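(* (Quantum Stokes Theorem) Let $(M,\omega)$ be a closed $2n$-dimensional symplectic manifold. For any $\alpha\in\Omega^j(M)$ we have $\int_h d\alpha=0$, $\int_h h\delta\alpha=0$, and therefore $$\int_h d_h\alpha=0.$$
   Context: The quantum integral $\int_h:\Omega(M)[h]\to\mathbb{R}[h]$ is the $\mathbb{R}[h]$-module map defined on $\alpha\in\Omega^j(M)$ by $\int_h\alpha=0$ if $j$ is odd, and $\int_h\alpha=\int_M\alpha\wedge\frac{\omega^k}{k!}$ if $j=2n-2k$ for an integer $k$. Let $w$ be the Poisson bivector field obtained from $\omega$ by raising indices: in a local frame $\{e_i\}$ of $TM$ with dual frame $\{e^i\}$, with $\omega_{ij}=\omega(e_i,e_j)$, the skew-symmetric matrix $w^{ij}=w(e^i,e^j)$ is the inverse of $(\omega_{ij})$. With $w\vdash\alpha=\tfrac12w^{ij}\,e_i\vdash(e_j\vdash\alpha)$ (summation over all repeated indices, $(v\vdash\alpha)(v_1,\dots)=\alpha(v,v_1,\dots)$), Koszul's operator $\delta:\Omega^k(M)\to\Omega^{k-1}(M)$ is $\delta\alpha=w\vdash d\alpha-d(w\vdash\alpha)$, and the quantum exterior differential is $d_h=d-h\delta$. *)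

theory Defs
  imports
    "HOL-Analysis.Analysis"
    "HOL-Computational_Algebra.Polynomial"
    "HOL-Library.Function_Algebras"
begin

section \<open>Smooth manifolds\<close>

text \<open>For open \<open>S\<close>: all iterated directional derivatives up to order \<open>k\<close> exist and are continuous.\<close>

primrec Ck_on :: "nat \<Rightarrow> ('e::real_normed_vector \<Rightarrow> 'f::real_normed_vector) \<Rightarrow> 'e set \<Rightarrow> bool" where
  "Ck_on 0 f S \<longleftrightarrow> continuous_on S f"
| "Ck_on (Suc k) f S \<longleftrightarrow>
     f differentiable_on S \<and> (\<forall>v. Ck_on k (\<lambda>x. frechet_derivative f (at x) v) S)"

definition smooth_on :: "('e::real_normed_vector \<Rightarrow> 'f::real_normed_vector) \<Rightarrow> 'e set \<Rightarrow> bool" where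
  "smooth_on f S \<longleftrightarrow> (\<forall>k. Ck_on k f S)"

text \<open>A chart is a pair \<open>(U, \<phi>)\<close> of a coordinate domain and a coordinate map.\<close>

type_synonym ('a, 'm) chart = "'a set \<times> ('a \<Rightarrow> real^'m)"

definition chart_image :: "('a, 'm::finite) chart \<Rightarrow> (real^'m) set" where
  "chart_image c = snd c ` fst c"

definition chart_inv :: "('a, 'm::finite) chart \<Rightarrow> real^'m \<Rightarrow> 'a" where
  "chart_inv c = inv_into (fst c) (snd c)"

definition transition :: "('a, 'm::finite) chart \<Rightarrow> ('a, 'm) chart \<Rightarrow> real^'m \<Rightarrow> real^'m" where
  "transition c c' = snd c' \<circ> chart_inv c"

definition is_chart :: "'a topology \<Rightarrow> ('a, 'm::finite) chart \<Rightarrow> bool" where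
  "is_chart M c \<longleftrightarrow> openin M (fst c) \<and> open (chart_image c) \<and>
     homeomorphic_map (subtopology M (fst c)) (top_of_set (chart_image c)) (snd c)"

text \<open>The dimension of the manifold is the cardinality of the index type \<open>'m\<close>.\<close>

locale smooth_manifold =
  fixes M :: "'a topology" and A :: "('a, 'm::finite) chart set"
  assumes Hausdorff: "Hausdorff_space M"
    and second_countable: "second_countable M"
    and charts: "\<And>c. c \<in> A \<Longrightarrow> is_chart M c"
    and covers: "(\<Union>c\<in>A. fst c) = topspace M"
    and smooth_transitions:
      "\<And>c c'. c \<in> A \<Longrightarrow> c' \<in> A \<Longrightarrow> smooth_on (transition c c') (snd c ` (fst c \<inter> fst c'))"

text \<open>There is no boundary, since chart images are open.\<close>

locale closed_manifold = smooth_manifold +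
  assumes compact: "compact_space M"

definition smooth_function :: "('a, 'm::finite) chart set \<Rightarrow> ('a \<Rightarrow> real) \<Rightarrow> bool" where
  "smooth_function A f \<longleftrightarrow> (\<forall>c\<in>A. smooth_on (f \<circ> chart_inv c) (chart_image c))"

section \<open>Differential forms\<close>

text \<open>
  A differential form is given by its local coordinate expressions: \<open>\<alpha> c x [v\<^sub>1, \<dots>, v\<^sub>k]\<close> is the value,
  at the point with coordinates \<open>x\<close> in the chart \<open>c\<close>, on the tangent vectors whose components in the
  coordinate frame of \<open>c\<close> are \<open>v\<^sub>1, \<dots>, v\<^sub>k\<close>. The expressions in two charts are related by pullback
  along the transition map. The length of the argument list records the degree, so that a sum
  of forms of different degrees is again of this type.
\<close>

type_synonym ('a, 'm) form = "('a, 'm) chart \<Rightarrow> real^'m \<Rightarrow> (real^'m) list \<Rightarrow> real"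

definition alternating_multilinear :: "nat \<Rightarrow> ('e::real_vector list \<Rightarrow> real) \<Rightarrow> bool" where
  "alternating_multilinear k f \<longleftrightarrow>
     (\<forall>vs. length vs \<noteq> k \<longrightarrow> f vs = 0) \<and>
     (\<forall>vs i. length vs = k \<longrightarrow> i < k \<longrightarrow> linear (\<lambda>v. f (vs[i := v]))) \<and>
     (\<forall>vs. length vs = k \<longrightarrow> \<not> distinct vs \<longrightarrow> f vs = 0)"

text \<open>The space of smooth \<open>k\<close>-forms. The first condition only normalises meaningless values.\<close>

definition Omega :: "('a, 'm::finite) chart set \<Rightarrow> nat \<Rightarrow> ('a, 'm) form set" where
  "Omega A k = {\<alpha>.
     (\<forall>c x vs. c \<notin> A \<or> x \<notin> chart_image c \<longrightarrow> \<alpha> c x vs = 0) \<and>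
     (\<forall>c\<in>A. \<forall>x\<in>chart_image c. alternating_multilinear k (\<alpha> c x)) \<and>
     (\<forall>c\<in>A. \<forall>vs. smooth_on (\<lambda>x. \<alpha> c x vs) (chart_image c)) \<and>
     (\<forall>c\<in>A. \<forall>c'\<in>A. \<forall>p\<in>fst c \<inter> fst c'. \<forall>vs.
        \<alpha> c (snd c p) vs =
        \<alpha> c' (snd c' p) (map (frechet_derivative (transition c c') (at (snd c p))) vs))}"

definition deg_part :: "nat \<Rightarrow> ('a, 'm::finite) form \<Rightarrow> ('a, 'm) form" where
  "deg_part j \<alpha> = (\<lambda>c x vs. if length vs = j then \<alpha> c x vs else 0)"

text \<open>
  The invariant formula for the exterior derivative, on constant vector fields of a chart:
  \<open>d\<alpha>(v\<^sub>0, \<dots>, v\<^sub>k) = \<Sum>\<^sub>i (-1)\<^sup>i v\<^sub>i \<cdot> \<alpha>(v\<^sub>0, \<dots>, v\<^sub>k)\<close>, where \<open>v\<^sub>i\<close> is omitted in the argument of \<open>\<alpha>\<close>.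
\<close>

definition ext_d :: "('a, 'm::finite) chart set \<Rightarrow> ('a, 'm) form \<Rightarrow> ('a, 'm) form" where
  "ext_d A \<alpha> = (\<lambda>c x vs.
     if c \<in> A \<and> x \<in> chart_image c
     then \<Sum>i<length vs. (-1)^i *
            frechet_derivative (\<lambda>y. \<alpha> c y (take i vs @ drop (Suc i) vs)) (at x) (vs ! i)
     else 0)"

text \<open>
  The sum over all shuffles: \<open>(\<alpha> \<and> \<beta>)(v\<^sub>0, \<dots>, v\<^sub>r) = \<Sum>\<^sub>S \<plusminus> \<alpha>(v\<^sub>S) \<beta>(v\<^sub>T)\<close> with \<open>T\<close> the complement of
  \<open>S\<close>. The convention is the one in which \<open>dx\<^sup>1 \<and> \<dots> \<and> dx\<^sup>m\<close> is the determinant.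
\<close>

definition shuffle_sign :: "nat set \<Rightarrow> real" where
  "shuffle_sign S = (-1) ^ card {(i, j). i \<in> S \<and> j \<notin> S \<and> j < i}"

definition wedge :: "('a, 'm::finite) form \<Rightarrow> ('a, 'm) form \<Rightarrow> ('a, 'm) form" where
  "wedge \<alpha> \<beta> = (\<lambda>c x vs. \<Sum>S\<in>Pow {..<length vs}.
     shuffle_sign S * \<alpha> c x (nths vs S) * \<beta> c x (nths vs (- S)))"

primrec wedge_power :: "('a, 'm::finite) form \<Rightarrow> nat \<Rightarrow> ('a, 'm) form" where
  "wedge_power \<alpha> 0 = (\<lambda>c x vs. if vs = [] then 1 else 0)"
| "wedge_power \<alpha> (Suc k) = wedge \<alpha> (wedge_power \<alpha> k)"

section \<open>Integration\<close>

text \<open>A smooth partition of unity, indexed by a finite set \<open>F\<close> of charts and subordinate to it.\<close>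

definition partition_of_unity ::
    "'a topology \<Rightarrow> ('a, 'm::finite) chart set \<Rightarrow> ('a, 'm) chart set \<Rightarrow>
     (('a, 'm) chart \<Rightarrow> 'a \<Rightarrow> real) \<Rightarrow> bool" where
  "partition_of_unity M A F \<rho> \<longleftrightarrow> finite F \<and> F \<subseteq> A \<and>
     (\<forall>c\<in>F. smooth_function A (\<rho> c)) \<and>
     (\<forall>c\<in>F. \<forall>p\<in>topspace M. 0 \<le> \<rho> c p) \<and>
     (\<forall>c\<in>F. M closure_of {p \<in> topspace M. \<rho> c p \<noteq> 0} \<subseteq> fst c) \<and>
     (\<forall>p\<in>topspace M. (\<Sum>c\<in>F. \<rho> c p) = 1)"

definition std_frame :: "(real^'m::finite) list" where
  "std_frame = (SOME bs. distinct bs \<and> set bs = Basis)"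

text \<open>
  The contribution of a chart to the integral of a top-degree form \<open>\<beta>\<close> over a manifold oriented by the
  nowhere vanishing top-degree form \<open>\<mu>\<close>. Charts are not assumed to be positively oriented: the
  factor \<open>sgn\<close> is the locally constant orientation sign of the coordinate frame. It also makes
  the ordering of \<open>std_frame\<close> irrelevant.
\<close>

definition local_integral ::
    "('a, 'm::finite) form \<Rightarrow> ('a, 'm) chart \<Rightarrow> ('a \<Rightarrow> real) \<Rightarrow> ('a, 'm) form \<Rightarrow> real" where
  "local_integral \<mu> c f \<beta> =
     integral (chart_image c)
       (\<lambda>x. f (chart_inv c x) * \<beta> c x std_frame * sgn (\<mu> c x std_frame))"

text \<open>As usual, any partition of unity may be used; the result does not depend on the choice.\<close>

definition manifold_integral ::
    "'a topology \<Rightarrow> ('a, 'm::finite) chart set \<Rightarrow> ('a, 'm) form \<Rightarrow> ('a, 'm) form \<Rightarrow> real" where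
  "manifold_integral M A \<mu> \<beta> =
     (let (F, \<rho>) = (SOME (F, \<rho>). partition_of_unity M A F \<rho>)
      in \<Sum>c\<in>F. local_integral \<mu> c (\<rho> c) \<beta>)"

section \<open>Symplectic manifolds and quantum calculus\<close>

locale closed_symplectic_manifold = closed_manifold M A
  for n :: nat and M :: "'a topology" and A :: "('a, 'm::finite) chart set" +
  fixes \<omega> :: "('a, 'm) form"
  assumes dimension: "CARD('m) = 2 * n"
    and two_form: "\<omega> \<in> Omega A 2"
    and d_closed: "ext_d A \<omega> = 0"
    and nondegenerate:
      "\<And>c x v. c \<in> A \<Longrightarrow> x \<in> chart_image c \<Longrightarrow> v \<noteq> 0 \<Longrightarrow> \<exists>u. \<omega> c x [v, u] \<noteq> 0"

text \<open>The components \<open>w\<^sup>i\<^sup>j\<close> of the Poisson bivector field, in the coordinate frame of the chart \<open>c\<close>.\<close>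

definition poisson :: "('a, 'm::finite) form \<Rightarrow> ('a, 'm) chart \<Rightarrow> real^'m \<Rightarrow> real^'m^'m" where
  "poisson \<omega> c x = matrix_inv (\<chi> i j. \<omega> c x [axis i 1, axis j 1])"

definition contract :: "'e \<Rightarrow> ('e list \<Rightarrow> real) \<Rightarrow> 'e list \<Rightarrow> real" where
  "contract v f = (\<lambda>vs. f (v # vs))"

definition poisson_contract :: "('a, 'm::finite) form \<Rightarrow> ('a, 'm) form \<Rightarrow> ('a, 'm) form" where
  "poisson_contract \<omega> \<alpha> = (\<lambda>c x vs. 1/2 * (\<Sum>i\<in>UNIV. \<Sum>j\<in>UNIV.
     poisson \<omega> c x $ i $ j * contract (axis i 1) (contract (axis j 1) (\<alpha> c x)) vs))"

definition koszul ::
    "('a, 'm::finite) chart set \<Rightarrow> ('a, 'm) form \<Rightarrow> ('a, 'm) form \<Rightarrow> ('a, 'm) form" where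
  "koszul A \<omega> \<alpha> = poisson_contract \<omega> (ext_d A \<alpha>) - ext_d A (poisson_contract \<omega> \<alpha>)"

text \<open>
  Elements of \<open>\<Omega>(M)[h]\<close> are polynomials with forms as coefficients, added pointwise as functions;
  multiplication by \<open>h\<close> is \<open>pCons 0\<close>. The coefficientwise extension of \<open>d\<close> and \<open>\<delta>\<close> is \<open>map_poly\<close>.
\<close>

definition quantum_d ::
    "('a, 'm::finite) chart set \<Rightarrow> ('a, 'm) form \<Rightarrow> ('a, 'm) form poly \<Rightarrow> ('a, 'm) form poly" where
  "quantum_d A \<omega> p = map_poly (ext_d A) p - pCons 0 (map_poly (koszul A \<omega>) p)"

text \<open>
  The quantum integral on \<open>j\<close>-forms, with \<open>M\<close> oriented by \<open>\<omega>\<^sup>n\<close>. For even \<open>j = 2n - 2k\<close> we have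
  \<open>k = n - j div 2\<close>; there are no nonzero \<open>j\<close>-forms with \<open>j > 2n\<close>.
\<close>

definition quantum_integral_deg ::
    "nat \<Rightarrow> 'a topology \<Rightarrow> ('a, 'm::finite) chart set \<Rightarrow> ('a, 'm) form \<Rightarrow>
     nat \<Rightarrow> ('a, 'm) form \<Rightarrow> real" where
  "quantum_integral_deg n M A \<omega> j \<alpha> =
     (if odd j \<or> j > 2 * n then 0
      else let k = n - j div 2 in
        manifold_integral M A (wedge_power \<omega> n)
          (wedge \<alpha> (\<lambda>c x vs. wedge_power \<omega> k c x vs / fact k)))"

text \<open>The extension to \<open>\<Omega>(M)[h]\<close>, additive in the degree and linear over \<open>\<real>[h]\<close>.\<close>

definition quantum_integral ::
    "nat \<Rightarrow> 'a topology \<Rightarrow> ('a, 'm::finite) chart set \<Rightarrow> ('a, 'm) form \<Rightarrow>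
     ('a, 'm) form poly \<Rightarrow> real poly" where
  "quantum_integral n M A \<omega> =
     map_poly (\<lambda>\<alpha>. \<Sum>j\<le>2 * n. quantum_integral_deg n M A \<omega> j (deg_part j \<alpha>))"

end

theory Submission
  imports Defs
begin

text \<open>
  Both integrands are exact up to a constant. Put \<open>\<omega>\<^sub>k = \<omega>\<^sup>k / k!\<close>. Since \<open>d\<omega> = 0\<close>, we have
  \<open>d\<alpha> \<and> \<omega>\<^sub>k = d(\<alpha> \<and> \<omega>\<^sub>k)\<close>. If \<open>\<alpha>\<close> has degree \<open>j\<close> with \<open>j + 2k > 2n\<close>, then \<open>\<alpha> \<and> \<omega>\<^sub>k = 0\<close>, and
  contracting with the Poisson bivector field yields
  \<open>(w \<turnstile> \<alpha>) \<and> \<omega>\<^sub>k = (j + k - n - 1) \<alpha> \<and> \<omega>\<^sub>k\<^sub>-\<^sub>1\<close>. Applied to \<open>\<alpha>\<close> and to \<open>d\<alpha>\<close>, this shows that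
  \<open>\<delta>\<alpha> \<and> \<omega>\<^sub>k\<close> is a multiple of \<open>d(\<alpha> \<and> \<omega>\<^sub>k\<^sub>-\<^sub>1)\<close>. So everything follows from Stokes' theorem.

  For Stokes' theorem take a partition of unity \<open>\<rho>\<^sub>c\<close>. Integration by parts in each chart gives
  \<open>\<Sum>\<^sub>c \<integral>\<^sub>c \<rho>\<^sub>c d\<beta> = - \<Sum>\<^sub>c \<integral>\<^sub>c d\<rho>\<^sub>c \<and> \<beta> = - \<Sum>\<^sub>c \<Sum>\<^sub>e \<integral>\<^sub>c \<rho>\<^sub>e d\<rho>\<^sub>c \<and> \<beta>\<close>. The last integrand lives
  on the overlap of the two charts, so it may be integrated in \<open>e\<close> instead, where the sum over \<open>c\<close>
  vanishes because \<open>\<Sum>\<^sub>c d\<rho>\<^sub>c = 0\<close>. In this way only the differential of functions, and not that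
  of \<open>\<beta>\<close>, has to be invariant under coordinate changes.
\<close>

text \<open>The formula for \<open>w \<turnstile> \<alpha>\<close> rests on a second-order Leibniz
  rule. Raising an index turns the contractions of \<omega> into the dual basis covectors, so the
  mixed terms form the Euler operator, the sum of all
  \<open>e\<^sup>i \<and> (e\<^sub>i \<turnstile> _)\<close>, which counts degrees. The formula
  applies because \<delta>\<alpha> is paired with \<open>\<omega>\<^sub>k\<close> only when \<alpha>
  has degree 2n - 2k + 1, so that the total degree exceeds the dimension by one. Its constant grows
  by 1 from \<alpha> to d\<alpha>, hence the multiple in question is 1. Stokes' theorem takes a
  global form, whereas the bivector field is handled chart by chart. Therefore \<delta>\<alpha> is
  traced back to \<open>\<alpha> \<and> \<omega>\<^sub>k\<^sub>-\<^sub>1\<close>, a product of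
  global forms. The integral is defined by a choice among partitions of unity. So Stokes' theorem is
  shown for an arbitrary one, and one is constructed, which makes the choice a genuine partition.
  Forms are functions of argument lists. Identities between them are proved by recursion on the
  list: contraction is an antiderivation of the wedge product, and Cartan's formula plays the same
  role for d.\<close>

text \<open>Inductive proofs leave eta-expanded function terms, which these rules would unfold.\<close>

declare plus_fun_apply [simp del] zero_fun_apply [simp del] minus_apply [simp del] uminus_apply [simp del]

section \<open>Exterior algebra in a single fibre\<close>

lemma contract_apply: "contract v f vs = f (v # vs)"
  by (simp add: contract_def)

lemmas fun_app = plus_fun_apply zero_fun_apply minus_apply uminus_apply contract_apply

text \<open>Restricted to arguments \<open>[]\<close> and \<open>v # vs\<close>, the rules fire on
  the clauses of \<open>Alt\<close>, which apply a form to such lists, and leave other applications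
  folded.\<close>

lemmas fun_app_list = plus_fun_apply[of _ _ "[]"] plus_fun_apply[of _ _ "v # vs" for v vs]
  zero_fun_apply[of "[]"] zero_fun_apply[of "v # vs" for v vs]

lemma contract_zero [simp]: "contract v 0 = 0"
  by (simp add: fun_eq_iff fun_app)

text \<open>The wedge product at one point, for arbitrary functions of lists. Its algebraic laws
  then carry no side conditions on degree or alternation.\<close>

definition fwedge :: "('e list \<Rightarrow> real) \<Rightarrow> ('e list \<Rightarrow> real) \<Rightarrow> 'e list \<Rightarrow> real" where
  "fwedge f g vs = (\<Sum>S\<in>Pow {..<length vs}. shuffle_sign S * f (nths vs S) * g (nths vs (- S)))"

text \<open>The grading involution. It carries the sign of the graded Leibniz rules without naming a
  degree.\<close>

definition twist :: "('e list \<Rightarrow> real) \<Rightarrow> 'e list \<Rightarrow> real" where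
  "twist f vs = (-1) ^ length vs * f vs"

definition funit :: "'e list \<Rightarrow> real" where
  "funit vs = (if vs = [] then 1 else 0)"

lemma wedge_eq_fwedge: "wedge \<alpha> \<beta> c x = fwedge (\<alpha> c x) (\<beta> c x)"
  by (simp add: wedge_def fwedge_def fun_eq_iff fun_app)

text \<open>The shift frees position 0, which forms one new inversion with each element of
  \<open>S\<close>; the old inversions are merely shifted.\<close>

lemma shuffle_sign_Suc_image:
  assumes "finite S"
  shows "shuffle_sign (Suc ` S) = (-1) ^ card S * shuffle_sign S"
proof -
  let ?P = "{(i, j). i \<in> S \<and> j \<notin> S \<and> j < i}"
  have fin: "finite ?P"
    by (rule finite_subset[of _ "Sigma S (\<lambda>i. {..<i})"]) (use assms in auto)
  have eq: "{(i, j). i \<in> Suc ` S \<and> j \<notin> Suc ` S \<and> j < i}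
      = (\<lambda>i. (Suc i, 0)) ` S \<union> map_prod Suc Suc ` ?P" (is "?A = ?B")
  proof
    show "?A \<subseteq> ?B"
    proof
      fix p assume "p \<in> ?A"
      then obtain i j where p: "p = (Suc i, j)" "i \<in> S" "j \<notin> Suc ` S" "j < Suc i" by auto
      show "p \<in> ?B"
        using p by (cases j) (auto simp: map_prod_def image_iff)
    qed
  qed auto
  have "card ?A = card ((\<lambda>i. (Suc i, 0::nat)) ` S) + card (map_prod Suc Suc ` ?P)"
    unfolding eq using assms fin by (intro card_Un_disjoint) auto
  also have "\<dots> = card S + card ?P"
    by (intro arg_cong2[of _ _ _ _ "(+)"] card_image) (auto simp: inj_on_def)
  finally show ?thesis
    by (simp add: shuffle_sign_def power_add)
qed

text \<open>A chosen position 0 takes part in no inversion: nothing precedes it, and it is not among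
  the skipped positions.\<close>

lemma shuffle_sign_insert_0: "shuffle_sign (insert 0 (Suc ` S)) = shuffle_sign S"
proof -
  let ?P = "{(i, j). i \<in> S \<and> j \<notin> S \<and> j < i}"
  have eq: "{(i, j). i \<in> insert 0 (Suc ` S) \<and> j \<notin> insert 0 (Suc ` S) \<and> j < i}
      = map_prod Suc Suc ` ?P" (is "?A = ?B")
  proof
    show "?A \<subseteq> ?B"
    proof
      fix p assume "p \<in> ?A"
      then obtain i j where p: "p = (Suc i, j)" "i \<in> S" "j \<noteq> 0" "j \<notin> Suc ` S" "j < Suc i" by auto
      show "p \<in> ?B"
        using p by (cases j) (auto simp: map_prod_def image_iff)
    qed
  qed auto
  have "card ?A = card ?P"
    unfolding eq by (intro card_image) (auto simp: inj_on_def)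
  then show ?thesis
    by (simp add: shuffle_sign_def)
qed

text \<open>The two parts tell whether a shuffle hands the first argument to the left or to the
  right factor.\<close>

lemma Pow_lessThan_Suc:
  "Pow {..<Suc n} = (\<lambda>S. insert 0 (Suc ` S)) ` Pow {..<n} \<union> (\<lambda>S. Suc ` S) ` Pow {..<n}"
proof -
  have "Pow {..<Suc n} = Pow (insert 0 (Suc ` {..<n}))"
    by (simp add: lessThan_Suc_eq_insert_0)
  also have "\<dots> = Pow (Suc ` {..<n}) \<union> insert 0 ` Pow (Suc ` {..<n})"
    by (rule Pow_insert)
  also have "Pow (Suc ` {..<n}) = (\<lambda>S. Suc ` S) ` Pow {..<n}"
    by (simp add: image_Pow_surj)
  finally show ?thesis
    by (auto simp: image_image)
qed

lemma fwedge_Nil [simp]: "fwedge f g [] = f [] * g []"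
  by (simp add: fwedge_def shuffle_sign_def)

text \<open>
  Interior products are antiderivations. Read as a recursion on the argument list, this replaces
  the combinatorics of shuffles by induction.
\<close>

lemma fwedge_Cons:
  "fwedge f g (v # vs) = fwedge (contract v f) g vs + fwedge (twist f) (contract v g) vs"
proof -
  let ?n = "length vs"
  let ?h = "\<lambda>S. shuffle_sign S * f (nths (v # vs) S) * g (nths (v # vs) (- S))"
  have "fwedge f g (v # vs) = sum ?h (Pow {..<Suc ?n})"
    by (simp add: fwedge_def)
  also have "\<dots> = sum ?h ((\<lambda>S. insert 0 (Suc ` S)) ` Pow {..<?n})
                  + sum ?h ((\<lambda>S. Suc ` S) ` Pow {..<?n})"
    unfolding Pow_lessThan_Suc by (rule sum.union_disjoint) auto
  also have "sum ?h ((\<lambda>S. insert 0 (Suc ` S)) ` Pow {..<?n})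
      = (\<Sum>S\<in>Pow {..<?n}. ?h (insert 0 (Suc ` S)))"
  proof (rule sum.reindex_cong[of "\<lambda>S. insert 0 (Suc ` S)"])
    show "inj_on (\<lambda>S. insert 0 (Suc ` S)) (Pow {..<?n})"
    proof (rule inj_onI)
      fix S T assume "insert 0 (Suc ` S) = insert 0 (Suc ` T)"
      then have "Suc ` S = Suc ` T" by (auto simp: insert_ident)
      then show "S = T" by (simp add: inj_image_eq_iff)
    qed
  qed auto
  also have "\<dots> = fwedge (contract v f) g vs"
    unfolding fwedge_def
  proof (rule sum.cong)
    fix S :: "nat set"
    have "{j. Suc j \<in> insert 0 (Suc ` S)} = S" "{j. Suc j \<in> - insert 0 (Suc ` S)} = - S" by auto
    then show "?h (insert 0 (Suc ` S))
        = shuffle_sign S * contract v f (nths vs S) * g (nths vs (- S))"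
      by (simp add: nths_Cons shuffle_sign_insert_0 fun_app)
  qed simp
  also have "sum ?h ((\<lambda>S. Suc ` S) ` Pow {..<?n}) = (\<Sum>S\<in>Pow {..<?n}. ?h (Suc ` S))"
    by (rule sum.reindex_cong[of "\<lambda>S. Suc ` S"]) (auto simp: inj_on_def inj_image_eq_iff)
  also have "\<dots> = fwedge (twist f) (contract v g) vs"
    unfolding fwedge_def
  proof (rule sum.cong)
    fix S assume S: "S \<in> Pow {..<?n}"
    have [simp]: "{j. Suc j \<in> Suc ` S} = S" "{j. Suc j \<notin> Suc ` S} = - S" by auto
    have "{i. i < ?n \<and> i \<in> S} = S" using S by auto
    moreover have "finite S" using S finite_subset by auto
    ultimately show "?h (Suc ` S)
        = shuffle_sign S * twist f (nths vs S) * contract v g (nths vs (- S))"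
      by (simp add: nths_Cons shuffle_sign_Suc_image twist_def length_nths fun_app)
  qed simp
  finally show ?thesis .
qed

lemma contract_fwedge: "contract v (fwedge f g) = fwedge (contract v f) g + fwedge (twist f) (contract v g)"
  by (simp add: fun_eq_iff fun_app fwedge_Cons)

lemma fwedge_add_left: "fwedge (f + g) h = fwedge f h + fwedge g h"
  by (simp add: fwedge_def fun_eq_iff fun_app algebra_simps sum.distrib)

lemma fwedge_add_right: "fwedge f (g + h) = fwedge f g + fwedge f h"
  by (simp add: fwedge_def fun_eq_iff fun_app algebra_simps sum.distrib)

lemma fwedge_minus_left: "fwedge (- f) g = - fwedge f g"
  by (simp add: fwedge_def fun_eq_iff fun_app sum_negf)

lemma fwedge_minus_right: "fwedge f (- g) = - fwedge f g"
  by (simp add: fwedge_def fun_eq_iff fun_app sum_negf)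

lemma fwedge_diff_left: "fwedge (f - g) h = fwedge f h - fwedge g h"
  by (simp add: fwedge_def fun_eq_iff fun_app algebra_simps sum_subtractf)

lemma fwedge_diff_right: "fwedge f (g - h) = fwedge f g - fwedge f h"
  by (simp add: fwedge_def fun_eq_iff fun_app algebra_simps sum_subtractf)

definition fscale :: "real \<Rightarrow> ('e list \<Rightarrow> real) \<Rightarrow> 'e list \<Rightarrow> real" where
  "fscale a f vs = a * f vs"

lemma fwedge_fscale_left: "fwedge (fscale a f) g = fscale a (fwedge f g)"
  by (simp add: fwedge_def fun_eq_iff fun_app fscale_def sum_distrib_left algebra_simps)

lemma fwedge_fscale_right: "fwedge f (fscale a g) = fscale a (fwedge f g)"
  by (simp add: fwedge_def fun_eq_iff fun_app fscale_def sum_distrib_left algebra_simps)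

lemma fwedge_zero_left [simp]: "fwedge 0 g = 0"
  by (simp add: fwedge_def fun_eq_iff fun_app)

lemma fwedge_zero_right [simp]: "fwedge f 0 = 0"
  by (simp add: fwedge_def fun_eq_iff fun_app)

lemma fwedge_sum_left: "fwedge (\<Sum>i\<in>I. f i) g = (\<Sum>i\<in>I. fwedge (f i) g)"
  by (induction I rule: infinite_finite_induct) (simp_all add: fwedge_add_left)

lemma fwedge_sum_right: "fwedge f (\<Sum>i\<in>I. g i) = (\<Sum>i\<in>I. fwedge f (g i))"
  by (induction I rule: infinite_finite_induct) (simp_all add: fwedge_add_right)

lemma fscale_simps [simp]:
  "fscale 1 f = f" "fscale 0 f = 0" "fscale a 0 = 0" "fscale a (fscale b f) = fscale (a * b) f"
  "fscale (-1) f = - f"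
  by (simp_all add: fun_eq_iff fun_app fscale_def)

lemma fscale_add_right: "fscale a (f + g) = fscale a f + fscale a g"
  and fscale_diff_right: "fscale a (f - g) = fscale a f - fscale a g"
  and fscale_minus_left: "fscale (- a) f = - fscale a f"
  by (simp_all add: fun_eq_iff fun_app fscale_def algebra_simps)

lemma fscale_sum_right: "fscale a (\<Sum>i\<in>I. f i) = (\<Sum>i\<in>I. fscale a (f i))"
  by (induction I rule: infinite_finite_induct) (simp_all add: fscale_add_right)

lemma contract_add: "contract v (f + g) = contract v f + contract v g"
  and contract_diff: "contract v (f - g) = contract v f - contract v g"
  and contract_fscale: "contract v (fscale a f) = fscale a (contract v f)"
  and contract_twist: "contract v (twist f) = - twist (contract v f)"
  by (simp_all add: fun_eq_iff fun_app fscale_def twist_def)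

lemma contract_sum: "contract v (\<Sum>i\<in>I. f i) = (\<Sum>i\<in>I. contract v (f i))"
  by (induction I rule: infinite_finite_induct) (simp_all add: contract_add)

lemma twist_twist [simp]: "twist (twist f) = f"
  by (auto simp: fun_eq_iff fun_app twist_def)

lemma twist_fwedge: "twist (fwedge f g) = fwedge (twist f) (twist g)"
proof
  fix vs
  show "twist (fwedge f g) vs = fwedge (twist f) (twist g) vs"
  proof (induction vs arbitrary: f g)
    case Nil
    then show ?case by (simp add: twist_def)
  next
    case (Cons v vs)
    have "twist (fwedge f g) (v # vs) = - twist (fwedge (contract v f) g) vs - twist (fwedge (twist f) (contract v g)) vs"
      by (simp add: twist_def fwedge_Cons algebra_simps)
    then show ?case
      by (simp add: fwedge_Cons Cons.IH contract_twist fwedge_minus_left fwedge_minus_right)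
        (simp add: uminus_apply)
  qed
qed

lemma contract_funit [simp]: "contract v funit = 0"
  by (simp add: fun_eq_iff fun_app funit_def)

lemma fwedge_funit_left [simp]: "fwedge funit f = f"
proof
  fix vs
  have "twist funit = (funit :: 'a list \<Rightarrow> real)" by (simp add: fun_eq_iff fun_app funit_def twist_def)
  then show "fwedge funit f vs = f vs"
    by (induction vs arbitrary: f) (auto simp: fwedge_Cons funit_def[of "[]"] fun_app)
qed

text \<open>Both sides obey the same recursion under contraction. The induction runs over all three
  factors at once, because contraction and \<open>twist\<close> change them.\<close>

lemma fwedge_assoc: "fwedge (fwedge f g) h = fwedge f (fwedge g h)"
proof
  fix vs
  show "fwedge (fwedge f g) h vs = fwedge f (fwedge g h) vs"
    by (induction vs arbitrary: f g h)
      (simp_all add: fwedge_Cons contract_fwedge fwedge_add_left fwedge_add_right twist_fwedge fun_app)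
qed

text \<open>The parities of the two degrees are encoded by \<open>s\<close> and \<open>t\<close>.\<close>

lemma fwedge_commute_parity:
  assumes "twist f = fscale s f" "twist g = fscale t g" "s \<in> {1, -1}" "t \<in> {1, -1}"
  shows "fwedge f g = fscale (if s = -1 \<and> t = -1 then -1 else 1) (fwedge g f)"
proof
  fix vs
  show "fwedge f g vs = fscale (if s = -1 \<and> t = -1 then -1 else 1) (fwedge g f) vs"
    using assms
  proof (induction vs arbitrary: f g s t)
    case Nil
    \<comment> \<open>A function of odd parity vanishes on the empty list, so the sign is immaterial
      there.\<close>
    have "f [] = s * f []" "g [] = t * g []"
      using Nil.prems(1,2) by (auto simp: fun_eq_iff fun_app twist_def fscale_def dest!: spec[of _ "[]"])
    then show ?case using Nil.prems(3,4) by (auto simp: fscale_def)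
  next
    case (Cons v vs)
    \<comment> \<open>Contraction shifts the degree by one and thus flips the parity.\<close>
    have f: "twist (contract v f) = fscale (- s) (contract v f)"
      using arg_cong[OF Cons.prems(1), of "contract v"]
      by (simp add: contract_twist contract_fscale fscale_minus_left) (metis minus_minus)
    have g: "twist (contract v g) = fscale (- t) (contract v g)"
      using arg_cong[OF Cons.prems(2), of "contract v"]
      by (simp add: contract_twist contract_fscale fscale_minus_left) (metis minus_minus)
    have "fwedge f g (v # vs) = fwedge (contract v f) g vs + s * fwedge f (contract v g) vs"
      by (simp only: fwedge_Cons Cons.prems(1) fwedge_fscale_left) (simp add: fscale_def)
    moreover have "fwedge g f (v # vs) = fwedge (contract v g) f vs + t * fwedge g (contract v f) vs"
      by (simp only: fwedge_Cons Cons.prems(2) fwedge_fscale_left) (simp add: fscale_def)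
    moreover note Cons.IH[OF f Cons.prems(2)] Cons.IH[OF Cons.prems(1) g]
    ultimately show ?case using Cons.prems(3,4) by (auto simp: fscale_def)
  qed
qed

lemma fwedge_map: "fwedge f g (map L vs) = fwedge (\<lambda>us. f (map L us)) (\<lambda>us. g (map L us)) vs"
  by (simp add: fwedge_def nths_map)

primrec fpower :: "('e list \<Rightarrow> real) \<Rightarrow> nat \<Rightarrow> 'e list \<Rightarrow> real" where
  "fpower f 0 = funit"
| "fpower f (Suc k) = fwedge f (fpower f k)"

lemma wedge_power_eq_fpower: "wedge_power \<omega> k c x = fpower (\<omega> c x) k"
proof (induction k)
  case 0
  show ?case by (simp add: funit_def fun_eq_iff)
next
  case (Suc k)
  then show ?case by (simp add: wedge_eq_fwedge)
qed

text \<open>The power rule for an antiderivation. An even \<open>f\<close> commutes with its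
  contraction, so all summands of the Leibniz rule coincide.\<close>

lemma contract_fpower:
  assumes "twist f = f"
  shows "contract v (fpower f (Suc k)) = fscale (Suc k) (fwedge (contract v f) (fpower f k))"
proof (induction k)
  case 0
  then show ?case by (simp add: contract_fwedge)
next
  case (Suc k)
  have "twist (contract v f) = - contract v f"
    using arg_cong[OF assms, of "contract v"] by (simp add: contract_twist) (metis minus_minus)
  then have comm: "fwedge f (contract v f) = fwedge (contract v f) f"
    using fwedge_commute_parity[of f 1 "contract v f" "-1"] assms by simp
  have "contract v (fpower f (Suc (Suc k)))
      = fwedge (contract v f) (fpower f (Suc k)) + fwedge f (contract v (fpower f (Suc k)))"
    using contract_fwedge[of v f "fpower f (Suc k)"] by (simp add: assms)
  also have "fwedge f (contract v (fpower f (Suc k)))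
      = fscale (Suc k) (fwedge (contract v f) (fpower f (Suc k)))"
    unfolding Suc.IH fwedge_fscale_right by (simp add: comm flip: fwedge_assoc)
  also have "F + fscale (Suc k) F = fscale (Suc (Suc k)) F" for F :: "'a list \<Rightarrow> real"
    by (simp add: fun_eq_iff fun_app fscale_def algebra_simps)
  finally show ?case .
qed

section \<open>Alternating forms\<close>

text \<open>A recursive form of \<open>alternating_multilinear\<close>, equivalent by
  \<open>Alt_iff_alternating_multilinear\<close>. It constrains only the first two arguments and
  leaves the others to the contractions, which suits inductions through
  \<open>fwedge_Cons\<close>.\<close>

primrec Alt :: "nat \<Rightarrow> ('e::real_vector list \<Rightarrow> real) \<Rightarrow> bool" where
  "Alt 0 f \<longleftrightarrow> (\<forall>vs. vs \<noteq> [] \<longrightarrow> f vs = 0)"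
| "Alt (Suc k) f \<longleftrightarrow> f [] = 0 \<and> (\<forall>vs. linear (\<lambda>v. f (v # vs))) \<and>
     (\<forall>v. Alt k (contract v f)) \<and> (\<forall>v. contract v (contract v f) = 0)"

lemma Alt_length: "Alt k f \<Longrightarrow> length vs \<noteq> k \<Longrightarrow> f vs = 0"
proof (induction k arbitrary: f vs)
  case (Suc k)
  show ?case
  proof (cases vs)
    case (Cons v us)
    then show ?thesis using Suc.IH[of "contract v f" us] Suc.prems by (simp add: contract_apply[of v f us])
  qed (use Suc.prems in simp)
qed auto

lemma Alt_twist:
  assumes "Alt k f" shows "twist f = fscale ((-1) ^ k) f"
proof
  fix vs show "twist f vs = fscale ((-1) ^ k) f vs"
    using Alt_length[OF assms, of vs] by (cases "length vs = k") (auto simp: twist_def fscale_def)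
qed

lemma Alt_zero [simp]: "Alt k 0"
proof (induction k)
  case (Suc k)
  then show ?case by (simp add: module_hom_zero fun_app_list)
qed (simp add: fun_app)

lemma Alt_add: "Alt k f \<Longrightarrow> Alt k g \<Longrightarrow> Alt k (f + g)"
proof (induction k arbitrary: f g)
  case (Suc k)
  then show ?case by (auto simp: contract_add fun_app_list intro!: linear_compose_add)
qed (auto simp: fun_app)

lemma Alt_fscale: "Alt k f \<Longrightarrow> Alt k (fscale a f)"
proof (induction k arbitrary: f)
  case (Suc k)
  have "linear (\<lambda>v. a *\<^sub>R f (v # vs))" for vs
    using Suc.prems by (intro linear_compose_scale_right) auto
  with Suc show ?case by (auto simp: contract_fscale) (auto simp: fscale_def)
qed (auto simp: fscale_def)

lemma Alt_uminus: "Alt k f \<Longrightarrow> Alt k (- f)"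
  using Alt_fscale[of k f "-1"] by simp

lemma Alt_twist_Alt: "Alt k f \<Longrightarrow> Alt k (twist f)"
  by (simp add: Alt_twist Alt_fscale)

lemma Alt_linear: "Alt k f \<Longrightarrow> linear (\<lambda>v. f (v # vs))"
  by (cases k) (auto simp: module_hom_zero)

lemma Alt_0_contract: "Alt 0 f \<Longrightarrow> contract v f = 0"
  by (auto simp: fun_eq_iff fun_app)

lemma Alt_contract_twice: "Alt k f \<Longrightarrow> contract v (contract v f) = 0"
  by (cases k) (auto simp: Alt_0_contract)

lemma linear_fwedge_left:
  assumes "\<And>us. linear (\<lambda>v. F v us)"
  shows "linear (\<lambda>v. fwedge (F v) g vs)"
  unfolding fwedge_def
proof (rule linear_compose_sum, rule ballI)
  fix S
  have "linear (\<lambda>v. (shuffle_sign S * g (nths vs (- S))) *\<^sub>R F v (nths vs S))"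
    by (intro linear_compose_scale_right assms)
  then show "linear (\<lambda>v. shuffle_sign S * F v (nths vs S) * g (nths vs (- S)))"
    by (simp add: mult_ac)
qed

lemma linear_fwedge_right:
  assumes "\<And>us. linear (\<lambda>v. G v us)"
  shows "linear (\<lambda>v. fwedge f (G v) vs)"
  unfolding fwedge_def
proof (rule linear_compose_sum, rule ballI)
  fix S
  have "linear (\<lambda>v. (shuffle_sign S * f (nths vs S)) *\<^sub>R G v (nths vs (- S)))"
    by (intro linear_compose_scale_right assms)
  then show "linear (\<lambda>v. shuffle_sign S * f (nths vs S) * G v (nths vs (- S)))"
    by simp
qed

text \<open>The induction is on the total degree, since a contraction lowers the degree of only one
  of the factors.\<close>

lemma Alt_fwedge: "Alt j f \<Longrightarrow> Alt k g \<Longrightarrow> Alt (j + k) (fwedge f g)"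
proof (induction "j + k" arbitrary: j k f g)
  case 0
  then have "fwedge f g vs = 0" if "vs \<noteq> []" for vs
    using that by (cases vs) (auto simp: fwedge_Cons Alt_0_contract fun_app)
  with 0 show ?case by simp
next
  case (Suc m)
  have left: "Alt m (fwedge (contract v f) g)" for v
  proof (cases j)
    case 0
    then show ?thesis using Suc.prems by (simp add: Alt_0_contract)
  next
    case (Suc j')
    then show ?thesis using Suc.hyps(1)[of j' k "contract v f" g] Suc.hyps(2) Suc.prems by simp
  qed
  have right: "Alt m (fwedge (twist f) (contract v g))" for v
  proof (cases k)
    case 0
    then show ?thesis using Suc.prems by (simp add: Alt_0_contract)
  next
    case (Suc k')
    then show ?thesis
      using Suc.hyps(1)[of j k' "twist f" "contract v g"] Suc.hyps(2) Suc.prems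
      by (simp add: Alt_twist_Alt)
  qed
  have "f [] = 0 \<or> g [] = 0"
    using Suc.hyps(2) Alt_length[OF Suc.prems(1), of "[]"] Alt_length[OF Suc.prems(2), of "[]"]
    by (cases j) auto
  moreover have "linear (\<lambda>v. fwedge f g (v # vs))" for vs
    using Suc.prems unfolding fwedge_Cons
    by (intro linear_compose_add linear_fwedge_left linear_fwedge_right) (auto simp: contract_apply intro: Alt_linear)
  moreover have "Alt m (contract v (fwedge f g))" for v
    unfolding contract_fwedge by (intro Alt_add left right)
  \<comment> \<open>The two mixed terms contain one contraction of each factor. They differ by the
    sign from \<open>contract_twist\<close> and cancel.\<close>
  moreover have "contract v (contract v (fwedge f g)) = 0" for v
    using Alt_contract_twice[OF Suc.prems(1)] Alt_contract_twice[OF Suc.prems(2)]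
    by (simp add: contract_fwedge contract_add contract_twist fwedge_minus_left)
  ultimately show ?case
    unfolding Suc.hyps(2)[symmetric] by auto
qed

lemma Alt_fpower:
  assumes "Alt j f" shows "Alt (k * j) (fpower f k)"
proof (induction k)
  case (Suc k)
  then show ?case using Alt_fwedge[OF assms Suc.IH] by simp
qed (simp add: funit_def)

text \<open>Polarisation: expand the vanishing value at \<open>u + v, u + v\<close>.\<close>

lemma Alt_swap:
  assumes "Alt k f"
  shows "f (u # v # vs) = - f (v # u # vs)"
proof -
  have lin1: "linear (\<lambda>x. f (x # us))" for us by (rule Alt_linear[OF assms])
  have lin2: "linear (\<lambda>x. f (a # x # us))" for a us
  proof (cases k)
    case 0
    then show ?thesis using assms by (simp add: module_hom_zero)
  next
    case (Suc m)
    then show ?thesis using Alt_linear[of m "contract a f"] assms by (simp add: fun_app)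
  qed
  have zero: "f (x # x # vs) = 0" for x
    using fun_cong[OF Alt_contract_twice[OF assms], of x vs] by (simp add: fun_app)
  have "f ((u + v) # (u + v) # vs)
      = f (u # u # vs) + f (u # v # vs) + (f (v # u # vs) + f (v # v # vs))"
    by (simp only: linear_add[OF lin1] linear_add[OF lin2])
  then show ?thesis
    by (simp only: zero)
qed

lemma Alt_contract: "Alt k f \<Longrightarrow> Alt (k - 1) (contract v f)"
  by (cases k) (auto simp: Alt_0_contract)

text \<open>Swapping the leading \<open>v\<close> behind \<open>p\<close> lets \<open>p\<close> be
  contracted away, which brings the two copies closer.\<close>

lemma Alt_repeat: "Alt k f \<Longrightarrow> f (v # ps @ v # qs) = 0"
proof (induction ps arbitrary: k f)
  case Nil
  then show ?case using fun_cong[OF Alt_contract_twice[OF Nil], of v qs] by (simp add: fun_app)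
next
  case (Cons p ps)
  have "f (v # p # ps @ v # qs) = - contract p f (v # ps @ v # qs)"
    using Alt_swap[OF Cons.prems, of v p] by (simp add: fun_app)
  also have "\<dots> = 0" using Cons.IH[OF Alt_contract[OF Cons.prems]] by simp
  finally show ?case by simp
qed

lemma Alt_not_distinct: "Alt k f \<Longrightarrow> \<not> distinct vs \<Longrightarrow> f vs = 0"
proof (induction vs arbitrary: k f)
  case (Cons v vs)
  show ?case
  proof (cases "v \<in> set vs")
    case True
    then obtain ps qs where "vs = ps @ v # qs" by (meson split_list)
    then show ?thesis using Alt_repeat[OF Cons.prems(1)] by simp
  next
    case False
    then show ?thesis
      using Cons.IH[OF Alt_contract[OF Cons.prems(1), of v]] Cons.prems(2) by (simp add: fun_app)
  qed
qed simp

lemma Alt_linear_nth: "Alt k f \<Longrightarrow> i < length vs \<Longrightarrow> linear (\<lambda>v. f (vs[i := v]))"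
proof (induction i arbitrary: k f vs)
  case 0
  then show ?case by (cases vs) (auto intro: Alt_linear)
next
  case (Suc i)
  obtain w us where vs: "vs = w # us" using Suc.prems by (cases vs) auto
  show ?case using Suc.IH[OF Alt_contract[OF Suc.prems(1)], of us w] Suc.prems(2) vs by (simp add: fun_app)
qed

lemma alternating_multilinear_contract:
  assumes "alternating_multilinear (Suc k) f"
  shows "alternating_multilinear k (contract v f)"
  unfolding alternating_multilinear_def
proof (intro conjI allI impI)
  fix vs :: "'a list" and i assume "length vs = k" "i < k"
  then show "linear (\<lambda>w. contract v f (vs[i := w]))"
    using assms[unfolded alternating_multilinear_def, THEN conjunct2, THEN conjunct1,
        rule_format, of "v # vs" "Suc i"] by (simp add: contract_apply)
qed (use assms in \<open>auto simp: alternating_multilinear_def fun_app\<close>)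

lemma Alt_iff_alternating_multilinear: "Alt k f \<longleftrightarrow> alternating_multilinear k f"
proof
  assume "Alt k f"
  then show "alternating_multilinear k f"
    unfolding alternating_multilinear_def
    by (auto intro: Alt_length Alt_linear_nth Alt_not_distinct)
next
  show "alternating_multilinear k f \<Longrightarrow> Alt k f"
  proof (induction k arbitrary: f)
    case 0
    then show ?case by (auto simp: alternating_multilinear_def)
  next
    case (Suc k)
    have len: "f vs = 0" if "length vs \<noteq> Suc k" for vs
      using that Suc.prems by (auto simp: alternating_multilinear_def)
    have "linear (\<lambda>v. f (v # vs))" for vs
    proof (cases "length vs = k")
      case True
      have "linear (\<lambda>v. f ((0 # vs)[0 := v]))"
        using Suc.prems[unfolded alternating_multilinear_def, THEN conjunct2, THEN conjunct1,
            rule_format, of "0 # vs" 0] True by simp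
      then show ?thesis by simp
    qed (simp add: len module_hom_zero)
    moreover have "contract v (contract v f) = 0" for v
    proof
      fix vs
      show "contract v (contract v f) vs = 0 vs"
        using Suc.prems len[of "v # v # vs"] unfolding alternating_multilinear_def
          by (cases "length (v # v # vs) = Suc k") (auto simp: fun_app)
    qed
    ultimately show ?case
      using len[of "[]"] Suc.IH[OF alternating_multilinear_contract[OF Suc.prems]] by simp
  qed
qed

lemma Alt_map:
  assumes "Alt k f" "linear L"
  shows "Alt k (\<lambda>vs. f (map L vs))"
  using assms(1)
proof (induction k arbitrary: f)
  case (Suc k)
  have "linear (\<lambda>v. f (L v # map L vs))" for vs
    using linear_compose[OF assms(2), of "\<lambda>v. f (v # map L vs)"] Suc.prems by (simp add: o_def)
  moreover have "Alt k (contract v (\<lambda>vs. f (map L vs)))" for v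
    using Suc.IH[of "contract (L v) f"] Suc.prems by (simp add: contract_def)
  moreover have "f (L v # L v # map L vs) = 0" for v vs
    using Alt_contract_twice[OF Suc.prems, of "L v"] by (auto simp: fun_eq_iff fun_app)
  ultimately show ?case using Suc.prems by (auto simp: fun_eq_iff fun_app)
qed auto

section \<open>Values on basis vectors, and forms of top degree\<close>

lemma Alt_eq_0_basis:
  fixes f :: "'e::euclidean_space list \<Rightarrow> real"
  assumes "Alt k f" "\<And>vs. set vs \<subseteq> Basis \<Longrightarrow> length vs = k \<Longrightarrow> f vs = 0"
  shows "f = 0"
  using assms
proof (induction k arbitrary: f)
  case 0
  then show ?case by (auto simp: fun_eq_iff fun_app) (metis list.set(1) empty_subsetI list.size(3))
next
  case (Suc k)
  have b: "contract b f = 0" if "b \<in> Basis" for b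
  proof (rule Suc.IH)
    show "Alt k (contract b f)" using Suc.prems(1) by simp
  qed (use Suc.prems(2) that in \<open>simp add: contract_apply\<close>)
  show ?case
  proof
    fix vs
    show "f vs = 0 vs"
    proof (cases vs)
      case (Cons v us)
      have "(\<lambda>v. f (v # us)) = (\<lambda>v. 0)"
        using b
        by (intro linear_eq_stdbasis[OF Alt_linear[OF Suc.prems(1)] module_hom_zero]) (auto simp: fun_eq_iff fun_app)
      then show ?thesis using Cons by (auto dest: fun_cong simp: zero_fun_apply)
    qed (use Suc.prems in \<open>simp add: fun_app\<close>)
  qed
qed

text \<open>Absolute values absorb the sign of the permutation, so no signs have to be
  tracked.\<close>

lemma Alt_move: "Alt k f \<Longrightarrow> \<bar>f (ps @ x # qs)\<bar> = \<bar>f (x # ps @ qs)\<bar>"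
proof (induction ps arbitrary: k f)
  case (Cons p ps)
  have "\<bar>f (p # ps @ x # qs)\<bar> = \<bar>f (p # x # ps @ qs)\<bar>"
    using Cons.IH[OF Alt_contract[OF Cons.prems, of p]] by (simp add: fun_app)
  also have "\<dots> = \<bar>f (x # p # ps @ qs)\<bar>"
    using Alt_swap[OF Cons.prems, of p x] by simp
  finally show ?case by simp
qed simp

lemma Alt_permute: "Alt k f \<Longrightarrow> mset xs = mset ys \<Longrightarrow> \<bar>f xs\<bar> = \<bar>f ys\<bar>"
proof (induction xs arbitrary: k f ys)
  case (Cons x xs)
  then have "x \<in> set ys" by (metis list.set_intros(1) set_mset_mset)
  then obtain ps qs where ys: "ys = ps @ x # qs" by (meson split_list)
  with Cons.prems have "mset xs = mset (ps @ qs)" by simp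
  from Cons.IH[OF Alt_contract[OF Cons.prems(1), of x] this] show ?case
    using Alt_move[OF Cons.prems(1), of ps x qs] ys by (simp add: fun_app)
qed simp

text \<open>Distinct basis vectors in full number are a permutation of \<open>bs\<close>. This is
  the one-dimensionality of the space of top-degree forms.\<close>

lemma Alt_top_eq_0:
  fixes f :: "'e::euclidean_space list \<Rightarrow> real"
  assumes "Alt (length bs) f" "distinct bs" "set bs = Basis" "f bs = 0"
  shows "f = 0"
proof (rule Alt_eq_0_basis[OF assms(1)])
  fix vs assume vs: "set vs \<subseteq> (Basis :: 'e set)" "length vs = length bs"
  show "f vs = 0"
  proof (cases "distinct vs")
    case True
    have "card (set vs) = card (Basis :: 'e set)"
      using vs True assms(2,3) by (metis distinct_card)
    then have "set vs = set bs" using vs assms(3) card_subset_eq[OF finite_Basis] by blast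
    then have "mset vs = mset bs" using True assms(2) set_eq_iff_mset_eq_distinct by blast
    then show ?thesis using Alt_permute[OF assms(1)] assms(4) by (metis abs_eq_0)
  qed (rule Alt_not_distinct[OF assms(1)])
qed

lemma Alt_degree_gt_DIM:
  fixes f :: "'e::euclidean_space list \<Rightarrow> real"
  assumes "Alt k f" "k > DIM('e)"
  shows "f = 0"
proof (rule Alt_eq_0_basis[OF assms(1)])
  fix vs assume vs: "set vs \<subseteq> (Basis :: 'e set)" "length vs = k"
  then have "\<not> distinct vs"
    using assms(2) card_mono[OF finite_Basis vs(1)] distinct_card by fastforce
  then show "f vs = 0" by (rule Alt_not_distinct[OF assms(1)])
qed

lemma std_frame:
  "distinct (std_frame :: (real^'m::finite) list)" "set (std_frame :: (real^'m) list) = Basis"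
  "length (std_frame :: (real^'m) list) = CARD('m)"
proof -
  have "\<exists>bs. distinct bs \<and> set bs = (Basis :: (real^'m) set)"
    using finite_distinct_list[OF finite_Basis] by blast
  then have "distinct (std_frame :: (real^'m) list) \<and> set (std_frame :: (real^'m) list) = Basis"
    unfolding std_frame_def by (rule someI_ex)
  then show *: "distinct (std_frame :: (real^'m::finite) list)" "set (std_frame :: (real^'m) list) = Basis"
    by auto
  have "length (std_frame :: (real^'m) list) = card (Basis :: (real^'m) set)"
    using distinct_card[OF *(1)] *(2) by simp
  then show "length (std_frame :: (real^'m) list) = CARD('m)" by simp
qed

lemma Alt_diff: "Alt k f \<Longrightarrow> Alt k g \<Longrightarrow> Alt k (f - g)"
  using Alt_add[of k f "- g"] Alt_uminus[of k g] by simp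

text \<open>The determinant, as a function of the rows, is itself a top-degree form. Hence
  \<open>f\<close> is the determinant times its value on the standard frame.\<close>

lemma Alt_top_map:
  fixes f :: "(real^'m::finite) list \<Rightarrow> real"
  assumes f: "Alt CARD('m) f" and L: "linear L"
  shows "f (map L std_frame) = det (matrix L) * f std_frame"
proof -
  let ?bs = "std_frame :: (real^'m) list"
  let ?N = "CARD('m)"
  have ex: "\<exists>k<?N. ?bs ! k = axis i 1" for i :: 'm
  proof -
    have "axis i 1 \<in> set ?bs" unfolding std_frame by (simp add: axis_in_Basis_iff)
    then show ?thesis by (metis in_set_conv_nth std_frame(3))
  qed
  \<comment> \<open>\<open>std_frame\<close> is an arbitrary enumeration of the basis. Sorting rows
    by the position of each axis vector makes the frame the identity matrix, whatever its
    order.\<close>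
  define ix where "ix i = (SOME k. k < ?N \<and> ?bs ! k = axis i 1)" for i :: 'm
  have ix: "ix i < ?N" "?bs ! ix i = axis i 1" for i
    using someI_ex[OF ex[of i]] unfolding ix_def by auto
  have inj: "ix i = ix j \<longleftrightarrow> i = j" for i j
  proof
    assume "ix i = ix j"
    then have "axis i (1::real) = axis j 1" using ix(2)[of i] ix(2)[of j] by argo
    then show "i = j" by (simp add: axis_eq_axis)
  qed simp
  have surj: "\<exists>i. ix i = k" if "k < ?N" for k
  proof -
    have "card (range ix) = ?N" by (simp add: card_image inj_def inj)
    then have "range ix = {..<?N}" using ix(1) by (intro card_subset_eq) auto
    then show ?thesis using that by (metis (no_types, lifting) imageE lessThan_iff)
  qed
  let ?D = "\<lambda>vs. det (\<chi> i. vs ! ix i) * f ?bs"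
  let ?g = "\<lambda>vs. if length vs = ?N then ?D vs else 0"
  have "alternating_multilinear ?N ?g"
    unfolding alternating_multilinear_def
  proof (intro conjI allI impI)
    fix vs :: "(real^'m) list" and k assume vs: "length vs = ?N" "k < ?N"
    obtain i where i: "ix i = k" using surj[OF vs(2)] by blast
    have e: "(\<chi> l. vs[k := v] ! ix l) = (\<chi> l. if l = i then v else vs ! ix l)" for v
      using i vs by (auto simp: vec_eq_iff nth_list_update inj)
    have "linear (\<lambda>v. f ?bs *\<^sub>R det (\<chi> l. if l = i then v else vs ! ix l))"
      by (intro linear_compose_scale_right linearI)
         (simp_all add: det_row_add det_row_mul[where 'a = real, unfolded scalar_mult_eq_scaleR])
    then show "linear (\<lambda>v. ?g (vs[k := v]))"
      using vs by (simp add: e mult.commute)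
  next
    fix vs :: "(real^'m) list" assume vs: "length vs = ?N" "\<not> distinct vs"
    then obtain a b where "a < ?N" "b < ?N" "a \<noteq> b" "vs ! a = vs ! b"
      by (metis distinct_conv_nth)
    moreover then obtain i j where "ix i = a" "ix j = b" using surj by meson
    ultimately have "det (\<chi> i. vs ! ix i) = 0"
      by (intro det_identical_rows[of i j]) (auto simp: row_def)
    then show "?g vs = 0" by simp
  qed auto
  then have g: "Alt ?N ?g" by (simp add: Alt_iff_alternating_multilinear)
  have "(\<chi> i. ?bs ! ix i) = mat 1"
    by (simp add: ix vec_eq_iff mat_def axis_def)
  then have "(f - ?g) ?bs = 0" by (simp add: std_frame minus_apply)
  then have "f - ?g = 0"
    by (intro Alt_top_eq_0[OF _ std_frame(1,2)]) (simp_all add: std_frame Alt_diff f g)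
  then have "f = ?g" by (simp only: right_minus_eq)
  then have "f (map L ?bs) = ?g (map L ?bs)" by (rule fun_cong)
  also have "\<dots> = det (\<chi> i. L (axis i 1)) * f ?bs"
    by (simp add: std_frame ix)
  also have "(\<chi> i. L (axis i 1)) = transpose (matrix L)"
    by (simp add: vec_eq_iff transpose_def matrix_def)
  finally show ?thesis by simp
qed

lemma sum_fun_apply: "(\<Sum>i\<in>I. F i) x = (\<Sum>i\<in>I. F i x)"
  by (induction I rule: infinite_finite_induct) (simp_all add: plus_fun_apply zero_fun_apply)

section \<open>Linear symplectic algebra\<close>

text \<open>The dual basis covector \<open>e\<^sup>i\<close>, as a 1-form on lists.\<close>

definition coord :: "'m \<Rightarrow> (real^'m::finite) list \<Rightarrow> real" where
  "coord i us = (if length us = 1 then hd us $ i else 0)"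

lemma contract_coord: "contract v (coord i) = fscale (v $ i) funit"
  by (simp add: fun_eq_iff contract_apply coord_def fscale_def funit_def)

lemma twist_coord: "twist (coord i) = - coord i"
  by (simp add: fun_eq_iff uminus_apply coord_def twist_def)

text \<open>Every shuffle feeds \<open>coord i\<close> either one of the arguments or a list of the
  wrong length.\<close>

lemma fwedge_coord_eq_0: "(\<And>v. v \<in> set vs \<Longrightarrow> v $ i = 0) \<Longrightarrow> fwedge (coord i) g vs = 0"
proof (induction vs arbitrary: g)
  case (Cons v vs)
  then show ?case
    by (simp add: fwedge_Cons contract_coord twist_coord fwedge_minus_left uminus_apply zero_fun_apply)
qed (simp add: coord_def)

lemma contract_commute:
  assumes "Alt k f" shows "contract u (contract v f) = - contract v (contract u f)"
  using Alt_swap[OF assms, of v u] by (simp add: fun_eq_iff contract_apply uminus_apply)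

lemma contract_eq_sum_axis:
  fixes f :: "(real^'m::finite) list \<Rightarrow> real"
  assumes "Alt k f"
  shows "contract v f = (\<Sum>i\<in>UNIV. fscale (v $ i) (contract (axis i 1) f))"
proof
  fix vs
  have lin: "linear (\<lambda>x. f (x # vs))" by (rule Alt_linear[OF assms])
  have "f (v # vs) = f ((\<Sum>i\<in>UNIV. v $ i *\<^sub>R axis i 1) # vs)"
    using basis_expansion[of v] by (simp add: scalar_mult_eq_scaleR)
  also have "\<dots> = (\<Sum>i\<in>UNIV. v $ i * f (axis i 1 # vs))"
    by (simp add: linear_sum[OF lin] linear_cmul[OF lin])
  also have "\<dots> = (\<Sum>i\<in>UNIV. fscale (v $ i) (contract (axis i 1) f)) vs"
    by (simp add: sum_fun_apply fscale_def contract_apply)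
  finally show "contract v f vs = (\<Sum>i\<in>UNIV. fscale (v $ i) (contract (axis i 1) f)) vs"
    by (simp add: contract_apply)
qed

text \<open>The Euler operator multiplies by the degree. Contracting it with \<open>v\<close> yields
  \<open>contract v f\<close>, from the covector, plus the Euler operator of
  \<open>contract v f\<close>: degree one plus degree \<open>k\<close>.\<close>

lemma sum_coord_contract:
  fixes f :: "(real^'m::finite) list \<Rightarrow> real"
  assumes "Alt k f"
  shows "(\<Sum>i\<in>UNIV. fwedge (coord i) (contract (axis i 1) f)) = fscale k f"
  using assms
proof (induction k arbitrary: f)
  case 0
  then show ?case by (simp add: Alt_0_contract)
next
  case (Suc k)
  let ?S = "\<lambda>f. \<Sum>i\<in>UNIV. fwedge (coord i) (contract (axis i 1) f)"
  have "contract v (?S f) = contract v (fscale (Suc k) f)" for v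
  proof -
    have "contract v (?S f) = (\<Sum>i\<in>UNIV. fscale (v $ i) (contract (axis i 1) f)
        + fwedge (coord i) (contract (axis i 1) (contract v f)))"
      by (simp add: contract_sum contract_fwedge contract_coord twist_coord fwedge_fscale_left fwedge_minus_left
          fwedge_minus_right contract_commute[OF Suc.prems, of v])
    also have "\<dots> = contract v f + ?S (contract v f)"
      by (simp add: sum.distrib flip: contract_eq_sum_axis[OF Suc.prems])
    also have "\<dots> = contract v f + fscale k (contract v f)"
      using Suc.prems by (subst Suc.IH) auto
    also have "\<dots> = contract v (fscale (Suc k) f)"
      by (simp add: fun_eq_iff contract_apply plus_fun_apply fscale_def algebra_simps)
    finally show ?thesis .
  qed
  then have "?S f (v # vs) = fscale (Suc k) f (v # vs)" for v vs
    by (simp only: contract_apply[of v _ vs, symmetric])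
  moreover have "?S f [] = fscale (Suc k) f []"
    using Suc.prems by (simp add: sum_fun_apply coord_def fscale_def)
  ultimately have "?S f us = fscale (Suc k) f us" for us
    by (cases us) simp_all
  then show ?case by (rule ext)
qed

text \<open>Moving a 1-form past \<open>f\<close> costs exactly the sign that \<open>twist\<close>
  provides.\<close>

lemma fwedge_twist_coord:
  assumes "Alt k f" shows "fwedge (twist f) (coord i) = fwedge (coord i) f"
proof -
  have "fwedge f (coord i) = fscale (if (-1) ^ k = (-1::real) then - 1 else 1) (fwedge (coord i) f)"
    using fwedge_commute_parity[of f "(-1) ^ k" "coord i" "-1"] Alt_twist[OF assms]
    by (auto simp: twist_coord minus_one_power_iff)
  then show ?thesis
    by (auto simp: Alt_twist[OF assms] fwedge_fscale_left minus_one_power_iff fwedge_minus_left)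
qed

text \<open>Twice the contraction with the bivector \<open>W\<close>; the factor 1/2 stays
  outside.\<close>

definition pcontract :: "real^'m^'m \<Rightarrow> ((real^'m::finite) list \<Rightarrow> real) \<Rightarrow> (real^'m) list \<Rightarrow> real" where
  "pcontract W f =
     (\<Sum>i\<in>UNIV. \<Sum>j\<in>UNIV. fscale (W $ i $ j) (contract (axis i 1) (contract (axis j 1) f)))"

lemma sum_antisym:
  fixes T :: "'m::finite \<Rightarrow> 'm \<Rightarrow> 'e list \<Rightarrow> real"
  assumes "\<And>i j. W j i = - W i j"
  shows "(\<Sum>i\<in>UNIV. \<Sum>j\<in>UNIV. fscale (W i j) (T j i)) = - (\<Sum>i\<in>UNIV. \<Sum>j\<in>UNIV. fscale (W i j) (T i j))"
proof -
  have "(\<Sum>i\<in>UNIV. \<Sum>j\<in>UNIV. fscale (W i j) (T j i)) = (\<Sum>j\<in>UNIV. \<Sum>i\<in>UNIV. fscale (W i j) (T j i))"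
    by (rule sum.swap)
  also have "\<dots> = (\<Sum>j\<in>UNIV. \<Sum>i\<in>UNIV. - fscale (W j i) (T j i))"
    by (intro sum.cong refl) (metis assms fscale_minus_left)
  finally show ?thesis by (simp add: sum_negf)
qed

text \<open>The Leibniz rule of a second-order operator. A product has two mixed terms, with
  opposite signs and exchanged indices; antisymmetry of \<open>W\<close> merges them, whence the
  factor 2.\<close>

lemma pcontract_fwedge:
  assumes "\<And>i j. W $ j $ i = - W $ i $ j"
  shows "pcontract W (fwedge f g) = fwedge (pcontract W f) g + fwedge f (pcontract W g)
    - fscale 2 (\<Sum>i\<in>UNIV. fwedge (twist (contract (axis i 1) f))
        (\<Sum>j\<in>UNIV. fscale (W $ i $ j) (contract (axis j 1) g)))"
proof -
  let ?\<iota> = "\<lambda>i. contract (axis i (1::real))"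
  let ?T = "\<lambda>i j. fwedge (twist (?\<iota> i f)) (?\<iota> j g)"
  have "?\<iota> i (?\<iota> j (fwedge f g))
      = fwedge (?\<iota> i (?\<iota> j f)) g + fwedge f (?\<iota> i (?\<iota> j g)) + ?T j i - ?T i j" for i j
    by (simp add: contract_fwedge contract_add contract_twist fwedge_minus_left algebra_simps)
  then have "pcontract W (fwedge f g) = fwedge (pcontract W f) g + fwedge f (pcontract W g)
      + (\<Sum>i\<in>UNIV. \<Sum>j\<in>UNIV. fscale (W $ i $ j) (?T j i))
      - (\<Sum>i\<in>UNIV. \<Sum>j\<in>UNIV. fscale (W $ i $ j) (?T i j))"
    by (simp add: pcontract_def fscale_add_right fscale_diff_right sum.distrib sum_subtractf
        fwedge_sum_left fwedge_sum_right fwedge_fscale_left fwedge_fscale_right)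
  also have "\<dots> = fwedge (pcontract W f) g + fwedge f (pcontract W g)
      - fscale 2 (\<Sum>i\<in>UNIV. \<Sum>j\<in>UNIV. fscale (W $ i $ j) (?T i j))"
    by (subst sum_antisym[of "\<lambda>i j. W $ i $ j" ?T, OF assms])
      (simp add: fun_eq_iff fscale_def plus_fun_apply minus_apply uminus_apply)
  finally show ?thesis
    by (simp add: fwedge_sum_right fwedge_fscale_right)
qed

section \<open>A nondegenerate 2-form on one fibre and its inverse bivector\<close>

locale symplectic_form =
  fixes w :: "(real^'m::finite) list \<Rightarrow> real"
  assumes Alt_2: "Alt 2 w"
    and nondeg: "\<And>v. v \<noteq> 0 \<Longrightarrow> \<exists>u. w [v, u] \<noteq> 0"
begin

definition \<Omega> :: "real^'m^'m" where "\<Omega> = (\<chi> i j. w [axis i 1, axis j 1])"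

lemma antisym: "w [u, v] = - w [v, u]"
  using Alt_swap[OF Alt_2, of u v "[]"] .

lemma twist_w: "twist w = w"
  using Alt_twist[OF Alt_2] by simp

text \<open>A kernel vector pairs to 0 with all basis vectors, hence with all vectors, against
  nondegeneracy.\<close>

lemma invertible_\<Omega>: "invertible \<Omega>"
proof -
  have "v = 0" if "\<Omega> *v v = 0" for v
  proof (rule ccontr)
    assume "v \<noteq> 0"
    then obtain u where u: "w [v, u] \<noteq> 0" using nondeg by blast
    have "w [axis i 1, v] = 0" for i
    proof -
      have "w [axis i 1, v] = - (\<Sum>j\<in>UNIV. v $ j * w [axis j 1, axis i 1])"
        using fun_cong[OF contract_eq_sum_axis[OF Alt_2, of v], of "[axis i 1]"] antisym[of "axis i 1" v]
        by (simp add: contract_apply sum_fun_apply fscale_def)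
      also have "\<dots> = (\<Sum>j\<in>UNIV. v $ j * w [axis i 1, axis j 1])"
        using antisym[of "axis i 1"] by (simp add: sum_negf)
      also have "\<dots> = (\<Omega> *v v) $ i"
        by (simp add: matrix_vector_mult_def \<Omega>_def mult.commute)
      finally show ?thesis using that by simp
    qed
    then have "w [u, v] = 0"
      using fun_cong[OF contract_eq_sum_axis[OF Alt_2, of u], of "[v]"]
      by (simp add: contract_apply sum_fun_apply fscale_def)
    then show False using u antisym[of u v] by simp
  qed
  then show ?thesis
    by (simp add: invertible_left_inverse matrix_left_invertible_ker)
qed

definition W :: "real^'m^'m" where "W = matrix_inv \<Omega>"

lemma W_mult_\<Omega>: "W ** \<Omega> = mat 1" and \<Omega>_mult_W: "\<Omega> ** W = mat 1"
  using someI_ex[OF invertible_\<Omega>[unfolded invertible_def]] by (auto simp: W_def matrix_inv_def)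

text \<open>Since \<Omega> is antisymmetric, \<open>- transpose W\<close> is a left inverse of it
  and therefore equals the right inverse \<open>W\<close>.\<close>

lemma W_antisym: "W $ j $ i = - W $ i $ j"
proof -
  have t: "transpose \<Omega> = - \<Omega>"
    by (auto simp: vec_eq_iff transpose_def \<Omega>_def intro: antisym)
  have "(- transpose W) ** \<Omega> = transpose (\<Omega> ** W)"
    unfolding matrix_transpose_mul t by (simp add: matrix_matrix_mult_def vec_eq_iff sum_negf)
  then have "(- transpose W) ** \<Omega> = mat 1" by (simp add: \<Omega>_mult_W transpose_mat)
  then have "(- transpose W) ** (\<Omega> ** W) = W" by (simp only: matrix_mul_assoc matrix_mul_lid)
  then have "- transpose W = W" by (simp only: \<Omega>_mult_W matrix_mul_rid)
  then have "W $ j $ i = (- transpose W) $ j $ i" by simp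
  then show ?thesis by (simp add: transpose_def)
qed

text \<open>Raising the index that \<open>w\<close> has lowered, that is,
  \<open>W ** \<Omega> = mat 1\<close> row by row. It replaces contractions of \<open>w\<close> by
  covectors to which the Euler identity applies.\<close>

lemma sum_W_contract: "(\<Sum>j\<in>UNIV. fscale (W $ i $ j) (contract (axis j 1) w)) = coord i"
proof
  fix us
  show "(\<Sum>j\<in>UNIV. fscale (W $ i $ j) (contract (axis j 1) w)) us = coord i us"
  proof (cases "length us = 1")
    case True
    then obtain u where us: "us = [u]" by (auto simp: length_Suc_conv)
    have "w [axis j 1, u] = (\<Sum>l\<in>UNIV. u $ l * \<Omega> $ j $ l)" for j
      using fun_cong[OF contract_eq_sum_axis[OF Alt_2, of u], of "[axis j 1]"] antisym[of "axis j 1"]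
      by (simp add: contract_apply sum_fun_apply fscale_def \<Omega>_def sum_negf)
    then have "(\<Sum>j\<in>UNIV. fscale (W $ i $ j) (contract (axis j 1) w)) us
        = (\<Sum>j\<in>UNIV. \<Sum>l\<in>UNIV. W $ i $ j * (u $ l * \<Omega> $ j $ l))"
      by (simp add: us contract_apply sum_fun_apply fscale_def sum_distrib_left)
    also have "\<dots> = (\<Sum>l\<in>UNIV. u $ l * (W ** \<Omega>) $ i $ l)"
      by (subst sum.swap) (simp add: matrix_matrix_mult_def sum_distrib_left mult_ac)
    also have "\<dots> = (\<Sum>l\<in>UNIV. if l = i then u $ l else 0)"
      by (intro sum.cong) (auto simp: W_mult_\<Omega> mat_def)
    finally show ?thesis by (simp add: us coord_def)
  next
    case False
    then have "w (v # us) = 0" for v by (intro Alt_length[OF Alt_2]) simp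
    then show ?thesis using False by (simp add: coord_def sum_fun_apply fscale_def contract_apply)
  qed
qed

lemma sum_W_contract_fpower:
  "(\<Sum>j\<in>UNIV. fscale (W $ i $ j) (contract (axis j 1) (fpower w (Suc k))))
    = fscale (Suc k) (fwedge (coord i) (fpower w k))"
proof -
  have "(\<Sum>j\<in>UNIV. fscale (W $ i $ j) (contract (axis j 1) (fpower w (Suc k))))
      = (\<Sum>j\<in>UNIV. fscale (Suc k) (fwedge (fscale (W $ i $ j) (contract (axis j 1) w)) (fpower w k)))"
    unfolding contract_fpower[OF twist_w] by (simp add: fwedge_fscale_left mult.commute)
  also have "\<dots> = fscale (Suc k) (fwedge (coord i) (fpower w k))"
    by (simp only: sum_W_contract flip: fscale_sum_right fwedge_sum_left)
  finally show ?thesis .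
qed

text \<open>After the inner index is raised, \<open>contract (axis i 1)\<close> meets
  \<open>coord i\<close>. The products of the two contribute the trace \<open>CARD('m)\<close>; the
  rest is the Euler operator on \<open>fpower w k\<close>, which has degree
  \<open>2 * k\<close>.\<close>

lemma pcontract_fpower:
  "pcontract W (fpower w (Suc k)) = fscale (Suc k * (CARD('m) - 2 * real k)) (fpower w k)"
proof -
  have "pcontract W (fpower w (Suc k)) = (\<Sum>i\<in>UNIV. contract (axis i 1)
      (\<Sum>j\<in>UNIV. fscale (W $ i $ j) (contract (axis j 1) (fpower w (Suc k)))))"
    unfolding pcontract_def by (simp only: contract_sum contract_fscale)
  also have "\<dots> = fscale (Suc k) (\<Sum>i\<in>UNIV. contract (axis i 1) (fwedge (coord i) (fpower w k)))"
    unfolding sum_W_contract_fpower by (simp only: contract_fscale fscale_sum_right)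
  also have "(\<Sum>i\<in>UNIV. contract (axis i 1) (fwedge (coord i) (fpower w k)))
      = (\<Sum>i\<in>(UNIV::'m set). fpower w k) - fscale (2 * k) (fpower w k)"
    using sum_coord_contract[OF Alt_fpower[OF Alt_2, of k]]
    by (simp add: contract_fwedge contract_coord twist_coord fwedge_minus_left sum_subtractf mult.commute)
  also have "\<dots> = fscale (CARD('m) - 2 * real k) (fpower w k)"
    by (simp add: fun_eq_iff minus_apply sum_fun_apply fscale_def algebra_simps)
  finally show ?thesis by simp
qed

text \<open>Apply \<open>pcontract W\<close> to \<open>f \<and> w\<^sup>k\<^sup>+\<^sup>1\<close>, which vanishes for reasons of degree.\<close>

lemma pcontract_fwedge_fpower:
  assumes f: "Alt j f" and deg: "CARD('m) < j + 2 * Suc k"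
  shows "fwedge (pcontract W f) (fpower w (Suc k))
    = fscale (Suc k * (2 * real j + 2 * real k - CARD('m))) (fwedge f (fpower w k))"
proof -
  have "fwedge f (fpower w (Suc k)) = 0"
    using deg by (intro Alt_degree_gt_DIM[OF Alt_fwedge[OF f Alt_fpower[OF Alt_2]]]) simp
  then have 0: "pcontract W (fwedge f (fpower w (Suc k))) = 0"
    by (simp only:) (simp add: pcontract_def)
  \<comment> \<open>The mixed term after index raising: moving the covector to the front produces
    the Euler operator on \<open>f\<close>, which contributes the summand \<open>2 * real j\<close>
    of the constant.\<close>
  have "(\<Sum>i\<in>UNIV. fwedge (twist (contract (axis i 1) f)) (fwedge (coord i) (fpower w k)))
      = fwedge (\<Sum>i\<in>UNIV. fwedge (coord i) (contract (axis i 1) f)) (fpower w k)"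
    by (simp add: fwedge_sum_left fwedge_twist_coord[OF Alt_contract[OF f]] flip: fwedge_assoc)
  also have "\<dots> = fscale j (fwedge f (fpower w k))"
    by (simp add: sum_coord_contract[OF f] fwedge_fscale_left)
  finally have "(\<Sum>i\<in>UNIV. fwedge (twist (contract (axis i 1) f))
      (\<Sum>j\<in>UNIV. fscale (W $ i $ j) (contract (axis j 1) (fpower w (Suc k)))))
      = fscale (Suc k * j) (fwedge f (fpower w k))"
    unfolding sum_W_contract_fpower by (simp add: fwedge_fscale_right distrib_right flip: fscale_sum_right)
  with 0 pcontract_fwedge[OF W_antisym, of f "fpower w (Suc k)"]
  have "0 = fwedge (pcontract W f) (fpower w (Suc k))
      + fwedge f (fscale (Suc k * (CARD('m) - 2 * real k)) (fpower w k))
      - fscale 2 (fscale (Suc k * j) (fwedge f (fpower w k)))"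
    by (simp only: pcontract_fpower)
  then show ?thesis
    unfolding fwedge_fscale_right
    by (auto simp: fun_eq_iff fun_app fscale_def algebra_simps)
qed

text \<open>If the next power vanished, so would its contractions, and after index raising the
  product of every \<open>coord i\<close> with \<open>fpower w k\<close>. Below top degree this
  forces \<open>fpower w k\<close> itself to vanish.\<close>

lemma fpower_nonzero: "2 * k \<le> CARD('m) \<Longrightarrow> fpower w k \<noteq> 0"
proof (induction k)
  case 0
  then show ?case by (auto simp: fun_eq_iff funit_def zero_fun_apply)
next
  case (Suc k)
  show ?case
  proof
    assume "fpower w (Suc k) = 0"
    then have "fscale (Suc k) (fwedge (coord i) (fpower w k)) = 0" for i
      using sum_W_contract_fpower[of i k] by simp
    then have 0: "fwedge (coord i) (fpower w k) us = 0" for i us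
      by (auto simp: fun_eq_iff fscale_def zero_fun_apply)
    have "fpower w k = 0"
    proof (rule Alt_eq_0_basis[OF Alt_fpower[OF Alt_2]])
      fix vs :: "(real^'m) list" assume vs: "set vs \<subseteq> Basis" "length vs = k * 2"
      \<comment> \<open>The arguments cannot exhaust the basis. Put a missing vector
        \<open>b\<close> in front: on \<open>b # vs\<close> the product with its covector is just
        the value of \<open>fpower w k\<close> on \<open>vs\<close>.\<close>
      have "card (set vs) < card (Basis :: (real^'m) set)"
        using card_length[of vs] vs(2) Suc.prems by simp
      then obtain b where b: "b \<in> Basis" "b \<notin> set vs"
        using vs(1) by (metis psubsetI psubset_imp_ex_mem less_irrefl subset_antisym subsetI)
      then obtain i where i: "b = axis i 1" by (auto simp: Basis_vec_def)
      have "v $ i = 0" if "v \<in> set vs" for v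
        using that vs(1) b(2) i by (auto simp: Basis_vec_def axis_def)
      then have "fwedge (coord i) (contract b (fpower w k)) vs = 0" by (rule fwedge_coord_eq_0)
      then show "fpower w k vs = 0"
        using 0[of i "b # vs"]
        by (simp add: fwedge_Cons contract_coord twist_coord fwedge_minus_left uminus_apply i)
    qed
    with Suc show False by simp
  qed
qed

lemma fpower_std_frame:
  assumes "CARD('m) = 2 * n" shows "fpower w n std_frame \<noteq> 0"
  using fpower_nonzero[of n] Alt_top_eq_0[of "std_frame :: (real^'m) list" "fpower w n"] Alt_fpower[OF Alt_2, of n] assms
  by (auto simp: std_frame mult.commute)

end

section \<open>Calculus of \<open>C\<^sup>k\<close> functions\<close>

lemma Ck_on_cong:
  assumes "open S" "\<And>x. x \<in> S \<Longrightarrow> f x = g x" "Ck_on k f S"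
  shows "Ck_on k g S"
  using assms(2,3)
proof (induction k arbitrary: f g)
  case 0
  then show ?case using continuous_on_cong[of S S f g] by auto
next
  case (Suc k)
  have f: "f differentiable (at x)" if "x \<in> S" for x
    using Suc.prems(2) that by (simp add: differentiable_on_eq_differentiable_at assms(1))
  have "Ck_on k (\<lambda>x. frechet_derivative g (at x) v) S" for v
  proof (rule Suc.IH)
    show "Ck_on k (\<lambda>x. frechet_derivative f (at x) v) S" using Suc.prems(2) by simp
    show "frechet_derivative f (at x) v = frechet_derivative g (at x) v" if "x \<in> S" for x
      by (rule fun_cong[OF frechet_derivative_transform_within_open[OF f[OF that] assms(1) that]])
        (use Suc.prems in auto)
  qed
  moreover have "g differentiable (at x)" if x: "x \<in> S" for x
    using f[OF x] has_derivative_transform_within_open[OF _ assms(1) x] Suc.prems(1)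
    unfolding differentiable_def by blast
  then have "g differentiable_on S"
    by (simp add: differentiable_on_eq_differentiable_at assms(1))
  ultimately show ?case by simp
qed

lemma smooth_on_cong: "smooth_on f S \<Longrightarrow> open S \<Longrightarrow> (\<And>x. x \<in> S \<Longrightarrow> f x = g x) \<Longrightarrow> smooth_on g S"
  by (auto simp: smooth_on_def intro: Ck_on_cong)

lemma Ck_on_local:
  assumes "\<And>x. x \<in> S \<Longrightarrow> \<exists>T. open T \<and> x \<in> T \<and> Ck_on k f T"
  shows "Ck_on k f S"
  using assms
proof (induction k arbitrary: f)
  case 0
  have "isCont f x" if x: "x \<in> S" for x
    using 0[OF x] continuous_on_eq_continuous_at by auto
  then show ?case by (simp add: continuous_at_imp_continuous_on)
next
  case (Suc k)
  have "f differentiable (at x)" if "x \<in> S" for x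
    using Suc.prems[OF that] by (auto simp: differentiable_on_eq_differentiable_at)
  then have "f differentiable_on S"
    by (simp add: differentiable_on_def differentiable_at_withinI)
  moreover have "Ck_on k (\<lambda>x. frechet_derivative f (at x) v) S" for v
    by (rule Suc.IH) (use Suc.prems in fastforce)
  ultimately show ?case by simp
qed

lemma smooth_on_local:
  assumes "\<And>x. x \<in> S \<Longrightarrow> \<exists>T. open T \<and> x \<in> T \<and> smooth_on f T"
  shows "smooth_on f S"
  unfolding smooth_on_def
proof
  fix k show "Ck_on k f S"
    by (rule Ck_on_local) (use assms in \<open>auto simp only: smooth_on_def\<close>)
qed

lemma Ck_on_Suc_imp: "Ck_on (Suc k) f S \<Longrightarrow> Ck_on k f S"
proof (induction k arbitrary: f)
  case (Suc k)
  have "Ck_on k (\<lambda>x. frechet_derivative f (at x) v) S" for v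
    by (rule Suc.IH) (use Suc.prems in simp)
  then show ?case using Suc.prems by simp
qed (simp add: differentiable_imp_continuous_on)

lemma Ck_on_differentiable_at: "Ck_on (Suc k) f S \<Longrightarrow> open S \<Longrightarrow> x \<in> S \<Longrightarrow> f differentiable (at x)"
  by (simp add: differentiable_on_eq_differentiable_at)

lemma smooth_on_differentiable_at: "smooth_on f S \<Longrightarrow> open S \<Longrightarrow> x \<in> S \<Longrightarrow> f differentiable (at x)"
  using Ck_on_differentiable_at unfolding smooth_on_def by blast

lemma smooth_on_continuous_on: "smooth_on f S \<Longrightarrow> continuous_on S f"
  by (auto simp: smooth_on_def dest: spec[of _ 0])

lemma smooth_on_deriv: "smooth_on f S \<Longrightarrow> smooth_on (\<lambda>x. frechet_derivative f (at x) v) S"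
  unfolding smooth_on_def by (metis Ck_on.simps(2))

text \<open>Admits an explicit derivative in place of the chosen \<open>frechet_derivative\<close>;
  the closure properties are inductions through this rule.\<close>

lemma Ck_on_SucI:
  assumes "open S" "\<And>x. x \<in> S \<Longrightarrow> (f has_derivative f' x) (at x)" "\<And>v. Ck_on k (\<lambda>x. f' x v) S"
  shows "Ck_on (Suc k) f S"
proof -
  have "Ck_on k (\<lambda>x. frechet_derivative f (at x) v) S" for v
    by (rule Ck_on_cong[OF assms(1) _ assms(3)[of v]]) (use assms(2) frechet_derivative_at in metis)
  moreover have "f differentiable_on S"
    using assms(2) by (auto simp: differentiable_on_def differentiable_def intro: has_derivative_at_withinI)
  ultimately show ?thesis by simp
qed

lemma Ck_on_has_derivative:
  assumes "Ck_on (Suc k) f S" "open S" "x \<in> S"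
  shows "(f has_derivative frechet_derivative f (at x)) (at x)"
  using Ck_on_differentiable_at[OF assms] frechet_derivative_works by blast

lemma Ck_on_const [simp]: "Ck_on k (\<lambda>_. c) S"
  by (induction k arbitrary: c) simp_all

lemma Ck_on_bounded_linear_compose:
  assumes L: "bounded_linear L" and S: "open S"
  shows "Ck_on k f S \<Longrightarrow> Ck_on k (\<lambda>x. L (f x)) S"
proof (induction k arbitrary: f)
  case 0
  then show ?case using bounded_linear.continuous_on[OF L] by simp
next
  case (Suc k)
  show ?case
  proof (rule Ck_on_SucI[OF S])
    show "((\<lambda>x. L (f x)) has_derivative (\<lambda>v. L (frechet_derivative f (at x) v))) (at x)" if "x \<in> S" for x
      by (intro bounded_linear.has_derivative[OF L] Ck_on_has_derivative[OF Suc.prems S that])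
    show "Ck_on k (\<lambda>x. L (frechet_derivative f (at x) v)) S" for v
      by (rule Suc.IH) (use Suc.prems in simp)
  qed
qed

lemma Ck_on_ident: "open S \<Longrightarrow> Ck_on k (\<lambda>x. x) S"
proof (cases k)
  case (Suc m)
  then show "open S \<Longrightarrow> ?thesis" by (auto intro!: Ck_on_SucI[where f' = "\<lambda>_ v. v"] simp del: Ck_on.simps)
qed simp

lemma Ck_on_add: "open S \<Longrightarrow> Ck_on k f S \<Longrightarrow> Ck_on k g S \<Longrightarrow> Ck_on k (\<lambda>x. f x + g x) S"
proof (induction k arbitrary: f g)
  case (Suc k)
  show ?case
  proof (rule Ck_on_SucI[OF Suc.prems(1)])
    show "((\<lambda>x. f x + g x) has_derivative (\<lambda>v. frechet_derivative f (at x) v + frechet_derivative g (at x) v)) (at x)"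
      if "x \<in> S" for x
      using Suc.prems that by (intro has_derivative_add Ck_on_has_derivative) auto
  qed (use Suc in simp)
qed (simp add: continuous_on_add)

lemma Ck_on_mult:
  fixes f g :: "'e::real_normed_vector \<Rightarrow> real"
  shows "open S \<Longrightarrow> Ck_on k f S \<Longrightarrow> Ck_on k g S \<Longrightarrow> Ck_on k (\<lambda>x. f x * g x) S"
proof (induction k arbitrary: f g)
  case (Suc k)
  show ?case
  proof (rule Ck_on_SucI[OF Suc.prems(1)])
    show "((\<lambda>x. f x * g x) has_derivative
        (\<lambda>v. f x * frechet_derivative g (at x) v + frechet_derivative f (at x) v * g x)) (at x)"
      if "x \<in> S" for x
      using Suc.prems that by (intro has_derivative_mult Ck_on_has_derivative) auto
    show "Ck_on k (\<lambda>x. f x * frechet_derivative g (at x) v + frechet_derivative f (at x) v * g x) S" for v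
      using Suc.prems Ck_on_Suc_imp[OF Suc.prems(2)] Ck_on_Suc_imp[OF Suc.prems(3)]
      by (intro Ck_on_add Suc.IH) auto
  qed
qed (simp add: continuous_on_mult)

lemma Ck_on_sum: "open S \<Longrightarrow> (\<And>i. i \<in> I \<Longrightarrow> Ck_on k (f i) S) \<Longrightarrow> Ck_on k (\<lambda>x. \<Sum>i\<in>I. f i x) S"
  by (induction I rule: infinite_finite_induct) (auto intro: Ck_on_add)

text \<open>In the chain rule the direction in which \<open>f\<close> is differentiated varies with
  the point, while \<open>Ck_on\<close> speaks of fixed directions. Expanding that direction in a
  basis leaves sums of products that the induction covers.\<close>

lemma Ck_on_compose:
  fixes g :: "'e::real_normed_vector \<Rightarrow> 'b::euclidean_space" and f :: "'b \<Rightarrow> real"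
  assumes S: "open S" and T: "open T" and sub: "g ` S \<subseteq> T"
  shows "Ck_on k g S \<Longrightarrow> Ck_on k f T \<Longrightarrow> Ck_on k (\<lambda>x. f (g x)) S"
proof (induction k arbitrary: f)
  case 0
  then show ?case using sub by (auto intro: continuous_on_compose2)
next
  case (Suc k)
  let ?f' = "\<lambda>y. frechet_derivative f (at y)" and ?g' = "\<lambda>x. frechet_derivative g (at x)"
  show ?case
  proof (rule Ck_on_SucI[OF S])
    show "((\<lambda>x. f (g x)) has_derivative (\<lambda>v. \<Sum>b\<in>Basis. (?g' x v \<bullet> b) * ?f' (g x) b)) (at x)"
      if x: "x \<in> S" for x
    proof -
      have f: "(f has_derivative ?f' (g x)) (at (g x))"
        using Ck_on_has_derivative[OF Suc.prems(2) T] x sub by auto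
      have "((\<lambda>x. f (g x)) has_derivative (\<lambda>v. ?f' (g x) (?g' x v))) (at x)"
        using diff_chain_at[OF Ck_on_has_derivative[OF Suc.prems(1) S x] f] by (simp add: o_def)
      moreover have "?f' (g x) u = (\<Sum>b\<in>Basis. (u \<bullet> b) * ?f' (g x) b)" for u
      proof -
        have lin: "linear (?f' (g x))" using has_derivative_linear[OF f] .
        have "?f' (g x) u = ?f' (g x) (\<Sum>b\<in>Basis. (u \<bullet> b) *\<^sub>R b)" by (simp add: euclidean_representation)
        then show ?thesis by (simp add: linear_sum[OF lin] linear_cmul[OF lin])
      qed
      then have "(\<lambda>v. ?f' (g x) (?g' x v)) = (\<lambda>v. \<Sum>b\<in>Basis. (?g' x v \<bullet> b) * ?f' (g x) b)"
        by (intro ext)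
      ultimately show ?thesis by metis
    qed
    have g': "Ck_on k (\<lambda>x. ?g' x v) S" for v using Suc.prems(1) by simp
    have f': "Ck_on k (\<lambda>y. ?f' y b) T" for b using Suc.prems(2) by simp
    have "Ck_on k (\<lambda>x. ?g' x v \<bullet> b) S" for v b
      by (rule Ck_on_bounded_linear_compose[OF bounded_linear_inner_left S g'])
    moreover have "Ck_on k (\<lambda>x. ?f' (g x) b) S" for b
      by (rule Suc.IH[OF Ck_on_Suc_imp[OF Suc.prems(1)] f'])
    ultimately show "Ck_on k (\<lambda>x. \<Sum>b\<in>Basis. (?g' x v \<bullet> b) * ?f' (g x) b) S" for v
      by (intro Ck_on_sum Ck_on_mult S)
  qed
qed

text \<open>The derivative is again a polynomial in \<open>inverse\<close>, so the induction
  closes.\<close>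

lemma Ck_on_inverse: "Ck_on k (inverse :: real \<Rightarrow> real) (- {0})"
proof (induction k)
  case (Suc k)
  have "Ck_on k (\<lambda>x. - (inverse x * v * inverse x)) (- {0::real})" for v
    by (intro Ck_on_bounded_linear_compose[OF bounded_linear_minus[OF bounded_linear_ident]]
        Ck_on_mult Suc.IH Ck_on_const) (auto simp: open_delete)
  then show ?case
    by (intro Ck_on_SucI[where f' = "\<lambda>x h. - (inverse x * h * inverse x)"] has_derivative_inverse')
      (auto simp: open_delete)
qed (auto intro!: continuous_on_inverse)

section \<open>Smooth functions, up to the construction of a bump function\<close>

lemma smooth_on_const [simp]: "smooth_on (\<lambda>_. c) S"
  by (simp add: smooth_on_def)

lemma smooth_on_add: "open S \<Longrightarrow> smooth_on f S \<Longrightarrow> smooth_on g S \<Longrightarrow> smooth_on (\<lambda>x. f x + g x) S"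
  by (simp add: smooth_on_def Ck_on_add)

lemma smooth_on_mult:
  fixes f g :: "'e::real_normed_vector \<Rightarrow> real"
  shows "open S \<Longrightarrow> smooth_on f S \<Longrightarrow> smooth_on g S \<Longrightarrow> smooth_on (\<lambda>x. f x * g x) S"
  by (simp add: smooth_on_def Ck_on_mult)

lemma smooth_on_sum: "open S \<Longrightarrow> (\<And>i. i \<in> I \<Longrightarrow> smooth_on (f i) S) \<Longrightarrow> smooth_on (\<lambda>x. \<Sum>i\<in>I. f i x) S"
  by (simp add: smooth_on_def Ck_on_sum)

lemma smooth_on_compose:
  fixes g :: "'e::real_normed_vector \<Rightarrow> 'b::euclidean_space" and f :: "'b \<Rightarrow> real"
  assumes "open S" "open T" "g ` S \<subseteq> T" "smooth_on g S" "smooth_on f T"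
  shows "smooth_on (\<lambda>x. f (g x)) S"
  unfolding smooth_on_def
proof
  fix k show "Ck_on k (\<lambda>x. f (g x)) S"
    using assms(4,5) by (intro Ck_on_compose[OF assms(1-3)]) (auto simp only: smooth_on_def)
qed

lemma smooth_on_bounded_linear_compose:
  "bounded_linear L \<Longrightarrow> open S \<Longrightarrow> smooth_on f S \<Longrightarrow> smooth_on (\<lambda>x. L (f x)) S"
  by (simp add: smooth_on_def Ck_on_bounded_linear_compose)

lemma smooth_on_divide:
  fixes f g :: "'e::real_normed_vector \<Rightarrow> real"
  assumes "open S" "smooth_on f S" "smooth_on g S" "\<And>x. x \<in> S \<Longrightarrow> g x \<noteq> 0"
  shows "smooth_on (\<lambda>x. f x / g x) S"
proof -
  have "smooth_on (\<lambda>x. inverse (g x)) S"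
    by (rule smooth_on_compose[of S "- {0}" g inverse])
      (use assms Ck_on_inverse in \<open>auto simp: smooth_on_def open_delete\<close>)
  then show ?thesis
    using smooth_on_mult[OF assms(1,2)] by (simp add: divide_inverse)
qed

text \<open>The family is closed under differentiation, which makes smoothness at \<open>0\<close> an induction.\<close>

definition flat :: "nat \<Rightarrow> real \<Rightarrow> real" where
  "flat m t = (if t \<le> 0 then 0 else exp (- inverse t) * inverse t ^ m)"

text \<open>At 0 the two sides are treated apart. From the right the difference quotient is a power
  of \<open>inverse h\<close> divided by \<open>exp (inverse h)\<close>, which tends to 0.\<close>

lemma flat_has_derivative:
  "(flat m has_real_derivative flat (m + 2) t - real m * flat (m + 1) t) (at t)"
proof -
  consider "t < 0" | "t = 0" | "t > 0" by linarith
  then show ?thesis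
  proof cases
    case 1
    have "(flat m has_real_derivative 0) (at t)"
      by (rule has_field_derivative_transform_within_open[of "\<lambda>_. 0" _ _ "{..<0}"])
        (use 1 in \<open>auto simp: flat_def\<close>)
    then show ?thesis using 1 by (simp add: flat_def)
  next
    case 2
    have "((\<lambda>h. flat m h / h) \<longlongrightarrow> 0) (at_left 0)"
      by (rule tendsto_eventually) (auto simp: eventually_at_filter flat_def)
    moreover have "((\<lambda>h. flat m h / h) \<longlongrightarrow> 0) (at_right 0)"
    proof (rule Lim_transform_eventually)
      show "((\<lambda>h::real. exp (- inverse h) * inverse h ^ m / h) \<longlongrightarrow> 0) (at_right 0)"
      proof -
        have "((\<lambda>h::real. inverse h ^ Suc m / exp (inverse h)) \<longlongrightarrow> 0) (at_right 0)"
          by (rule filterlim_compose[OF tendsto_power_div_exp_0 filterlim_inverse_at_top_right])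
        then show ?thesis by (simp add: exp_minus divide_inverse mult_ac)
      qed
      show "\<forall>\<^sub>F h in at_right 0. exp (- inverse h) * inverse h ^ m / h = flat m h / h"
        by (auto simp: eventually_at_filter flat_def)
    qed
    ultimately have "((\<lambda>h. flat m h / h) \<longlongrightarrow> 0) (at 0)"
      by (simp add: filterlim_split_at)
    then show ?thesis using 2 by (simp add: DERIV_def flat_def)
  next
    case 3
    let ?x = "inverse t"
    have "((\<lambda>t. exp (- inverse t) * inverse t ^ m) has_real_derivative
        exp (- ?x) * (?x * ?x) * ?x ^ m - real m * ?x ^ (m - 1) * (?x * ?x) * exp (- ?x)) (at t)"
      using 3 by (auto intro!: derivative_eq_intros)
    \<comment> \<open>The exponent \<open>m - 1\<close> is truncated for \<open>m = 0\<close>, where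
      the factor \<open>real m\<close> removes the term; hence the case distinction.\<close>
    also have "exp (- ?x) * (?x * ?x) * ?x ^ m - real m * ?x ^ (m - 1) * (?x * ?x) * exp (- ?x)
        = flat (m + 2) t - real m * flat (m + 1) t"
      using 3 by (cases m) (simp_all add: flat_def mult_ac)
    finally have "((\<lambda>t. exp (- inverse t) * inverse t ^ m) has_real_derivative
        flat (m + 2) t - real m * flat (m + 1) t) (at t)" .
    then show ?thesis
      by (rule has_field_derivative_transform_within_open[of _ _ _ "{0<..}"])
        (use 3 in \<open>auto simp: flat_def\<close>)
  qed
qed

lemma Ck_on_flat: "Ck_on k (flat m) UNIV"
proof (induction k arbitrary: m)
  case 0
  have "isCont (flat m) t" for t by (rule DERIV_isCont[OF flat_has_derivative])
  then show ?case by (simp add: continuous_at_imp_continuous_on)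
next
  case (Suc k)
  show ?case
  proof (rule Ck_on_SucI)
    show "(flat m has_derivative (\<lambda>h. (flat (m + 2) t + (- real m) * flat (m + 1) t) * h)) (at t)" for t
      using flat_has_derivative[of m t] by (simp add: has_field_derivative_def)
    show "Ck_on k (\<lambda>t. (flat (m + 2) t + (- real m) * flat (m + 1) t) * h) UNIV" for h
      by (intro Ck_on_mult Ck_on_add Suc.IH Ck_on_const open_UNIV)
  qed simp
qed

lemma smooth_bump:
  fixes a :: "'e::euclidean_space"
  obtains h :: "'e \<Rightarrow> real" where "smooth_on h UNIV" "\<And>x. 0 \<le> h x" "\<And>x. h x \<noteq> 0 \<longleftrightarrow> dist a x < r"
proof (cases "r > 0")
  case False
  then have "r \<le> dist a x" for x using zero_le_dist[of a x] by linarith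
  then show ?thesis using that[of "\<lambda>_. 0"] by (simp add: not_less)
next
  case True
  \<comment> \<open>This is the squared radius minus the squared distance from \<open>a\<close>,
    spelled out as a polynomial in the coordinates so that closure under sums and products gives
    smoothness.\<close>
  let ?q = "\<lambda>x. r\<^sup>2 + (\<Sum>b\<in>Basis. (- 1) * ((x \<bullet> b + (- (a \<bullet> b))) * (x \<bullet> b + (- (a \<bullet> b)))))"
  have q: "?q x = r\<^sup>2 - (dist a x)\<^sup>2" for x
  proof -
    have "(dist a x)\<^sup>2 = (x - a) \<bullet> (x - a)"
      by (metis dist_commute dist_norm power2_norm_eq_inner)
    also have "\<dots> = (\<Sum>b\<in>Basis. (x \<bullet> b - a \<bullet> b) * (x \<bullet> b - a \<bullet> b))"
      by (subst euclidean_inner) (simp add: inner_diff_left)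
    finally show ?thesis by (simp add: sum_negf)
  qed
  have id: "smooth_on (\<lambda>x::'e. x) UNIV" by (simp add: smooth_on_def Ck_on_ident)
  have "smooth_on ?q UNIV"
    by (intro smooth_on_add smooth_on_sum smooth_on_mult smooth_on_const open_UNIV
        smooth_on_bounded_linear_compose[OF bounded_linear_inner_left] id)
  then have "smooth_on (\<lambda>x. flat 0 (?q x)) UNIV"
    by (rule smooth_on_compose[of UNIV UNIV, rotated 3]) (auto simp: smooth_on_def Ck_on_flat)
  moreover have "flat 0 (?q x) \<noteq> 0 \<longleftrightarrow> dist a x < r" for x
  proof -
    have "(dist a x)\<^sup>2 < r\<^sup>2 \<longleftrightarrow> dist a x < r"
      by (metis True less_imp_le power2_less_imp_less power_strict_mono zero_le_dist zero_less_numeral)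
    then show ?thesis unfolding q by (auto simp: flat_def not_le)
  qed
  ultimately show ?thesis
    by (intro that[of "\<lambda>x. flat 0 (?q x)"]) (auto simp: flat_def)
qed

section \<open>Integrals of compactly supported functions\<close>

lemmas HK_cong = Henstock_Kurzweil_Integration.integral_cong
  and HK_sum = Henstock_Kurzweil_Integration.integral_sum
  and HK_restrict_UNIV = Henstock_Kurzweil_Integration.integral_restrict_UNIV

text \<open>The extension is continuous on each of the open sets \<open>U\<close> and
  \<open>- K\<close>, which cover the space.\<close>

lemma continuous_on_zero_extension:
  fixes f :: "'a::euclidean_space \<Rightarrow> real"
  assumes "open U" "compact K" "K \<subseteq> U" "continuous_on U f" "\<And>x. x \<in> U - K \<Longrightarrow> f x = 0"
  shows "continuous_on UNIV (\<lambda>x. if x \<in> U then f x else 0)"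
proof -
  let ?g = "\<lambda>x. if x \<in> U then f x else 0"
  have "continuous_on U ?g"
    using assms(4) by (rule continuous_on_eq) simp
  moreover have "continuous_on (- K) ?g"
    by (rule continuous_on_eq[of _ "\<lambda>_. 0"]) (use assms(5) in auto)
  moreover have "open (- K)" using assms(2) compact_imp_closed by auto
  ultimately have "continuous_on (U \<union> - K) ?g" using assms(1) by (intro continuous_on_open_Un)
  moreover have "U \<union> - K = UNIV" using assms(3) by auto
  ultimately show ?thesis by simp
qed

lemma absolutely_integrable_compact_support:
  fixes f :: "'a::euclidean_space \<Rightarrow> real"
  assumes "continuous_on UNIV f" "compact K" "\<And>x. x \<notin> K \<Longrightarrow> f x = 0"
  shows "f absolutely_integrable_on UNIV"
proof -
  obtain a b where K: "K \<subseteq> cbox a b"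
    using bounded_subset_cbox_symmetric compact_imp_bounded assms(2) by metis
  have "f absolutely_integrable_on cbox a b"
    using assms(1) by (intro absolutely_integrable_continuous) (rule continuous_on_subset, auto)
  then have "(\<lambda>x. if x \<in> cbox a b then f x else 0) absolutely_integrable_on UNIV"
    by (simp only: absolutely_integrable_restrict_UNIV)
  moreover have "(\<lambda>x. if x \<in> cbox a b then f x else 0) = f"
    using assms(3) K by (auto simp: fun_eq_iff)
  ultimately show ?thesis by simp
qed

lemma absolutely_integrable_on_compact_support:
  fixes f :: "'a::euclidean_space \<Rightarrow> real"
  assumes "open U" "compact K" "K \<subseteq> U" "continuous_on U f" "\<And>x. x \<in> U - K \<Longrightarrow> f x = 0"
  shows "f absolutely_integrable_on U"
proof -
  have "(\<lambda>x. if x \<in> U then f x else 0) absolutely_integrable_on UNIV"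
    using assms by (intro absolutely_integrable_compact_support[OF continuous_on_zero_extension[OF assms] assms(2)]) auto
  then show ?thesis by (simp only: absolutely_integrable_restrict_UNIV)
qed

lemma integral_on_subset:
  fixes f :: "'a::euclidean_space \<Rightarrow> real"
  assumes "S \<subseteq> T" "\<And>x. x \<in> T - S \<Longrightarrow> f x = 0"
  shows "integral T f = integral S f"
proof -
  have "(\<lambda>x. if x \<in> T then f x else 0) = (\<lambda>x. if x \<in> S then f x else 0)"
    using assms by (auto simp: fun_eq_iff)
  then show ?thesis by (metis HK_restrict_UNIV)
qed

lemma integral_shift:
  fixes g :: "'a::euclidean_space \<Rightarrow> real"
  assumes "continuous_on UNIV g" "compact K" "\<And>x. x \<notin> K \<Longrightarrow> g x = 0"
  shows "integral UNIV (\<lambda>x. g (x + c)) = integral UNIV g"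
proof -
  obtain a where K: "K \<subseteq> cbox (- a) a"
    using bounded_subset_cbox_symmetric compact_imp_bounded assms(2) by metis
  have "(g has_integral integral (cbox (- a) a) g) (cbox (- a) a)"
    by (intro integrable_integral integrable_continuous continuous_on_subset[OF assms(1)]) auto
  from has_integral_affinity[OF this, of 1 c]
  have "((\<lambda>x. g (x + c)) has_integral integral (cbox (- a) a) g) ((\<lambda>x. x + - c) ` cbox (- a) a)"
    by simp
  then have "((\<lambda>x. g (x + c)) has_integral integral (cbox (- a) a) g) UNIV"
  proof (rule has_integral_on_superset)
    fix x assume "x \<notin> (\<lambda>x. x + - c) ` cbox (- a) a"
    then have "x + c \<notin> cbox (- a) a" by (metis add_uminus_conv_diff add_diff_cancel_right' imageI)
    then show "g (x + c) = 0" using K assms(3) by blast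
  qed simp
  moreover have "integral UNIV g = integral (cbox (- a) a) g"
    using K assms(3) by (intro integral_on_subset) auto
  ultimately show ?thesis by (simp add: integral_unique)
qed

text \<open>
  Integrate \<open>F (x + b) - F x = \<integral>\<^sub>0\<^sup>1 D\<^sub>b F (x + t b) dt\<close> over \<open>x\<close>: by Fubini and translation
  invariance the right-hand side becomes \<open>\<integral> D\<^sub>b F\<close>, the left-hand side \<open>0\<close>.
\<close>

lemma integral_derivative_eq_0:
  fixes F F' :: "'a::euclidean_space \<Rightarrow> real"
  assumes der: "\<And>x t. ((\<lambda>t. F (x + t *\<^sub>R b)) has_real_derivative F' (x + t *\<^sub>R b)) (at t)"
    and F: "continuous_on UNIV F" and F': "continuous_on UNIV F'"
    and K: "compact K" and F0: "\<And>x. x \<notin> K \<Longrightarrow> F x = 0" and F'0: "\<And>x. x \<notin> K \<Longrightarrow> F' x = 0"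
  shows "integral UNIV F' = 0"
proof -
  \<comment> \<open>One box has to contain all translates of \<open>K\<close> by
    \<open>- t *\<^sub>R b\<close> with \<open>t\<close> in the unit interval, so that the domain of
    the inner integral does not depend on \<open>t\<close>.\<close>
  have "compact ((\<lambda>(x, t). x - t *\<^sub>R b) ` (K \<times> {0..1::real}))"
    by (intro compact_continuous_image compact_Times K)
      (auto intro!: continuous_intros simp: case_prod_unfold)
  then obtain a where a: "(\<lambda>(x, t). x - t *\<^sub>R b) ` (K \<times> {0..1}) \<subseteq> cbox (- a) a"
    using bounded_subset_cbox_symmetric compact_imp_bounded by metis
  let ?B = "cbox (- a) a"
  have B: "x + t *\<^sub>R b \<notin> K" if "x \<notin> ?B" "t \<in> {0..1}" for x t
  proof
    assume "x + t *\<^sub>R b \<in> K"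
    then have "(\<lambda>(x, t). x - t *\<^sub>R b) (x + t *\<^sub>R b, t) \<in> (\<lambda>(x, t). x - t *\<^sub>R b) ` (K \<times> {0..1})"
      using that by blast
    then show False using a that by auto
  qed
  have shift: "integral ?B (\<lambda>x. g (x + t *\<^sub>R b)) = integral UNIV g"
    if "continuous_on UNIV g" "\<And>x. x \<notin> K \<Longrightarrow> g x = 0" "t \<in> {0..1}" for g :: "'a \<Rightarrow> real" and t
  proof -
    have "integral UNIV (\<lambda>x. g (x + t *\<^sub>R b)) = integral ?B (\<lambda>x. g (x + t *\<^sub>R b))"
      using that B by (intro integral_on_subset) auto
    then show ?thesis using integral_shift[OF that(1) K that(2)] by simp
  qed
  have "integral UNIV F' = integral (cbox 0 1) (\<lambda>t::real. integral ?B (\<lambda>x. F' (x + t *\<^sub>R b)))"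
  proof -
    have "integral (cbox 0 1) (\<lambda>t::real. integral ?B (\<lambda>x. F' (x + t *\<^sub>R b)))
        = integral (cbox 0 1) (\<lambda>t::real. integral UNIV F')"
      using shift[OF F' F'0] by (intro HK_cong) auto
    then show ?thesis by simp
  qed
  also have "\<dots> = integral ?B (\<lambda>x. integral (cbox 0 1) (\<lambda>t::real. F' (x + t *\<^sub>R b)))"
    by (rule integral_swap_continuous[symmetric])
      (auto intro!: continuous_on_compose2[OF F'] continuous_intros simp: case_prod_unfold)
  also have "\<dots> = integral ?B (\<lambda>x. F (x + b) - F x)"
  proof (rule HK_cong)
    fix x
    have "((\<lambda>t. F' (x + t *\<^sub>R b)) has_integral F (x + 1 *\<^sub>R b) - F (x + 0 *\<^sub>R b)) {0..1}"
      by (intro fundamental_theorem_of_calculus)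
        (auto intro: has_field_derivative_at_within der simp flip: has_real_derivative_iff_has_vector_derivative)
    then show "integral (cbox 0 1) (\<lambda>t::real. F' (x + t *\<^sub>R b)) = F (x + b) - F x"
      by (simp add: integral_unique)
  qed
  also have "\<dots> = integral ?B (\<lambda>x. F (x + b)) - integral ?B F"
    by (intro Henstock_Kurzweil_Integration.integral_diff integrable_continuous
        continuous_on_compose2[OF F] continuous_intros continuous_on_subset[OF F]) auto
  also have "\<dots> = 0"
    using shift[OF F F0, of 1] shift[OF F F0, of 0] by simp
  finally show ?thesis .
qed

section \<open>Change of variables\<close>

text \<open>
  The change of variables theorem of the library needs a well-ordered index type. A bijection of
  finite index types transports it to arbitrary ones.
\<close>

typedef (overloaded) ('m::finite) idx = "{..<CARD('m)}"
  using zero_less_card_finite by blast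

setup_lifting type_definition_idx

instantiation idx :: (finite) linorder
begin
lift_definition less_eq_idx :: "'a idx \<Rightarrow> 'a idx \<Rightarrow> bool" is "(\<le>)" .
lift_definition less_idx :: "'a idx \<Rightarrow> 'a idx \<Rightarrow> bool" is "(<)" .
instance by standard (transfer; auto)+
end

instance idx :: (finite) wellorder
proof
  fix P :: "'a idx \<Rightarrow> bool" and a :: "'a idx"
  assume *: "\<And>x. (\<And>y. y < x \<Longrightarrow> P y) \<Longrightarrow> P x"
  show "P a"
    by (induction "Rep_idx a" arbitrary: a rule: less_induct) (rule *, simp add: less_idx.rep_eq)
qed

lemma range_Rep_idx: "range (Rep_idx :: 'm::finite idx \<Rightarrow> nat) = {..<CARD('m)}"
  using type_definition.Rep_range[OF type_definition_idx] .

instance idx :: (finite) finite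
proof
  have "inj (Rep_idx :: 'a idx \<Rightarrow> nat)" by (simp add: inj_def Rep_idx_inject)
  then show "finite (UNIV :: 'a idx set)"
    by (rule finite_imageD[rotated]) (simp add: range_Rep_idx)
qed

lemma ex_bij_idx: "\<exists>\<pi> :: 'm::finite idx \<Rightarrow> 'm. bij \<pi>"
proof -
  have "inj (Rep_idx :: 'm idx \<Rightarrow> nat)" by (simp add: inj_def Rep_idx_inject)
  then have "CARD('m idx) = CARD('m)"
    using card_image[of "Rep_idx :: 'm idx \<Rightarrow> nat" UNIV] by (simp add: range_Rep_idx)
  then show ?thesis
    using finite_same_card_bij[of "UNIV :: 'm idx set" "UNIV :: 'm set"] by auto
qed

section \<open>Permuting and renaming coordinates\<close>

definition reindex :: "('n \<Rightarrow> 'm) \<Rightarrow> real^'m \<Rightarrow> real^'n" where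
  "reindex \<pi> x = (\<chi> i. x $ \<pi> i)"

lemma reindex_nth [simp]: "reindex \<pi> x $ i = x $ \<pi> i"
  by (simp add: reindex_def)

lemma bounded_linear_reindex: "bounded_linear (reindex \<pi> :: real^'m::finite \<Rightarrow> real^'n::finite)"
  by (intro linear_conv_bounded_linear[THEN iffD1] linearI) (simp_all add: vec_eq_iff)

lemma reindex_inverse:
  fixes \<pi> :: "'n::finite \<Rightarrow> 'm::finite"
  assumes "bij \<pi>"
  shows "reindex \<pi> (reindex (inv \<pi>) x) = x" "reindex (inv \<pi>) (reindex \<pi> y) = y"
  using assms by (auto simp: vec_eq_iff bij_is_inj inv_f_f bij_is_surj surj_f_inv_f)

lemma reindex_cbox:
  fixes \<rho> :: "'n::finite \<Rightarrow> 'm::finite"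
  assumes "bij \<rho>"
  shows "reindex \<rho> ` cbox u v = cbox (reindex \<rho> u) (reindex \<rho> v)"
proof
  show "reindex \<rho> ` cbox u v \<subseteq> cbox (reindex \<rho> u) (reindex \<rho> v)"
    by (auto simp: mem_box_cart)
  show "cbox (reindex \<rho> u) (reindex \<rho> v) \<subseteq> reindex \<rho> ` cbox u v"
  proof
    fix y assume y: "y \<in> cbox (reindex \<rho> u) (reindex \<rho> v)"
    have "u $ i \<le> y $ inv \<rho> i \<and> y $ inv \<rho> i \<le> v $ i" for i
      using y[unfolded mem_box_cart, rule_format, of "inv \<rho> i"] assms
      by (simp add: bij_is_surj surj_f_inv_f)
    then have "reindex (inv \<rho>) y \<in> cbox u v" by (simp add: mem_box_cart)
    then show "y \<in> reindex \<rho> ` cbox u v" using reindex_inverse(1)[OF assms, of y] by (metis imageI)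
  qed
qed

text \<open>Renaming coordinates maps boxes to boxes with the same edge lengths, so it preserves
  their content.\<close>

lemma integral_reindex:
  fixes \<pi> :: "'n::finite \<Rightarrow> 'm::finite" and g :: "real^'m \<Rightarrow> real"
  assumes \<pi>: "bij \<pi>" and g: "continuous_on UNIV g" "compact K" "\<And>x. x \<notin> K \<Longrightarrow> g x = 0"
  shows "integral UNIV (\<lambda>y. g (reindex (inv \<pi>) y)) = integral UNIV g"
proof -
  obtain a where K: "K \<subseteq> cbox (- a) a"
    using bounded_subset_cbox_symmetric compact_imp_bounded g(2) by metis
  have bij': "bij (inv \<pi>)" using \<pi> by (rule bij_imp_bij_inv)
  have content: "measure lborel (reindex (inv \<pi>) ` cbox u v) = 1 * measure lborel (cbox u v)" for u v :: "real^'n"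
  proof (cases "cbox u v = {}")
    case False
    then have "reindex (inv \<pi>) ` cbox u v \<noteq> {}" by simp
    then have ne: "cbox (reindex (inv \<pi>) u) (reindex (inv \<pi>) v) \<noteq> {}" unfolding reindex_cbox[OF bij'] .
    have "(\<Prod>i\<in>UNIV. v $ inv \<pi> i - u $ inv \<pi> i) = (\<Prod>i\<in>UNIV. v $ i - u $ i)"
      by (rule prod.reindex_bij_betw[OF bij', of "\<lambda>i. v $ i - u $ i"])
    then show ?thesis using False ne by (simp add: reindex_cbox[OF bij'] content_cbox_cart)
  qed simp
  have "(g has_integral integral (cbox (- a) a) g) (cbox (- a) a)"
    by (intro integrable_integral integrable_continuous continuous_on_subset[OF g(1)]) auto
  from has_integral_twiddle[of 1 "reindex \<pi>" "reindex (inv \<pi>)", OF _ _ _ _ _ _ content this,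
      OF zero_less_one reindex_inverse[OF \<pi>] linear_continuous_at[OF bounded_linear_reindex]]
  have "((\<lambda>y. g (reindex (inv \<pi>) y)) has_integral integral (cbox (- a) a) g) (reindex \<pi> ` cbox (- a) a)"
    using reindex_cbox[OF \<pi>] reindex_cbox[OF bij'] by auto
  then have "((\<lambda>y. g (reindex (inv \<pi>) y)) has_integral integral (cbox (- a) a) g) UNIV"
  proof (rule has_integral_on_superset)
    fix y assume "y \<notin> reindex \<pi> ` cbox (- a) a"
    then have "reindex (inv \<pi>) y \<notin> cbox (- a) a" using reindex_inverse(1)[OF \<pi>, of y] by (metis imageI)
    then show "g (reindex (inv \<pi>) y) = 0" using K g(3) by blast
  qed simp
  moreover have "integral UNIV g = integral (cbox (- a) a) g"
    using K g(3) by (intro integral_on_subset) auto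
  ultimately show ?thesis by (simp add: integral_unique)
qed

section \<open>Orientation signs and integrals of top-degree forms\<close>

lemma Alt_top_proportional:
  fixes f g :: "'e::euclidean_space list \<Rightarrow> real"
  assumes "Alt (length bs) f" "Alt (length bs) g" "distinct bs" "set bs = Basis"
  shows "f vs * g bs = f bs * g vs"
proof -
  have "fscale (g bs) f - fscale (f bs) g = 0"
    by (rule Alt_top_eq_0[of bs])
      (use assms in \<open>auto intro: Alt_diff Alt_fscale simp: minus_apply fscale_def\<close>)
  then have "(fscale (g bs) f - fscale (f bs) g) vs = 0" by (simp add: zero_fun_apply)
  then show ?thesis by (simp add: minus_apply fscale_def mult.commute)
qed

text \<open>Reordering a frame multiplies both top-degree forms by the same sign, which cancels in
  the product with \<open>sgn\<close>.\<close>

lemma Alt_top_sgn_permute: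
  fixes f g :: "'e::euclidean_space list \<Rightarrow> real"
  assumes "Alt (length bs) f" "Alt (length bs) g" "distinct bs" "set bs = Basis"
    and ps: "mset ps = mset bs"
  shows "f ps * sgn (g ps) = f bs * sgn (g bs)"
proof (cases "g bs = 0")
  case True
  then show ?thesis using Alt_permute[OF assms(2) ps] by simp
next
  case False
  have "f ps * sgn (g ps) = f bs * g ps * sgn (g ps) / g bs"
    using Alt_top_proportional[OF assms(1-4), of ps] False by (simp add: field_simps)
  also have "\<dots> = f bs * (\<bar>g ps\<bar> / g bs)" by (simp add: linordered_idom_class.abs_sgn)
  also have "\<bar>g ps\<bar> / g bs = sgn (g bs)"
    using False by (simp add: Alt_permute[OF assms(2) ps] sgn_real_def)
  finally show ?thesis .
qed

lemma reindex_axis: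
  assumes "bij \<pi>" shows "reindex (inv \<pi>) (axis i 1) = axis (\<pi> i) 1"
  using assms by (auto simp: vec_eq_iff axis_def bij_is_inj inv_f_f bij_is_surj surj_f_inv_f)

lemma map_reindex_std_frame:
  fixes \<pi> :: "'n::finite \<Rightarrow> 'm::finite"
  assumes "bij \<pi>"
  shows "mset (map (reindex (inv \<pi>)) std_frame) = mset (std_frame :: (real^'m) list)"
proof -
  let ?\<Psi> = "reindex (inv \<pi>) :: real^'n \<Rightarrow> real^'m"
  have "inj ?\<Psi>" using reindex_inverse[OF assms] by (metis injI)
  then have "distinct (map ?\<Psi> std_frame)"
    by (auto simp: distinct_map std_frame intro: inj_on_subset)
  moreover have "set (map ?\<Psi> std_frame) = set (std_frame :: (real^'m) list)"
  proof -
    have "?\<Psi> ` Basis = (Basis :: (real^'m) set)"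
    proof
      show "?\<Psi> ` Basis \<subseteq> Basis" by (auto simp: Basis_vec_def reindex_axis[OF assms])
      show "Basis \<subseteq> ?\<Psi> ` Basis"
      proof
        fix b :: "real^'m" assume "b \<in> Basis"
        then obtain j where "b = axis j 1" by (auto simp: Basis_vec_def)
        then have "b = ?\<Psi> (axis (inv \<pi> j) 1)"
          using assms by (simp add: reindex_axis bij_is_surj surj_f_inv_f)
        then show "b \<in> ?\<Psi> ` Basis" by (auto simp: axis_in_Basis_iff)
      qed
    qed
    then show ?thesis by (simp add: std_frame)
  qed
  ultimately show ?thesis using std_frame(1) set_eq_iff_mset_eq_distinct by blast
qed

text \<open>Scalars are embedded in \<open>real^1\<close> to match the vector-valued integrand of
  the change of variables theorem.\<close>

lemma integral_change_of_variables_real: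
  fixes f :: "real^'m::{finite,wellorder} \<Rightarrow> real"
  assumes "S \<in> sets lebesgue"
    and "\<And>x. x \<in> S \<Longrightarrow> (g has_derivative g' x) (at x within S)" "inj_on g S"
    and f: "f absolutely_integrable_on g ` S"
  shows "integral S (\<lambda>x. \<bar>det (matrix (g' x))\<bar> * f (g x)) = integral (g ` S) f"
proof -
  let ?J = "\<lambda>r. vec r :: real^1"
  have J: "bounded_linear ?J"
    by (intro linear_conv_bounded_linear[THEN iffD1] linearI) (simp_all add: vec_eq_iff)
  have nth: "bounded_linear (\<lambda>v::real^1. v $ 1)" by (rule bounded_linear_vec_nth)
  let ?b = "integral (g ` S) (\<lambda>x. ?J (f x))"
  have "(\<lambda>x. ?J (f x)) absolutely_integrable_on g ` S"
    using absolutely_integrable_linear[OF f J] by (simp add: o_def)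
  then have *: "(\<lambda>x. \<bar>det (matrix (g' x))\<bar> *\<^sub>R ?J (f (g x))) absolutely_integrable_on S"
    "integral S (\<lambda>x. \<bar>det (matrix (g' x))\<bar> *\<^sub>R ?J (f (g x))) = ?b"
    using has_absolute_integral_change_of_variables[OF assms(1-3), of "\<lambda>x. ?J (f x)" ?b] by auto
  have "integral S (\<lambda>x. \<bar>det (matrix (g' x))\<bar> * f (g x))
      = integral S (\<lambda>x. \<bar>det (matrix (g' x))\<bar> *\<^sub>R ?J (f (g x))) $ 1"
    using integral_linear[OF absolutely_integrable_on_def[THEN iffD1, OF *(1), THEN conjunct1] nth]
    by (simp add: o_def)
  also have "\<dots> = integral (g ` S) f"
    using integral_linear[OF absolutely_integrable_on_def[THEN iffD1, OF f, THEN conjunct1] J]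
    by (simp add: *(2) o_def)
  finally show ?thesis .
qed

lemma integral_on_reindex:
  fixes \<pi> :: "'n::finite \<Rightarrow> 'm::finite" and g :: "real^'m \<Rightarrow> real"
  assumes \<pi>: "bij \<pi>" and U: "open U" "compact K" "K \<subseteq> U" "continuous_on U g" "\<And>x. x \<in> U - K \<Longrightarrow> g x = 0"
  shows "integral (reindex \<pi> ` U) (\<lambda>y. g (reindex (inv \<pi>) y)) = integral U g"
    and "(\<lambda>y. g (reindex (inv \<pi>) y)) absolutely_integrable_on reindex \<pi> ` U"
proof -
  let ?G = "\<lambda>x. if x \<in> U then g x else 0"
  note G = continuous_on_zero_extension[OF U]
  have G0: "?G x = 0" if "x \<notin> K" for x using U(5) that by auto
  have mem: "reindex (inv \<pi>) y \<in> S \<longleftrightarrow> y \<in> reindex \<pi> ` S" for y S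
    using reindex_inverse[OF \<pi>] by (auto simp: image_iff) metis
  have eq: "?G (reindex (inv \<pi>) y) = (if y \<in> reindex \<pi> ` U then g (reindex (inv \<pi>) y) else 0)" for y
    by (simp add: mem)
  have "integral UNIV (\<lambda>y. ?G (reindex (inv \<pi>) y)) = integral UNIV ?G"
    by (rule integral_reindex[OF \<pi> G U(2) G0])
  then show "integral (reindex \<pi> ` U) (\<lambda>y. g (reindex (inv \<pi>) y)) = integral U g"
    unfolding eq by (simp only: HK_restrict_UNIV)
  have "(\<lambda>y. ?G (reindex (inv \<pi>) y)) absolutely_integrable_on UNIV"
  proof (rule absolutely_integrable_compact_support)
    show "continuous_on UNIV (\<lambda>y. ?G (reindex (inv \<pi>) y))"
      by (intro continuous_on_compose2[OF G] linear_continuous_on[OF bounded_linear_reindex]) auto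
    show "compact (reindex \<pi> ` K)"
      by (intro compact_continuous_image U linear_continuous_on[OF bounded_linear_reindex])
    show "?G (reindex (inv \<pi>) y) = 0" if "y \<notin> reindex \<pi> ` K" for y
      using that G0[of "reindex (inv \<pi>) y"] by (simp add: mem)
  qed
  then show "(\<lambda>y. g (reindex (inv \<pi>) y)) absolutely_integrable_on reindex \<pi> ` U"
    unfolding eq by (simp only: absolutely_integrable_restrict_UNIV)
qed

lemma open_reindex_image:
  fixes \<pi> :: "'n::finite \<Rightarrow> 'm::finite"
  assumes "bij \<pi>" "open S" shows "open (reindex \<pi> ` S)"
proof -
  have "reindex \<pi> ` S = reindex (inv \<pi>) -` S"
    using reindex_inverse[OF assms(1)] by (auto simp: image_iff) metis
  then show ?thesis
    using assms(2) by (simp add: continuous_open_vimage linear_continuous_at[OF bounded_linear_reindex])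
qed

text \<open>The Jacobian is hidden in the forms. Evaluating \<open>f\<close> on the image frame
  produces the determinant and the sign of \<open>g\<close> produces its sign, so together they give
  the absolute value. Orientation-reversing maps are thereby included.\<close>

lemma integral_top_form_change:
  fixes T :: "real^'m::finite \<Rightarrow> real^'m" and f g :: "real^'m \<Rightarrow> (real^'m) list \<Rightarrow> real"
  assumes S: "open S" and inj: "inj_on T S" and TS: "open (T ` S)"
    and T': "\<And>x. x \<in> S \<Longrightarrow> (T has_derivative T' x) (at x)"
    and f: "\<And>y. y \<in> T ` S \<Longrightarrow> Alt CARD('m) (f y)" and g: "\<And>y. y \<in> T ` S \<Longrightarrow> Alt CARD('m) (g y)"
    and K: "compact K" "K \<subseteq> T ` S" "continuous_on (T ` S) (\<lambda>y. f y std_frame * sgn (g y std_frame))"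
      "\<And>y. y \<in> T ` S - K \<Longrightarrow> f y std_frame * sgn (g y std_frame) = 0"
    and L: "compact L" "L \<subseteq> S"
      "continuous_on S (\<lambda>x. f (T x) (map (T' x) std_frame) * sgn (g (T x) (map (T' x) std_frame)))"
      "\<And>x. x \<in> S - L \<Longrightarrow> f (T x) (map (T' x) std_frame) * sgn (g (T x) (map (T' x) std_frame)) = 0"
  shows "integral S (\<lambda>x. f (T x) (map (T' x) std_frame) * sgn (g (T x) (map (T' x) std_frame)))
    = integral (T ` S) (\<lambda>y. f y std_frame * sgn (g y std_frame))"
proof -
  obtain \<pi> :: "'m idx \<Rightarrow> 'm" where \<pi>: "bij \<pi>" using ex_bij_idx by blast
  have card: "CARD('m idx) = CARD('m)" using bij_betw_same_card[OF \<pi>] by simp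
  let ?\<Phi> = "reindex \<pi> :: real^'m \<Rightarrow> real^'m idx" and ?\<Psi> = "reindex (inv \<pi>) :: real^'m idx \<Rightarrow> real^'m"
  let ?h = "\<lambda>y. f y std_frame * sgn (g y std_frame)"
  let ?k = "\<lambda>x. f (T x) (map (T' x) std_frame) * sgn (g (T x) (map (T' x) std_frame))"
  let ?T = "\<lambda>z. ?\<Phi> (T (?\<Psi> z))" and ?T' = "\<lambda>z v. ?\<Phi> (T' (?\<Psi> z) (?\<Psi> v))"
  have lin: "linear ?\<Phi>" "linear ?\<Psi>" by (rule bounded_linear.linear[OF bounded_linear_reindex])+
  have img: "?T ` ?\<Phi> ` S = ?\<Phi> ` T ` S" by (simp add: image_image reindex_inverse[OF \<pi>])
  have "integral (?\<Phi> ` S) (\<lambda>z. \<bar>det (matrix (?T' z))\<bar> * ?h (?\<Psi> (?T z)))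
      = integral (?T ` ?\<Phi> ` S) (\<lambda>y. ?h (?\<Psi> y))"
  proof (rule integral_change_of_variables_real)
    show "?\<Phi> ` S \<in> sets lebesgue" using open_reindex_image[OF \<pi> S] by auto
    show "(?T has_derivative ?T' z) (at z within ?\<Phi> ` S)" if "z \<in> ?\<Phi> ` S" for z
    proof -
      have "?\<Psi> z \<in> S" using that by (auto simp: reindex_inverse[OF \<pi>])
      have "((\<lambda>z. T (?\<Psi> z)) has_derivative (\<lambda>v. T' (?\<Psi> z) (?\<Psi> v))) (at z)"
        using diff_chain_at[OF bounded_linear_imp_has_derivative[OF bounded_linear_reindex] T'[OF \<open>?\<Psi> z \<in> S\<close>]]
        by (simp add: o_def)
      then show ?thesis
        by (rule has_derivative_at_withinI[OF bounded_linear.has_derivative[OF bounded_linear_reindex]])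
    qed
    show "inj_on ?T (?\<Phi> ` S)"
    proof (rule inj_onI)
      fix a b assume a: "a \<in> ?\<Phi> ` S" and b: "b \<in> ?\<Phi> ` S" and eq: "?T a = ?T b"
      have "T (?\<Psi> a) = T (?\<Psi> b)" using arg_cong[OF eq, of ?\<Psi>] by (simp only: reindex_inverse[OF \<pi>])
      moreover have "?\<Psi> a \<in> S" "?\<Psi> b \<in> S" using a b by (auto simp: reindex_inverse[OF \<pi>])
      ultimately have "?\<Psi> a = ?\<Psi> b" using inj by (simp add: inj_on_def)
      from arg_cong[OF this, of ?\<Phi>] show "a = b" by (simp only: reindex_inverse[OF \<pi>])
    qed
    show "(\<lambda>y. ?h (?\<Psi> y)) absolutely_integrable_on ?T ` ?\<Phi> ` S"
      unfolding img by (rule integral_on_reindex(2)[OF \<pi> TS K])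
  qed
  also have "integral (?T ` ?\<Phi> ` S) (\<lambda>y. ?h (?\<Psi> y)) = integral (T ` S) ?h"
    unfolding img by (rule integral_on_reindex(1)[OF \<pi> TS K])
  also have "integral (?\<Phi> ` S) (\<lambda>z. \<bar>det (matrix (?T' z))\<bar> * ?h (?\<Psi> (?T z)))
      = integral (?\<Phi> ` S) (\<lambda>z. ?k (?\<Psi> z))"
  proof (rule HK_cong)
    fix z assume "z \<in> ?\<Phi> ` S"
    then have x: "?\<Psi> z \<in> S" by (auto simp: reindex_inverse[OF \<pi>])
    let ?y = "T (?\<Psi> z)" and ?D = "T' (?\<Psi> z)"
    let ?ps = "map ?\<Psi> std_frame"
    have D: "linear ?D" using has_derivative_linear[OF T'[OF x]] .
    then have T'lin: "linear (?T' z)"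
      using linear_compose[OF linear_compose[OF lin(2) D] lin(1)] by (simp add: o_def)
    have fy: "Alt CARD('m) (f ?y)" and gy: "Alt CARD('m) (g ?y)" using f g x by auto
    have map: "q (map ?D ?ps) = det (matrix (?T' z)) * q ?ps" if q: "Alt CARD('m) q" for q
    proof -
      have "Alt CARD('m idx) (\<lambda>vs. q (map ?\<Psi> vs))"
        unfolding card by (rule Alt_map[OF q lin(2)])
      from Alt_top_map[OF this T'lin] show ?thesis
        by (simp add: o_def reindex_inverse[OF \<pi>])
    qed
    have perm: "p ?ps * sgn (q ?ps) = p std_frame * sgn (q std_frame)"
      if "Alt CARD('m) p" "Alt CARD('m) q" for p q
      using that std_frame(1,2) map_reindex_std_frame[OF \<pi>]
      by (intro Alt_top_sgn_permute) (simp_all add: std_frame(3))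
    \<comment> \<open>The frame carried over from the other index type is only a permutation of
      \<open>std_frame\<close>. So reorder, extract the determinant from both factors, and reorder
      back.\<close>
    have "?k (?\<Psi> z) = f ?y (map ?D ?ps) * sgn (g ?y (map ?D ?ps))"
      by (rule perm[symmetric, OF Alt_map[OF fy D] Alt_map[OF gy D]])
    also have "\<dots> = \<bar>det (matrix (?T' z))\<bar> * (f ?y ?ps * sgn (g ?y ?ps))"
      unfolding map[OF fy] map[OF gy] by (simp add: sgn_mult linordered_idom_class.abs_sgn mult_ac)
    also have "f ?y ?ps * sgn (g ?y ?ps) = ?h ?y" by (rule perm[OF fy gy])
    finally show "\<bar>det (matrix (?T' z))\<bar> * ?h (?\<Psi> (?T z)) = ?k (?\<Psi> z)"
      by (simp add: reindex_inverse[OF \<pi>])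
  qed
  also have "\<dots> = integral S ?k"
    by (rule integral_on_reindex(1)[OF \<pi> S L])
  finally show ?thesis .
qed

section \<open>The exterior derivative in a chart\<close>

lemma frechet_derivativeI: "(f has_derivative f') (at x) \<Longrightarrow> frechet_derivative f (at x) v = f' v"
  using frechet_derivative_at by metis

lemma has_derivative_zero_on_open:
  assumes "open V" "x \<in> V" "\<And>y. y \<in> V \<Longrightarrow> f y = 0"
  shows "(f has_derivative (\<lambda>_. 0)) (at x)"
  by (rule has_derivative_transform_within_open[OF has_derivative_const[of 0]]) (use assms in auto)

text \<open>The formula of \<open>ext_d\<close> in one chart and without its guard. It thus also
  applies to contractions with a constant vector, which make sense only within the chart.\<close>

definition local_d :: "('e::real_normed_vector \<Rightarrow> 'e list \<Rightarrow> real) \<Rightarrow> 'e \<Rightarrow> 'e list \<Rightarrow> real" where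
  "local_d \<alpha> x vs = (\<Sum>i<length vs. (-1) ^ i *
     frechet_derivative (\<lambda>y. \<alpha> y (take i vs @ drop (Suc i) vs)) (at x) (vs ! i))"

text \<open>The Lie derivative along the constant vector field \<open>v\<close>.\<close>

definition dderiv :: "('e::real_normed_vector \<Rightarrow> 'e list \<Rightarrow> real) \<Rightarrow> 'e \<Rightarrow> 'e \<Rightarrow> 'e list \<Rightarrow> real" where
  "dderiv \<alpha> x v us = frechet_derivative (\<lambda>y. \<alpha> y us) (at x) v"

definition fdiff :: "('e::real_normed_vector \<Rightarrow> 'e list \<Rightarrow> real) \<Rightarrow> 'e \<Rightarrow> bool" where
  "fdiff \<alpha> x \<longleftrightarrow> (\<forall>us. (\<lambda>y. \<alpha> y us) differentiable (at x))"

lemma ext_d_eq_local_d: "c \<in> A \<Longrightarrow> x \<in> chart_image c \<Longrightarrow> ext_d A \<alpha> c x = local_d (\<alpha> c) x"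
  by (simp add: ext_d_def local_d_def fun_eq_iff)

lemma local_d_Nil [simp]: "local_d \<alpha> x [] = 0"
  by (simp add: local_d_def)

text \<open>Cartan's formula for the constant field \<open>v\<close>. It is the recursion that
  drives all inductions about \<open>local_d\<close>.\<close>

lemma local_d_Cons: "local_d \<alpha> x (v # vs) = dderiv \<alpha> x v vs - local_d (\<lambda>y. contract v (\<alpha> y)) x vs"
  by (simp add: local_d_def dderiv_def contract_apply sum.lessThan_Suc_shift sum_negf del: sum.lessThan_Suc)

lemma contract_local_d: "contract v (local_d \<alpha> x) = dderiv \<alpha> x v - local_d (\<lambda>y. contract v (\<alpha> y)) x"
  by (simp add: fun_eq_iff contract_apply minus_apply local_d_Cons)

lemma fdiff_has_derivative:
  "fdiff \<alpha> x \<Longrightarrow> ((\<lambda>y. \<alpha> y us) has_derivative (\<lambda>v. dderiv \<alpha> x v us)) (at x)"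
  unfolding fdiff_def dderiv_def using frechet_derivative_works by blast

lemma fdiff_contract: "fdiff \<alpha> x \<Longrightarrow> fdiff (\<lambda>y. contract v (\<alpha> y)) x"
  by (simp add: fdiff_def contract_apply)

lemma fdiff_twist: "fdiff \<alpha> x \<Longrightarrow> fdiff (\<lambda>y. twist (\<alpha> y)) x"
  by (simp add: fdiff_def twist_def)

lemma fdiff_fwedge: "fdiff \<alpha> x \<Longrightarrow> fdiff \<beta> x \<Longrightarrow> fdiff (\<lambda>y. fwedge (\<alpha> y) (\<beta> y)) x"
  by (simp add: fdiff_def fwedge_def)

lemma fdiff_funit: "fdiff (\<lambda>y. funit) x"
  by (simp add: fdiff_def)

lemma dderiv_add:
  assumes "fdiff \<alpha> x" "fdiff \<beta> x"
  shows "dderiv (\<lambda>y. \<alpha> y + \<beta> y) x v = dderiv \<alpha> x v + dderiv \<beta> x v"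
proof
  fix us
  show "dderiv (\<lambda>y. \<alpha> y + \<beta> y) x v us = (dderiv \<alpha> x v + dderiv \<beta> x v) us"
    unfolding dderiv_def[of "\<lambda>y. \<alpha> y + \<beta> y"] plus_fun_apply
    by (intro frechet_derivativeI has_derivative_add fdiff_has_derivative assms)
qed

lemma dderiv_twist:
  assumes "fdiff \<alpha> x"
  shows "dderiv (\<lambda>y. twist (\<alpha> y)) x v = twist (dderiv \<alpha> x v)"
proof
  fix us
  show "dderiv (\<lambda>y. twist (\<alpha> y)) x v us = twist (dderiv \<alpha> x v) us"
    unfolding dderiv_def[of "\<lambda>y. twist (\<alpha> y)"] twist_def
    by (intro frechet_derivativeI has_derivative_mult_right fdiff_has_derivative assms)
qed

lemma dderiv_fwedge:
  assumes "fdiff \<alpha> x" "fdiff \<beta> x"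
  shows "dderiv (\<lambda>y. fwedge (\<alpha> y) (\<beta> y)) x v = fwedge (dderiv \<alpha> x v) (\<beta> x) + fwedge (\<alpha> x) (dderiv \<beta> x v)"
proof
  fix us
  have "((\<lambda>y. fwedge (\<alpha> y) (\<beta> y) us) has_derivative
      (\<lambda>v. \<Sum>S\<in>Pow {..<length us}. shuffle_sign S * \<alpha> x (nths us S) * dderiv \<beta> x v (nths us (- S))
        + shuffle_sign S * dderiv \<alpha> x v (nths us S) * \<beta> x (nths us (- S)))) (at x)"
    unfolding fwedge_def
    by (intro has_derivative_sum has_derivative_mult has_derivative_mult_right fdiff_has_derivative assms)
  then show "dderiv (\<lambda>y. fwedge (\<alpha> y) (\<beta> y)) x v us = (fwedge (dderiv \<alpha> x v) (\<beta> x) + fwedge (\<alpha> x) (dderiv \<beta> x v)) us"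
    by (simp add: dderiv_def[of "\<lambda>y. fwedge (\<alpha> y) (\<beta> y)"] frechet_derivativeI plus_fun_apply fwedge_def sum.distrib add.commute)
qed

lemma local_d_add:
  assumes "fdiff \<alpha> x" "fdiff \<beta> x"
  shows "local_d (\<lambda>y. \<alpha> y + \<beta> y) x = local_d \<alpha> x + local_d \<beta> x"
proof
  fix vs
  show "local_d (\<lambda>y. \<alpha> y + \<beta> y) x vs = (local_d \<alpha> x + local_d \<beta> x) vs"
    using fun_cong[OF dderiv_add[OF assms]]
    by (simp add: local_d_def dderiv_def plus_fun_apply[of _ _ vs for vs] distrib_left sum.distrib)
qed

text \<open>The sign arises because the differential raises the degree by one.\<close>

lemma local_d_twist:
  assumes "fdiff \<alpha> x"
  shows "local_d (\<lambda>y. twist (\<alpha> y)) x = - twist (local_d \<alpha> x)"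
proof
  fix vs
  have "(-1) ^ i * dderiv (\<lambda>y. twist (\<alpha> y)) x (vs ! i) (take i vs @ drop (Suc i) vs)
      = - ((-1) ^ length vs * ((-1) ^ i * dderiv \<alpha> x (vs ! i) (take i vs @ drop (Suc i) vs)))"
    if "i < length vs" for i
  proof -
    have "length vs = Suc (length (take i vs @ drop (Suc i) vs))" using that by simp
    then show ?thesis by (simp only: dderiv_twist[OF assms] twist_def[of "dderiv \<alpha> x v" for v]) simp
  qed
  then show "local_d (\<lambda>y. twist (\<alpha> y)) x vs = (- twist (local_d \<alpha> x)) vs"
    by (simp add: local_d_def dderiv_def uminus_apply twist_def[of "local_d \<alpha> x"] sum_distrib_left sum_negf flip: sum_negf)
qed

text \<open>Both sides satisfy the same recursion, by Cartan's formula and the antiderivation rule.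
  The hypothesis is applied to contracted and twisted factors, so the induction keeps both factors
  arbitrary.\<close>

lemma local_d_fwedge:
  assumes "fdiff \<alpha> x" "fdiff \<beta> x"
  shows "local_d (\<lambda>y. fwedge (\<alpha> y) (\<beta> y)) x = fwedge (local_d \<alpha> x) (\<beta> x) + fwedge (twist (\<alpha> x)) (local_d \<beta> x)"
proof
  fix vs
  show "local_d (\<lambda>y. fwedge (\<alpha> y) (\<beta> y)) x vs = (fwedge (local_d \<alpha> x) (\<beta> x) + fwedge (twist (\<alpha> x)) (local_d \<beta> x)) vs"
    using assms
  proof (induction vs arbitrary: \<alpha> \<beta>)
    case Nil
    then show ?case by (simp add: plus_fun_apply)
  next
    case (Cons v vs)
    note d = Cons.prems fdiff_contract[OF Cons.prems(1), of v] fdiff_contract[OF Cons.prems(2), of v]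
      fdiff_twist[OF Cons.prems(1)]
    have "local_d (\<lambda>y. fwedge (\<alpha> y) (\<beta> y)) x (v # vs) = (fwedge (dderiv \<alpha> x v) (\<beta> x) + fwedge (\<alpha> x) (dderiv \<beta> x v)) vs
       - local_d (\<lambda>y. fwedge (contract v (\<alpha> y)) (\<beta> y) + fwedge (twist (\<alpha> y)) (contract v (\<beta> y))) x vs"
      unfolding local_d_Cons dderiv_fwedge[OF Cons.prems] contract_fwedge ..
    also have "local_d (\<lambda>y. fwedge (contract v (\<alpha> y)) (\<beta> y) + fwedge (twist (\<alpha> y)) (contract v (\<beta> y))) x vs
        = local_d (\<lambda>y. fwedge (contract v (\<alpha> y)) (\<beta> y)) x vs + local_d (\<lambda>y. fwedge (twist (\<alpha> y)) (contract v (\<beta> y))) x vs"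
      by (simp only: local_d_add[OF fdiff_fwedge[OF d(3,2)] fdiff_fwedge[OF d(5,4)]] plus_fun_apply)
    also have "local_d (\<lambda>y. fwedge (contract v (\<alpha> y)) (\<beta> y)) x vs
        = fwedge (local_d (\<lambda>y. contract v (\<alpha> y)) x) (\<beta> x) vs + fwedge (twist (contract v (\<alpha> x))) (local_d \<beta> x) vs"
      by (simp only: Cons.IH[OF d(3,2)] plus_fun_apply)
    also have "local_d (\<lambda>y. fwedge (twist (\<alpha> y)) (contract v (\<beta> y))) x vs
        = - fwedge (twist (local_d \<alpha> x)) (contract v (\<beta> x)) vs + fwedge (\<alpha> x) (local_d (\<lambda>y. contract v (\<beta> y)) x) vs"
      by (simp only: Cons.IH[OF d(5,4)] plus_fun_apply local_d_twist[OF d(1)] twist_twist fwedge_minus_left)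
        (simp only: uminus_apply)
    finally have 1: "local_d (\<lambda>y. fwedge (\<alpha> y) (\<beta> y)) x (v # vs) = fwedge (dderiv \<alpha> x v) (\<beta> x) vs + fwedge (\<alpha> x) (dderiv \<beta> x v) vs
       - (fwedge (local_d (\<lambda>y. contract v (\<alpha> y)) x) (\<beta> x) vs + fwedge (twist (contract v (\<alpha> x))) (local_d \<beta> x) vs
          + (- fwedge (twist (local_d \<alpha> x)) (contract v (\<beta> x)) vs + fwedge (\<alpha> x) (local_d (\<lambda>y. contract v (\<beta> y)) x) vs))"
      by (simp only: plus_fun_apply)
    have 2: "(fwedge (local_d \<alpha> x) (\<beta> x) + fwedge (twist (\<alpha> x)) (local_d \<beta> x)) (v # vs)
      = fwedge (dderiv \<alpha> x v) (\<beta> x) vs - fwedge (local_d (\<lambda>y. contract v (\<alpha> y)) x) (\<beta> x) vs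
        + fwedge (twist (local_d \<alpha> x)) (contract v (\<beta> x)) vs
        + (- fwedge (twist (contract v (\<alpha> x))) (local_d \<beta> x) vs
           + (fwedge (\<alpha> x) (dderiv \<beta> x v) vs - fwedge (\<alpha> x) (local_d (\<lambda>y. contract v (\<beta> y)) x) vs))"
      by (simp only: plus_fun_apply fwedge_Cons contract_local_d fwedge_diff_left fwedge_diff_right minus_apply
          contract_twist fwedge_minus_left twist_twist) (simp only: uminus_apply)
    show ?case unfolding 1 2 by simp
  qed
qed

section \<open>Differentials of functions and integration by parts\<close>

definition covector :: "('e \<Rightarrow> real) \<Rightarrow> 'e list \<Rightarrow> real" where
  "covector L vs = (if length vs = 1 then L (hd vs) else 0)"

lemma Alt_covector:
  assumes L: "linear L" shows "Alt 1 (covector L)"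
proof -
  have "linear (\<lambda>v. covector L (v # vs))" for vs
    using L by (cases vs) (simp_all add: covector_def module_hom_zero)
  then show ?thesis
    by (auto simp: covector_def contract_apply fun_eq_iff zero_fun_apply)
qed

lemma covector_eq_0: "(\<And>v. L v = 0) \<Longrightarrow> covector L = 0"
  by (simp add: covector_def fun_eq_iff zero_fun_apply)

text \<open>A function is the 0-form \<open>fscale (u y) funit\<close>, so this is the product rule
  with a first factor that \<open>twist\<close> leaves fixed.\<close>

lemma local_d_fscale:
  assumes u: "u differentiable (at x)" and \<beta>: "fdiff \<beta> x"
  shows "local_d (\<lambda>y. fscale (u y) (\<beta> y)) x
    = fwedge (covector (frechet_derivative u (at x))) (\<beta> x) + fscale (u x) (local_d \<beta> x)"
proof -
  have d: "fdiff (\<lambda>y. fscale (u y) funit) x"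
    using u by (simp add: fdiff_def fscale_def)
  have "local_d (\<lambda>y. fscale (u y) funit) x vs = covector (frechet_derivative u (at x)) vs" for vs
  proof (cases vs)
    case (Cons v us)
    have "local_d (\<lambda>y. contract v (fscale (u y) funit)) x us = 0"
      unfolding contract_fscale contract_funit by (simp add: local_d_def zero_fun_apply)
    then have "local_d (\<lambda>y. fscale (u y) funit) x vs = frechet_derivative (\<lambda>y. u y * funit us) (at x) v"
      by (simp add: Cons local_d_Cons dderiv_def fscale_def)
    then show ?thesis
      by (cases us) (simp_all add: Cons covector_def funit_def)
  qed (simp add: covector_def)
  then have 1: "local_d (\<lambda>y. fscale (u y) funit) x = covector (frechet_derivative u (at x))" by (rule ext)
  have 2: "twist (fscale (u x) (funit :: 'a list \<Rightarrow> real)) = fscale (u x) funit"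
    by (simp add: fun_eq_iff twist_def fscale_def funit_def)
  have "local_d (\<lambda>y. fscale (u y) (\<beta> y)) x = local_d (\<lambda>y. fwedge (fscale (u y) funit) (\<beta> y)) x"
    by (simp only: fwedge_fscale_left fwedge_funit_left)
  also have "\<dots> = fwedge (covector (frechet_derivative u (at x))) (\<beta> x) + fscale (u x) (local_d \<beta> x)"
    by (rule trans[OF local_d_fwedge[OF d \<beta>]]) (simp only: 1 2 fwedge_fscale_left fwedge_funit_left)
  finally show ?thesis .
qed

lemma fdiff_smooth: "(\<And>us. smooth_on (\<lambda>y. \<alpha> y us) U) \<Longrightarrow> open U \<Longrightarrow> x \<in> U \<Longrightarrow> fdiff \<alpha> x"
  unfolding fdiff_def using smooth_on_differentiable_at by blast

lemma continuous_on_locally_constant: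
  fixes s :: "'a::t2_space \<Rightarrow> 'b::topological_space"
  assumes s: "\<And>x. x \<in> U \<Longrightarrow> \<exists>V. open V \<and> x \<in> V \<and> V \<subseteq> U \<and> (\<forall>y\<in>V. s y = s x)"
  shows "continuous_on U s"
proof -
  have "isCont s x" if x: "x \<in> U" for x
  proof -
    obtain V where V: "open V" "x \<in> V" "\<forall>y\<in>V. s y = s x" using s[OF x] by blast
    have "continuous_on V s"
      by (rule continuous_on_eq[of _ "\<lambda>_. s x"]) (use V(3) in auto)
    then show ?thesis using V(1,2) by (simp add: continuous_on_eq_continuous_at)
  qed
  then show ?thesis by (simp add: continuous_at_imp_continuous_on)
qed

text \<open>Here \<open>s\<close> is the orientation sign of the coordinate frame.\<close>

lemma integral_local_d_by_parts:
  fixes \<beta> :: "'e::euclidean_space \<Rightarrow> 'e list \<Rightarrow> real"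
  assumes U: "open U" and K: "compact K" "K \<subseteq> U"
    and u: "smooth_on u U" and u0: "\<And>x. x \<in> U - K \<Longrightarrow> u x = 0"
    and \<beta>: "\<And>us. smooth_on (\<lambda>x. \<beta> x us) U"
    and s: "\<And>x. x \<in> U \<Longrightarrow> \<exists>V. open V \<and> x \<in> V \<and> V \<subseteq> U \<and> (\<forall>y\<in>V. s y = s x)"
  shows "integral U (\<lambda>x. u x * local_d \<beta> x bs * s x)
    = - integral U (\<lambda>x. fwedge (covector (frechet_derivative u (at x))) (\<beta> x) bs * s x)"
proof -
  have opK: "open (U - K)" by (rule open_Diff[OF U compact_imp_closed[OF K(1)]])
  have s_cont: "continuous_on U s" by (rule continuous_on_locally_constant[OF s])
  have du0: "frechet_derivative u (at x) v = 0" if "x \<in> U - K" for x v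
    by (rule frechet_derivativeI[OF has_derivative_zero_on_open[OF opK that u0]])
  have ud: "u differentiable (at x)" if "x \<in> U" for x
    by (rule smooth_on_differentiable_at[OF u U that])
  have bd: "fdiff \<beta> x" if "x \<in> U" for x
    by (rule fdiff_smooth[OF \<beta> U that])
  \<comment> \<open>Each summand of d(u \<beta>) is a derivative in one direction of a compactly
    supported function. The locally constant \<open>s\<close> passes through the derivative, so the
    extension by zero falls under \<open>integral_derivative_eq_0\<close>.\<close>
  have G: "integral U (\<lambda>x. s x * frechet_derivative (\<lambda>y. u y * \<beta> y us) (at x) v) = 0"
    "(\<lambda>x. s x * frechet_derivative (\<lambda>y. u y * \<beta> y us) (at x) v) absolutely_integrable_on U" for us v
  proof -
    let ?g = "\<lambda>y. u y * \<beta> y us"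
    let ?g' = "\<lambda>x. s x * frechet_derivative ?g (at x) v"
    let ?F = "\<lambda>x. if x \<in> U then s x * ?g x else 0" and ?F' = "\<lambda>x. if x \<in> U then ?g' x else 0"
    have g: "smooth_on ?g U" by (rule smooth_on_mult[OF U u \<beta>])
    have g'0: "frechet_derivative ?g (at x) v = 0" if "x \<in> U - K" for x
      by (rule frechet_derivativeI[OF has_derivative_zero_on_open[OF opK that]]) (simp add: u0)
    have contF': "continuous_on U ?g'"
      by (intro continuous_intros s_cont smooth_on_continuous_on smooth_on_deriv[OF g])
    have contF: "continuous_on U (\<lambda>x. s x * ?g x)"
      by (intro continuous_on_mult s_cont smooth_on_continuous_on[OF g])
    have F0: "?F x = 0" and F'0: "?F' x = 0" if "x \<notin> K" for x using u0 g'0 that by auto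
    have der: "((\<lambda>t. ?F (x + t *\<^sub>R v)) has_real_derivative ?F' (x + t *\<^sub>R v)) (at t)" for x t
    proof -
      let ?y = "x + t *\<^sub>R v"
      \<comment> \<open>On \<open>K\<close> a neighbourhood with constant \<open>s\<close> is
        available; off \<open>K\<close> the extension vanishes on the open set
        \<open>- K\<close>.\<close>
      have "\<exists>D. (?F has_derivative D) (at ?y) \<and> D v = ?F' ?y"
      proof (cases "?y \<in> K")
        case True
        then have y: "?y \<in> U" using K by auto
        obtain V where V: "open V" "?y \<in> V" "V \<subseteq> U" "\<forall>z\<in>V. s z = s ?y" using s[OF y] by blast
        have "(?g has_derivative frechet_derivative ?g (at ?y)) (at ?y)"
          using smooth_on_differentiable_at[OF g U y] frechet_derivative_works by blast
        then have "((\<lambda>z. s ?y * ?g z) has_derivative (\<lambda>h. s ?y * frechet_derivative ?g (at ?y) h)) (at ?y)"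
          by (rule has_derivative_mult_right)
        then have "(?F has_derivative (\<lambda>h. s ?y * frechet_derivative ?g (at ?y) h)) (at ?y)"
          by (rule has_derivative_transform_within_open[OF _ V(1,2)]) (use V(3,4) in auto)
        moreover have "s ?y * frechet_derivative ?g (at ?y) v = ?F' ?y" using y by simp
        ultimately show ?thesis by (intro exI[of _ "\<lambda>h. s ?y * frechet_derivative ?g (at ?y) h"] conjI)
      next
        case False
        have "(?F has_derivative (\<lambda>_. 0)) (at ?y)"
          by (rule has_derivative_zero_on_open[of "- K"])
            (use False F0 compact_imp_closed[OF K(1)] in auto)
        moreover have "0 = ?F' ?y" using F'0[OF False] by simp
        ultimately show ?thesis by (intro exI[of _ "\<lambda>_. 0"] conjI)
      qed
      then obtain D where D: "(?F has_derivative D) (at ?y)" "D v = ?F' ?y" by blast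
      have "((\<lambda>t. x + t *\<^sub>R v) has_derivative (\<lambda>h. h *\<^sub>R v)) (at t)"
        by (auto intro!: derivative_eq_intros)
      from diff_chain_at[OF this D(1)]
      have "((\<lambda>t. ?F (x + t *\<^sub>R v)) has_derivative (\<lambda>h. D (h *\<^sub>R v))) (at t)"
        by (simp add: o_def)
      moreover have "(\<lambda>h. D (h *\<^sub>R v)) = (*) (?F' ?y)"
        by (rule ext) (simp only: linear_cmul[OF has_derivative_linear[OF D(1)]] D(2) real_scaleR_def mult.commute)
      ultimately show ?thesis by (simp add: has_field_derivative_def)
    qed
    have "integral UNIV ?F' = 0"
    proof (rule integral_derivative_eq_0[OF der _ _ K(1) F0 F'0])
      show "continuous_on UNIV ?F"
        by (rule continuous_on_zero_extension[OF U K contF]) (use u0 in simp)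
      show "continuous_on UNIV ?F'"
        by (rule continuous_on_zero_extension[OF U K contF']) (use g'0 in simp)
    qed
    then show "integral U ?g' = 0" by (simp only: HK_restrict_UNIV)
    show "?g' absolutely_integrable_on U"
      by (rule absolutely_integrable_on_compact_support[OF U K contF']) (use g'0 in simp)
  qed
  let ?om = "\<lambda>i. take i bs @ drop (Suc i) bs"
  let ?R = "\<lambda>i x. (-1) ^ i * (s x * frechet_derivative (\<lambda>y. u y * \<beta> y (?om i)) (at x) (bs ! i))"
  let ?P = "\<lambda>x. u x * local_d \<beta> x bs * s x"
    and ?Q = "\<lambda>x. fwedge (covector (frechet_derivative u (at x))) (\<beta> x) bs * s x"
  \<comment> \<open>The summands add up to d(u \<beta>) times \<open>s\<close>, of integral 0. The
    product rule splits the same integrand into \<open>?Q\<close> and \<open>?P\<close>.\<close>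
  have "integral U (\<lambda>x. \<Sum>i<length bs. ?R i x)
      = (\<Sum>i<length bs. integral U (\<lambda>x. ?R i x))"
    by (rule HK_sum)
      (auto intro!: integrable_on_mult_right set_lebesgue_integral_eq_integral(1) G(2))
  also have "\<dots> = 0"
    by (simp add: G(1))
  also have "integral U (\<lambda>x. \<Sum>i<length bs. ?R i x)
      = integral U (\<lambda>x. ?Q x + ?P x)"
  proof (rule HK_cong)
    fix x assume "x \<in> U"
    have "(\<Sum>i<length bs. ?R i x)
        = s x * local_d (\<lambda>y. fscale (u y) (\<beta> y)) x bs"
      by (simp add: local_d_def fscale_def sum_distrib_left mult_ac)
    also have "\<dots> = ?Q x + ?P x"
      by (simp add: local_d_fscale[OF ud bd, OF \<open>x \<in> U\<close> \<open>x \<in> U\<close>] plus_fun_apply fscale_def[of _ "local_d \<beta> x"] algebra_simps)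
    finally show "(\<Sum>i<length bs. ?R i x)
        = ?Q x + ?P x" .
  qed
  also have "\<dots> = integral U ?Q + integral U ?P"
  proof (rule Henstock_Kurzweil_Integration.integral_add)
    have ldc: "continuous_on U (\<lambda>x. local_d \<beta> x bs)"
      unfolding local_d_def
      by (intro continuous_intros smooth_on_continuous_on smooth_on_deriv \<beta>)
    show "?P integrable_on U"
      by (intro set_lebesgue_integral_eq_integral(1) absolutely_integrable_on_compact_support[OF U K]
          continuous_intros s_cont smooth_on_continuous_on[OF u] ldc) (use u0 in simp)
    have covc: "continuous_on U (\<lambda>x. covector (frechet_derivative u (at x)) us)" for us
      by (cases "length us = 1") (simp_all add: covector_def smooth_on_continuous_on[OF smooth_on_deriv[OF u]])
    have "continuous_on U ?Q"
      unfolding fwedge_def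
      by (intro continuous_intros s_cont covc smooth_on_continuous_on[OF \<beta>])
    moreover have "?Q x = 0" if "x \<in> U - K" for x
      using du0[OF that] by (simp add: covector_eq_0 zero_fun_apply)
    ultimately show "?Q integrable_on U"
      by (intro set_lebesgue_integral_eq_integral(1) absolutely_integrable_on_compact_support[OF U K])
  qed
  finally show ?thesis by linarith
qed

section \<open>Charts\<close>

context smooth_manifold
begin

context
  fixes c :: "('a, 'm) chart"
  assumes c: "c \<in> A"
begin

lemma openin_chart: "openin M (fst c)"
  using charts[OF c] by (simp add: is_chart_def)

lemma chart_subset: "fst c \<subseteq> topspace M"
  using openin_chart by (rule openin_subset)

lemma open_chart_image: "open (chart_image c)"
  using charts[OF c] by (simp add: is_chart_def)

lemma chart_homeomorphic: "homeomorphic_map (subtopology M (fst c)) (top_of_set (chart_image c)) (snd c)"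
  using charts[OF c] by (simp add: is_chart_def)

lemma chart_inj: "inj_on (snd c) (fst c)"
  using homeomorphic_imp_injective_map[OF chart_homeomorphic] chart_subset
  by (simp add: inf.absorb2)

lemma chart_inv_chart: "p \<in> fst c \<Longrightarrow> chart_inv c (snd c p) = p"
  by (simp add: chart_inv_def inv_into_f_f chart_inj)

lemma chart_chart_inv: "x \<in> chart_image c \<Longrightarrow> snd c (chart_inv c x) = x"
  by (simp add: chart_inv_def chart_image_def f_inv_into_f)

lemma chart_inv_in: "x \<in> chart_image c \<Longrightarrow> chart_inv c x \<in> fst c"
  by (simp add: chart_inv_def chart_image_def inv_into_into)

lemma chart_in: "p \<in> fst c \<Longrightarrow> snd c p \<in> chart_image c"
  by (simp add: chart_image_def)

lemma open_chart_image_of: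
  assumes "openin M W" "W \<subseteq> fst c" shows "open (snd c ` W)"
proof -
  have "openin (subtopology M (fst c)) W"
    using assms openin_chart by (simp add: openin_open_subtopology)
  then have "openin (top_of_set (chart_image c)) (snd c ` W)"
    using homeomorphic_imp_open_map[OF chart_homeomorphic] by (simp add: open_map_def)
  then show ?thesis using open_chart_image openin_open_trans by blast
qed

lemma openin_chart_preimage:
  assumes "open S" shows "openin M {p \<in> fst c. snd c p \<in> S}"
proof -
  have "continuous_map (subtopology M (fst c)) (top_of_set (chart_image c)) (snd c)"
    by (rule homeomorphic_imp_continuous_map[OF chart_homeomorphic])
  moreover have "openin (top_of_set (chart_image c)) (chart_image c \<inter> S)"
    using assms by (simp add: openin_open_Int)
  ultimately have "openin (subtopology M (fst c)) {p \<in> topspace (subtopology M (fst c)). snd c p \<in> chart_image c \<inter> S}"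
    by (rule openin_continuous_map_preimage)
  also have "{p \<in> topspace (subtopology M (fst c)). snd c p \<in> chart_image c \<inter> S} = {p \<in> fst c. snd c p \<in> S}"
    using chart_subset by (auto simp: chart_image_def)
  finally show ?thesis using openin_chart by (simp add: openin_open_subtopology)
qed

lemma compact_chart_image_of:
  assumes "compactin M C" "C \<subseteq> fst c" shows "compact (snd c ` C)"
proof -
  have "compactin (subtopology M (fst c)) C"
    using assms by (simp add: compactin_subtopology)
  then have "compactin (top_of_set (chart_image c)) (snd c ` C)"
    by (rule image_compactin[OF _ homeomorphic_imp_continuous_map[OF chart_homeomorphic]])
  then show ?thesis by (simp add: compactin_subtopology)
qed

lemma compactin_chart_inv_image:
  assumes "compact L" "L \<subseteq> chart_image c" shows "compactin M (chart_inv c ` L)"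
proof -
  obtain g where g: "homeomorphic_maps (subtopology M (fst c)) (top_of_set (chart_image c)) (snd c) g"
    using chart_homeomorphic unfolding homeomorphic_map_maps by blast
  have eq: "g x = chart_inv c x" if "x \<in> chart_image c" for x
  proof -
    have "snd c (g x) = x" "g x \<in> fst c"
      using g that by (auto simp: homeomorphic_maps_def continuous_map_def)
    then show ?thesis using chart_inv_chart by metis
  qed
  have "compactin (top_of_set (chart_image c)) L"
    using assms by (simp add: compactin_subtopology)
  then have "compactin (subtopology M (fst c)) (g ` L)"
    using g by (intro image_compactin) (auto simp: homeomorphic_maps_def)
  moreover have "g ` L = chart_inv c ` L" using eq assms(2) by (intro image_cong) auto
  ultimately show ?thesis by (simp add: compactin_subtopology)
qed

end

lemma openin_overlap: "c \<in> A \<Longrightarrow> c' \<in> A \<Longrightarrow> openin M (fst c \<inter> fst c')"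
  by (simp add: openin_Int openin_chart)

lemma open_overlap: "c \<in> A \<Longrightarrow> c' \<in> A \<Longrightarrow> open (snd c ` (fst c \<inter> fst c'))"
  by (rule open_chart_image_of) (auto intro: openin_overlap)

lemma transition_chart: "c \<in> A \<Longrightarrow> p \<in> fst c \<Longrightarrow> transition c c' (snd c p) = snd c' p"
  by (simp add: transition_def chart_inv_chart)

lemma transition_image:
  "c \<in> A \<Longrightarrow> transition c c' ` snd c ` (fst c \<inter> fst c') = snd c' ` (fst c \<inter> fst c')"
  by (auto simp: image_image transition_chart intro!: image_cong)

lemma inj_on_transition:
  assumes c: "c \<in> A" and c': "c' \<in> A"
  shows "inj_on (transition c c') (snd c ` (fst c \<inter> fst c'))"
proof (rule inj_onI; clarify)
  fix p q assume p: "p \<in> fst c" "p \<in> fst c'" and q: "q \<in> fst c" "q \<in> fst c'"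
    and "transition c c' (snd c p) = transition c c' (snd c q)"
  then have "snd c' p = snd c' q" by (simp add: transition_chart c)
  then have "p = q" using chart_inj[OF c'] p q by (simp add: inj_on_def)
  then show "snd c p = snd c q" by simp
qed

lemma transition_has_derivative:
  assumes "c \<in> A" "c' \<in> A" "p \<in> fst c" "p \<in> fst c'"
  shows "(transition c c' has_derivative frechet_derivative (transition c c') (at (snd c p))) (at (snd c p))"
proof -
  have "snd c p \<in> snd c ` (fst c \<inter> fst c')" using assms by blast
  from smooth_on_differentiable_at[OF smooth_transitions[OF assms(1,2)] open_overlap[OF assms(1,2)] this]
  show ?thesis by (rule frechet_derivative_works[THEN iffD1])
qed

definition chart_bump :: "('a, 'm) chart \<Rightarrow> 'a \<Rightarrow> ('a \<Rightarrow> real) \<Rightarrow> bool" where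
  "chart_bump c p f \<longleftrightarrow> c \<in> A \<and> p \<in> fst c \<and> smooth_function A f \<and> (\<forall>q. 0 \<le> f q) \<and> f p \<noteq> 0 \<and>
     openin M {q \<in> topspace M. f q \<noteq> 0} \<and> M closure_of {q \<in> topspace M. f q \<noteq> 0} \<subseteq> fst c"

text \<open>A Euclidean bump function on a ball in the chart, extended by 0. The issue is smoothness
  of the extension in the other charts.\<close>

lemma ex_chart_bump:
  assumes p: "p \<in> topspace M"
  shows "\<exists>c f. chart_bump c p f"
proof -
  obtain c where c: "c \<in> A" and pc: "p \<in> fst c" using p covers by blast
  obtain r where r: "r > 0" "cball (snd c p) r \<subseteq> chart_image c"
    using open_contains_cball open_chart_image[OF c] chart_in[OF c pc] by meson
  obtain h :: "real^'m \<Rightarrow> real" where h: "smooth_on h UNIV" "\<And>x. 0 \<le> h x"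
    "\<And>x. h x \<noteq> 0 \<longleftrightarrow> dist (snd c p) x < r"
    using smooth_bump[of "snd c p" r] by blast
  define f where "f q = (if q \<in> fst c then h (snd c q) else 0)" for q
  define C where "C = chart_inv c ` cball (snd c p) r"
  have supp: "{q \<in> topspace M. f q \<noteq> 0} = {q \<in> fst c. snd c q \<in> ball (snd c p) r}"
    using chart_subset[OF c] h(3) by (auto simp: f_def)
  \<comment> \<open>The closed ball is compact, so its image is closed because \<open>M\<close> is
    Hausdorff. It contains the support and stays inside the chart.\<close>
  have C: "closedin M C"
    unfolding C_def using r(2)
    by (intro compactin_imp_closedin[OF Hausdorff] compactin_chart_inv_image[OF c]) auto
  have CU: "C \<subseteq> fst c" using r(2) chart_inv_in[OF c] by (auto simp: C_def)
  have suppC: "q \<in> C" if "q \<in> fst c" "snd c q \<in> ball (snd c p) r" for q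
    using that chart_inv_chart[OF c, of q] unfolding C_def by (metis ball_subset_cball imageI subsetD)
  have "smooth_function A f"
    unfolding smooth_function_def
  proof (intro ballI smooth_on_local)
    fix c' y assume c': "c' \<in> A" and y: "y \<in> chart_image c'"
    let ?q = "chart_inv c' y"
    note q = chart_inv_in[OF c' y] chart_chart_inv[OF c' y]
    \<comment> \<open>Points of the chart domain see \<open>h\<close> through a transition map; all
      others lie in the open complement of \<open>C\<close>, where \<open>f\<close>
      vanishes.\<close>
    show "\<exists>T. open T \<and> y \<in> T \<and> smooth_on (f \<circ> chart_inv c') T"
    proof (cases "?q \<in> fst c")
      case True
      let ?S = "snd c' ` (fst c' \<inter> fst c)"
      have "smooth_on (\<lambda>x. h (transition c' c x)) ?S"
        by (rule smooth_on_compose[OF open_overlap[OF c' c] open_UNIV _ smooth_transitions[OF c' c] h(1)]) simp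
      then have "smooth_on (f \<circ> chart_inv c') ?S"
        by (rule smooth_on_cong[OF _ open_overlap[OF c' c]])
          (auto simp: f_def transition_def chart_inv_chart[OF c'])
      moreover have "y \<in> ?S" using True q by (metis IntI imageI)
      ultimately show ?thesis using open_overlap[OF c' c] by blast
    next
      case False
      let ?W = "fst c' \<inter> (topspace M - C)"
      let ?S = "snd c' ` ?W"
      have "open ?S"
        using openin_chart[OF c'] C by (intro open_chart_image_of[OF c']) auto
      moreover have "y \<in> ?S"
        using False CU q chart_subset[OF c'] by (metis Diff_iff IntI imageI subsetD)
      moreover have "smooth_on (f \<circ> chart_inv c') ?S"
      proof (rule smooth_on_cong[OF smooth_on_const[of 0] \<open>open ?S\<close>])
        fix x assume "x \<in> ?S"
        then obtain q where q: "q \<in> ?W" "x = snd c' q" by blast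
        have "f q = 0"
        proof (rule ccontr)
          assume "f q \<noteq> 0"
          then have "q \<in> fst c" "snd c q \<in> ball (snd c p) r"
            using h(3) by (auto simp: f_def split: if_splits)
          then show False using suppC q by blast
        qed
        then show "0 = (f \<circ> chart_inv c') x" using q chart_inv_chart[OF c', of q] by simp
      qed
      ultimately show ?thesis by blast
    qed
  qed
  moreover have "M closure_of {q \<in> topspace M. f q \<noteq> 0} \<subseteq> fst c"
  proof -
    have "{q \<in> topspace M. f q \<noteq> 0} \<subseteq> C" unfolding supp using suppC by auto
    from closure_of_minimal[OF this C] show ?thesis using CU by (rule order_trans)
  qed
  moreover have "openin M {q \<in> topspace M. f q \<noteq> 0}"
    unfolding supp by (rule openin_chart_preimage[OF c open_ball])
  moreover have "f p \<noteq> 0" using pc h(3) r(1) by (simp add: f_def)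
  moreover have "0 \<le> f q" for q using h(2) by (simp add: f_def)
  ultimately have "chart_bump c p f" using c pc by (simp add: chart_bump_def)
  then show ?thesis by blast
qed

end

section \<open>Existence of a smooth partition of unity\<close>

context closed_manifold
begin

lemma ex_partition_of_unity: "\<exists>F \<rho>. partition_of_unity M A F \<rho>"
proof -
  have "\<forall>p\<in>topspace M. \<exists>c f. chart_bump c p f" using ex_chart_bump by blast
  then obtain c f where *: "\<And>p. p \<in> topspace M \<Longrightarrow> chart_bump (c p) p (f p)" by metis
  let ?supp = "\<lambda>p. {q \<in> topspace M. f p q \<noteq> 0}"
  have bump: "c p \<in> A" "smooth_function A (f p)" "0 \<le> f p q" "f p p \<noteq> 0"
    "openin M (?supp p)" "M closure_of ?supp p \<subseteq> fst (c p)" if "p \<in> topspace M" for p q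
    using *[OF that] by (simp_all only: chart_bump_def not_False_eq_True)
  have "\<forall>U\<in>?supp ` topspace M. openin M U" using bump(5) by (simp only: ball_simps) blast
  moreover have "topspace M \<subseteq> \<Union>(?supp ` topspace M)"
  proof
    fix p assume "p \<in> topspace M"
    then have "p \<in> ?supp p" using bump(4) by simp
    then show "p \<in> \<Union>(?supp ` topspace M)" using \<open>p \<in> topspace M\<close> by (rule UN_I[rotated])
  qed
  ultimately have "\<exists>\<F>. finite \<F> \<and> \<F> \<subseteq> ?supp ` topspace M \<and> topspace M \<subseteq> \<Union>\<F>"
    by (intro compact[unfolded compact_space_alt, rule_format] conjI)
  then obtain \<F> where \<F>: "finite \<F>" "\<F> \<subseteq> ?supp ` topspace M" "topspace M \<subseteq> \<Union>\<F>"
    by (elim exE conjE)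
  obtain P where P: "P \<subseteq> topspace M" "finite P" "\<F> = ?supp ` P"
    using finite_subset_image[OF \<F>(1,2)] by (elim exE conjE)
  note P = P(2,1) \<F>(3)[unfolded P(3)]
  have PM: "p \<in> topspace M" if "p \<in> P" for p using that P(2) by (rule subsetD[rotated])
  define s where "s q = (\<Sum>p\<in>P. f p q)" for q
  \<comment> \<open>A partition of unity is indexed by charts, and several points may have been
    assigned the same one; their bumps are added before dividing by the total sum.\<close>
  define \<rho> where "\<rho> d q = (\<Sum>p\<in>{p \<in> P. c p = d}. f p q) / s q" for d q
  have pos: "s q > 0" if q: "q \<in> topspace M" for q
  proof -
    obtain p where p: "p \<in> P" "f p q \<noteq> 0" using P(3) q by blast
    then have "0 < f p q" using bump(3)[OF PM[OF p(1)], of q] by linarith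
    also have "\<dots> \<le> s q"
      unfolding s_def using bump(3)[OF PM] P(1) by (intro member_le_sum[OF p(1)]) auto
    finally show ?thesis .
  qed
  have smooth_sum: "smooth_on ((\<lambda>q. \<Sum>p\<in>Q. f p q) \<circ> chart_inv d) (chart_image d)"
    if "Q \<subseteq> P" "d \<in> A" for Q d
    unfolding o_def
  proof (rule smooth_on_sum[OF open_chart_image[OF that(2)]])
    fix p assume "p \<in> Q"
    then have "smooth_function A (f p)" using bump(2) PM that(1) by (simp add: subset_iff)
    then show "smooth_on (\<lambda>x. f p (chart_inv d x)) (chart_image d)"
      using that(2) by (simp add: smooth_function_def o_def)
  qed
  have "partition_of_unity M A (c ` P) \<rho>"
    unfolding partition_of_unity_def
  proof (intro conjI ballI)
    show "finite (c ` P)" "c ` P \<subseteq> A" using P(1) bump(1)[OF PM] by auto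
    show "smooth_function A (\<rho> d)" for d
      unfolding smooth_function_def
    proof
      fix c' assume c': "c' \<in> A"
      have "smooth_on (\<lambda>x. ((\<lambda>q. \<Sum>p\<in>{p \<in> P. c p = d}. f p q) \<circ> chart_inv c') x / (s \<circ> chart_inv c') x) (chart_image c')"
      proof (rule smooth_on_divide[OF open_chart_image[OF c'] smooth_sum[OF _ c']])
        have "s = (\<lambda>q. \<Sum>p\<in>P. f p q)" by (simp add: s_def fun_eq_iff)
        then show "smooth_on (s \<circ> chart_inv c') (chart_image c')" using smooth_sum[OF _ c', of P] by simp
        show "(s \<circ> chart_inv c') x \<noteq> 0" if "x \<in> chart_image c'" for x
          using pos[of "chart_inv c' x"] chart_inv_in[OF c' that] chart_subset[OF c'] by auto
      qed auto
      then show "smooth_on (\<rho> d \<circ> chart_inv c') (chart_image c')" by (simp add: \<rho>_def o_def)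
    qed
    show "0 \<le> \<rho> d q" if "q \<in> topspace M" for d q
      unfolding \<rho>_def using bump(3)[OF PM] by (intro divide_nonneg_pos sum_nonneg pos[OF that]) simp
    show "M closure_of {q \<in> topspace M. \<rho> d q \<noteq> 0} \<subseteq> fst d" for d
    proof -
      have "{q \<in> topspace M. \<rho> d q \<noteq> 0} \<subseteq> \<Union>(?supp ` {p \<in> P. c p = d})"
      proof
        fix q assume q: "q \<in> {q \<in> topspace M. \<rho> d q \<noteq> 0}"
        then have "(\<Sum>p\<in>{p \<in> P. c p = d}. f p q) \<noteq> 0" by (auto simp: \<rho>_def)
        then obtain p where "p \<in> {p \<in> P. c p = d}" "f p q \<noteq> 0" by (meson sum.neutral)
        then show "q \<in> \<Union>(?supp ` {p \<in> P. c p = d})" using q by blast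
      qed
      then have "M closure_of {q \<in> topspace M. \<rho> d q \<noteq> 0} \<subseteq> M closure_of \<Union>(?supp ` {p \<in> P. c p = d})"
        by (rule closure_of_mono)
      also have "\<dots> = (\<Union>S\<in>?supp ` {p \<in> P. c p = d}. M closure_of S)"
        using P(1) by (intro closure_of_Union) auto
      also have "\<dots> \<subseteq> fst d" using bump(6)[OF PM] by auto
      finally show ?thesis .
    qed
    show "(\<Sum>d\<in>c ` P. \<rho> d q) = 1" if "q \<in> topspace M" for q
    proof -
      have "(\<Sum>d\<in>c ` P. \<rho> d q) = (\<Sum>d\<in>c ` P. \<Sum>p\<in>{p \<in> P. c p = d}. f p q) / s q"
        by (simp add: \<rho>_def sum_divide_distrib)
      also have "(\<Sum>d\<in>c ` P. \<Sum>p\<in>{p \<in> P. c p = d}. f p q) = s q"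
        unfolding s_def by (rule sum.group) (use P in auto)
      finally show ?thesis using pos[OF that] by simp
    qed
  qed
  then show ?thesis by blast
qed

end

section \<open>Stokes' theorem\<close>

lemma OmegaD:
  assumes "\<alpha> \<in> Omega A k"
  shows "\<forall>c\<in>A. \<forall>x\<in>chart_image c. alternating_multilinear k (\<alpha> c x)"
    and "\<forall>c\<in>A. \<forall>vs. smooth_on (\<lambda>x. \<alpha> c x vs) (chart_image c)"
    and "\<forall>c\<in>A. \<forall>c'\<in>A. \<forall>p\<in>fst c \<inter> fst c'. \<forall>vs.
      \<alpha> c (snd c p) vs =
      \<alpha> c' (snd c' p) (map (frechet_derivative (transition c c') (at (snd c p))) vs)"
proof -
  note * = assms[unfolded Omega_def mem_Collect_eq, THEN conjunct2]
  show "\<forall>c\<in>A. \<forall>x\<in>chart_image c. alternating_multilinear k (\<alpha> c x)"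
    by (rule *[THEN conjunct1])
  show "\<forall>c\<in>A. \<forall>vs. smooth_on (\<lambda>x. \<alpha> c x vs) (chart_image c)"
    by (rule *[THEN conjunct2, THEN conjunct1])
  show "\<forall>c\<in>A. \<forall>c'\<in>A. \<forall>p\<in>fst c \<inter> fst c'. \<forall>vs.
      \<alpha> c (snd c p) vs =
      \<alpha> c' (snd c' p) (map (frechet_derivative (transition c c') (at (snd c p))) vs)"
    by (rule *[THEN conjunct2, THEN conjunct2])
qed

lemma Omega_Alt: "\<alpha> \<in> Omega A k \<Longrightarrow> c \<in> A \<Longrightarrow> x \<in> chart_image c \<Longrightarrow> Alt k (\<alpha> c x)"
  unfolding Alt_iff_alternating_multilinear by (rule OmegaD(1)[rule_format])

lemma Omega_smooth: "\<alpha> \<in> Omega A k \<Longrightarrow> c \<in> A \<Longrightarrow> smooth_on (\<lambda>x. \<alpha> c x vs) (chart_image c)"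
  by (rule OmegaD(2)[rule_format])

lemma Omega_pullback:
  "\<alpha> \<in> Omega A k \<Longrightarrow> c \<in> A \<Longrightarrow> c' \<in> A \<Longrightarrow> p \<in> fst c \<Longrightarrow> p \<in> fst c' \<Longrightarrow>
    \<alpha> c (snd c p) vs = \<alpha> c' (snd c' p) (map (frechet_derivative (transition c c') (at (snd c p))) vs)"
  by (rule OmegaD(3)[rule_format]) simp_all

lemma covector_sum:
  "covector (\<lambda>v. \<Sum>i\<in>I. L i v) = (\<Sum>i\<in>I. covector (L i))"
  by (simp add: fun_eq_iff covector_def sum_fun_apply)

definition dwedge :: "('a \<Rightarrow> real) \<Rightarrow> ('a, 'm::finite) form \<Rightarrow> ('a, 'm) form" where
  "dwedge r \<beta> c x = fwedge (covector (frechet_derivative (r \<circ> chart_inv c) (at x))) (\<beta> c x)"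

context smooth_manifold
begin

lemma smooth_function_has_derivative:
  assumes "smooth_function A r" "c \<in> A" "x \<in> chart_image c"
  shows "((r \<circ> chart_inv c) has_derivative frechet_derivative (r \<circ> chart_inv c) (at x)) (at x)"
proof -
  have "smooth_on (r \<circ> chart_inv c) (chart_image c)"
    using assms by (simp add: smooth_function_def)
  from smooth_on_differentiable_at[OF this open_chart_image[OF assms(2)] assms(3)]
  show ?thesis by (rule frechet_derivative_works[THEN iffD1])
qed

lemma smooth_function_pullback:
  assumes r: "smooth_function A r" and c: "c \<in> A" "c' \<in> A" and p: "p \<in> fst c" "p \<in> fst c'"
  shows "frechet_derivative (r \<circ> chart_inv c) (at (snd c p)) v
    = frechet_derivative (r \<circ> chart_inv c') (at (snd c' p))
        (frechet_derivative (transition c c') (at (snd c p)) v)"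
proof (rule frechet_derivativeI)
  let ?D' = "frechet_derivative (r \<circ> chart_inv c') (at (snd c' p))"
  let ?DT = "frechet_derivative (transition c c') (at (snd c p))"
  have "((r \<circ> chart_inv c') has_derivative ?D') (at (transition c c' (snd c p)))"
    using smooth_function_has_derivative[OF r c(2) chart_in[OF c(2) p(2)]]
    by (simp only: transition_chart[OF c(1) p(1)])
  from diff_chain_at[OF transition_has_derivative[OF c p] this]
  have "((r \<circ> chart_inv c') \<circ> transition c c' has_derivative (\<lambda>v. ?D' (?DT v))) (at (snd c p))"
    by (simp only: o_def)
  then show "(r \<circ> chart_inv c has_derivative (\<lambda>v. ?D' (?DT v))) (at (snd c p))"
  proof (rule has_derivative_transform_within_open[OF _ open_overlap[OF c]])
    show "snd c p \<in> snd c ` (fst c \<inter> fst c')" using p by blast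
    show "((r \<circ> chart_inv c') \<circ> transition c c') x = (r \<circ> chart_inv c) x"
      if "x \<in> snd c ` (fst c \<inter> fst c')" for x
      using that c by (auto simp: transition_chart chart_inv_chart)
  qed
qed

context
  fixes r :: "'a \<Rightarrow> real" and \<beta> :: "('a, 'm) form" and k :: nat
  assumes r: "smooth_function A r" and \<beta>: "\<beta> \<in> Omega A k"
begin

lemma Alt_dwedge:
  assumes "c \<in> A" "x \<in> chart_image c" shows "Alt (Suc k) (dwedge r \<beta> c x)"
  using Alt_fwedge[OF Alt_covector[OF has_derivative_linear[OF smooth_function_has_derivative[OF r assms]]] Omega_Alt[OF \<beta> assms]]
  by (simp add: dwedge_def)

lemma continuous_on_dwedge:
  assumes "c \<in> A" shows "continuous_on (chart_image c) (\<lambda>x. dwedge r \<beta> c x vs)"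
proof -
  have "smooth_on (r \<circ> chart_inv c) (chart_image c)"
    using r assms by (simp add: smooth_function_def)
  then have "continuous_on (chart_image c) (\<lambda>x. covector (frechet_derivative (r \<circ> chart_inv c) (at x)) us)" for us
    by (cases "length us = 1") (simp_all add: covector_def smooth_on_continuous_on[OF smooth_on_deriv])
  then show ?thesis
    unfolding dwedge_def fwedge_def
    by (intro continuous_intros smooth_on_continuous_on[OF Omega_smooth[OF \<beta> assms]])
qed

lemma dwedge_pullback:
  assumes "c \<in> A" "c' \<in> A" "p \<in> fst c" "p \<in> fst c'"
  shows "dwedge r \<beta> c (snd c p) vs
    = dwedge r \<beta> c' (snd c' p) (map (frechet_derivative (transition c c') (at (snd c p))) vs)"
proof -
  let ?DT = "frechet_derivative (transition c c') (at (snd c p))"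
  have 1: "covector (frechet_derivative (r \<circ> chart_inv c) (at (snd c p)))
      = (\<lambda>us. covector (frechet_derivative (r \<circ> chart_inv c') (at (snd c' p))) (map ?DT us))"
  proof
    fix us
    show "covector (frechet_derivative (r \<circ> chart_inv c) (at (snd c p))) us
        = covector (frechet_derivative (r \<circ> chart_inv c') (at (snd c' p))) (map ?DT us)"
      using smooth_function_pullback[OF r assms] by (cases us) (simp_all add: covector_def)
  qed
  have 2: "\<beta> c (snd c p) = (\<lambda>us. \<beta> c' (snd c' p) (map ?DT us))"
    by (rule ext) (rule Omega_pullback[OF \<beta> assms])
  show ?thesis by (simp only: dwedge_def fwedge_map 1 2)
qed

text \<open>Off its closed support \<open>r\<close> vanishes on a whole neighbourhood, hence so does
  its differential.\<close>

lemma dwedge_eq_0: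
  assumes c: "c \<in> A" and p: "p \<in> fst c" "p \<notin> M closure_of {q \<in> topspace M. r q \<noteq> 0}"
  shows "dwedge r \<beta> c (snd c p) = 0"
proof -
  let ?W = "fst c \<inter> (topspace M - M closure_of {q \<in> topspace M. r q \<noteq> 0})"
  have "open (snd c ` ?W)"
    using openin_chart[OF c] by (intro open_chart_image_of[OF c]) (auto intro!: openin_diff)
  moreover have "snd c p \<in> snd c ` ?W" using p chart_subset[OF c] by blast
  moreover have "(r \<circ> chart_inv c) x = 0" if x: "x \<in> snd c ` ?W" for x
  proof -
    obtain q where q: "q \<in> ?W" "x = snd c q" using x by blast
    then have "r q = 0" using closure_of_subset[of "{q \<in> topspace M. r q \<noteq> 0}" M] by auto
    then show ?thesis using q chart_inv_chart[OF c] by simp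
  qed
  ultimately have "((r \<circ> chart_inv c) has_derivative (\<lambda>_. 0)) (at (snd c p))"
    by (rule has_derivative_zero_on_open)
  then have "covector (frechet_derivative (r \<circ> chart_inv c) (at (snd c p))) = 0"
    by (intro covector_eq_0 frechet_derivativeI)
  then show ?thesis by (simp add: dwedge_def)
qed

end

end

section \<open>Stokes' theorem for a given partition of unity and volume form\<close>

locale integration_data = closed_manifold M A
  for M :: "'a topology" and A :: "('a, 'm::finite) chart set" +
  fixes F and \<rho> :: "('a, 'm) chart \<Rightarrow> 'a \<Rightarrow> real" and \<beta> \<mu> :: "('a, 'm) form"
  assumes pou: "partition_of_unity M A F \<rho>"
    and \<beta>: "\<beta> \<in> Omega A (CARD('m) - 1)" and \<mu>: "\<mu> \<in> Omega A CARD('m)"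
    and \<mu>_nonzero: "\<And>c x. c \<in> A \<Longrightarrow> x \<in> chart_image c \<Longrightarrow> \<mu> c x std_frame \<noteq> 0"
begin

lemma pouD: "finite F" "\<And>c. c \<in> F \<Longrightarrow> c \<in> A" "\<And>c. c \<in> F \<Longrightarrow> smooth_function A (\<rho> c)"
    "\<And>c. c \<in> F \<Longrightarrow> M closure_of {p \<in> topspace M. \<rho> c p \<noteq> 0} \<subseteq> fst c"
    "\<And>p. p \<in> topspace M \<Longrightarrow> (\<Sum>c\<in>F. \<rho> c p) = 1"
  using pou unfolding partition_of_unity_def by (simp_all add: subset_iff del: split_paired_All)

definition supp where "supp c = M closure_of {p \<in> topspace M. \<rho> c p \<noteq> 0}"

lemma compactin_supp: "compactin M (supp c)"
  unfolding supp_def by (rule closedin_compact_space[OF compact closedin_closure_of])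

lemma supp_subset: "c \<in> F \<Longrightarrow> supp c \<subseteq> fst c"
  unfolding supp_def by (rule pouD(4))

lemma not_in_supp: "p \<in> topspace M \<Longrightarrow> p \<notin> supp c \<Longrightarrow> \<rho> c p = 0"
  using closure_of_subset[of "{p \<in> topspace M. \<rho> c p \<noteq> 0}" M] unfolding supp_def by auto

definition orient :: "('a, 'm) chart \<Rightarrow> real^'m \<Rightarrow> real" where
  "orient c x = sgn (\<mu> c x std_frame)"

lemma orient_locally_constant:
  assumes c: "c \<in> A" and x: "x \<in> chart_image c"
  shows "\<exists>V. open V \<and> x \<in> V \<and> V \<subseteq> chart_image c \<and> (\<forall>y\<in>V. orient c y = orient c x)"
proof -
  let ?m = "\<lambda>x. \<mu> c x std_frame"
  have cont: "continuous_on (chart_image c) ?m"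
    by (rule smooth_on_continuous_on[OF Omega_smooth[OF \<mu> c]])
  have "open (chart_image c \<inter> ?m -` {0<..})" "open (chart_image c \<inter> ?m -` {..<0})"
    by (auto intro!: continuous_open_preimage[OF cont open_chart_image[OF c]])
  moreover have "?m x > 0 \<or> ?m x < 0" using \<mu>_nonzero[OF c x] by linarith
  ultimately show ?thesis
  proof (elim disjE)
    assume "open (chart_image c \<inter> ?m -` {0<..})" "?m x > 0"
    then show ?thesis using x
      by (intro exI[of _ "chart_image c \<inter> ?m -` {0<..}"]) (simp add: orient_def)
  next
    assume "open (chart_image c \<inter> ?m -` {..<0})" "?m x < 0"
    then show ?thesis using x
      by (intro exI[of _ "chart_image c \<inter> ?m -` {..<0}"]) (simp add: orient_def)
  qed
qed

lemma continuous_on_orient: "c \<in> A \<Longrightarrow> continuous_on (chart_image c) (orient c)"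
  by (rule continuous_on_locally_constant[OF orient_locally_constant])

lemma local_integral_ext_d:
  assumes c: "c \<in> F"
  shows "local_integral \<mu> c (\<rho> c) (ext_d A \<beta>)
    = - integral (chart_image c) (\<lambda>x. dwedge (\<rho> c) \<beta> c x std_frame * orient c x)"
proof -
  note cA = pouD(2)[OF c]
  let ?u = "\<rho> c \<circ> chart_inv c"
  note sub = supp_subset[OF c]
  have "local_integral \<mu> c (\<rho> c) (ext_d A \<beta>)
      = integral (chart_image c) (\<lambda>x. ?u x * local_d (\<beta> c) x std_frame * orient c x)"
    unfolding local_integral_def orient_def
    by (intro HK_cong) (simp add: ext_d_eq_local_d cA)
  also have "\<dots> = - integral (chart_image c)
      (\<lambda>x. fwedge (covector (frechet_derivative ?u (at x))) (\<beta> c x) std_frame * orient c x)"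
  proof (rule integral_local_d_by_parts[OF open_chart_image[OF cA] compact_chart_image_of[OF cA compactin_supp sub]
        _ _ _ Omega_smooth[OF \<beta> cA] orient_locally_constant[OF cA]])
    show "snd c ` supp c \<subseteq> chart_image c" using sub by (auto simp: chart_image_def)
    show "smooth_on ?u (chart_image c)" using pouD(3)[OF c] cA by (simp add: smooth_function_def)
    fix x assume x: "x \<in> chart_image c - snd c ` supp c"
    then have "chart_inv c x \<notin> supp c" using chart_chart_inv[OF cA, of x] by force
    moreover have "chart_inv c x \<in> topspace M"
      using x chart_inv_in[OF cA] chart_subset[OF cA] by blast
    ultimately show "?u x = 0" by (simp add: not_in_supp)
  qed
  finally show ?thesis by (simp only: dwedge_def)
qed

text \<open>The integrand of the double sum, read in a chart \<open>d\<close>; the argument takes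
  \<open>d\<close> to be \<open>c\<close> or \<open>c'\<close>.\<close>

definition overlap where
  "overlap c c' d x = \<rho> c' (chart_inv d x) * dwedge (\<rho> c) \<beta> d x std_frame * orient d x"

lemma overlap_eq_0:
  assumes "c \<in> F" and d: "d \<in> A" "x \<in> chart_image d" and "chart_inv d x \<notin> supp c \<inter> supp c'"
  shows "overlap c c' d x = 0"
proof -
  have p: "chart_inv d x \<in> fst d" "chart_inv d x \<in> topspace M" "snd d (chart_inv d x) = x"
    using d chart_inv_in[OF d] chart_subset[OF d(1)] chart_chart_inv[OF d] by auto
  consider "chart_inv d x \<notin> supp c" | "chart_inv d x \<notin> supp c'" using assms(4) by blast
  then show ?thesis
  proof cases
    case 1
    then have "dwedge (\<rho> c) \<beta> d x = 0"
      using dwedge_eq_0[OF pouD(3)[OF assms(1)] \<beta> d(1) p(1)] p(3) by (simp add: supp_def)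
    then show ?thesis by (simp add: overlap_def zero_fun_apply)
  next
    case 2
    then show ?thesis by (simp add: overlap_def not_in_supp p(2))
  qed
qed

lemma continuous_on_overlap:
  assumes "c \<in> F" "c' \<in> F" and d: "d \<in> A"
  shows "continuous_on (chart_image d) (overlap c c' d)"
proof -
  have "smooth_on (\<rho> c' \<circ> chart_inv d) (chart_image d)"
    using pouD(3)[OF assms(2)] d by (simp add: smooth_function_def)
  then have "continuous_on (chart_image d) (\<lambda>x. \<rho> c' (chart_inv d x))"
    using smooth_on_continuous_on by (simp add: o_def)
  then show ?thesis
    unfolding overlap_def
    by (intro continuous_intros continuous_on_orient[OF d] continuous_on_dwedge[OF pouD(3)[OF assms(1)] \<beta> d])
qed

lemma compact_supp_image:
  assumes d: "d \<in> A" "supp c \<inter> supp c' \<subseteq> fst d"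
  shows "compact (snd d ` (supp c \<inter> supp c'))"
proof (rule compact_chart_image_of[OF d(1) _ d(2)])
  show "compactin M (supp c \<inter> supp c')"
    by (rule closed_Int_compactin[OF _ compactin_supp]) (simp add: supp_def)
qed

lemma overlap_eq_0':
  assumes "c \<in> F" "d \<in> A" "x \<in> chart_image d - snd d ` (supp c \<inter> supp c')"
  shows "overlap c c' d x = 0"
proof (rule overlap_eq_0[OF assms(1,2)])
  show "x \<in> chart_image d" using assms(3) by simp
  then show "chart_inv d x \<notin> supp c \<inter> supp c'"
    using assms(3) chart_chart_inv[OF assms(2), of x] by force
qed

lemma overlap_integrable:
  assumes "c \<in> F" "c' \<in> F" and d: "d \<in> A" "supp c \<inter> supp c' \<subseteq> fst d"
  shows "overlap c c' d integrable_on chart_image d"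
proof (rule set_lebesgue_integral_eq_integral(1)[OF absolutely_integrable_on_compact_support[OF
        open_chart_image[OF d(1)] compact_supp_image[OF d]]])
  show "snd d ` (supp c \<inter> supp c') \<subseteq> chart_image d" using d(2) by (auto simp: chart_image_def)
qed (use continuous_on_overlap[OF assms(1,2) d(1)] overlap_eq_0'[OF assms(1) d(1)] in auto)

text \<open>Change of variables along the transition map. Both integrands vanish outside the image
  of the common support, so the integrals may be cut down to the overlap of the two charts.\<close>

lemma integral_overlap:
  assumes c: "c \<in> F" and c': "c' \<in> F"
  shows "integral (chart_image c) (overlap c c' c) = integral (chart_image c') (overlap c c' c')"
proof -
  note cA = pouD(2)[OF c] and cA' = pouD(2)[OF c']
  let ?W = "fst c \<inter> fst c'"
  let ?S = "snd c ` ?W" and ?T = "transition c c'"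
  let ?T' = "\<lambda>x. frechet_derivative ?T (at x)"
  let ?C = "supp c \<inter> supp c'"
  have CW: "?C \<subseteq> ?W" using supp_subset[OF c] supp_subset[OF c'] by blast
  have TS: "?T ` ?S = snd c' ` ?W" by (rule transition_image[OF cA])
  \<comment> \<open>\<open>?f\<close> and \<open>?g\<close> are taken in the chart
    \<open>c'\<close>; their pullback \<open>?k\<close> is the integrand in \<open>c\<close>, by
    invariance of \<open>dwedge\<close> and of \<mu>.\<close>
  let ?f = "\<lambda>y. fscale (\<rho> c' (chart_inv c' y)) (dwedge (\<rho> c) \<beta> c' y)"
  let ?g = "\<mu> c'"
  let ?h = "\<lambda>y. ?f y std_frame * sgn (?g y std_frame)"
  let ?k = "\<lambda>x. ?f (?T x) (map (?T' x) std_frame) * sgn (?g (?T x) (map (?T' x) std_frame))"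
  have f': "?h y = overlap c c' c' y" for y
    by (simp add: overlap_def fscale_def orient_def)
  have f: "?k x = overlap c c' c x"
    if x: "x \<in> ?S" for x
  proof -
    obtain p where p: "p \<in> fst c" "p \<in> fst c'" "x = snd c p" using x by blast
    show ?thesis
      unfolding p(3) transition_chart[OF cA p(1)] fscale_def overlap_def orient_def
        dwedge_pullback[OF pouD(3)[OF c] \<beta> cA cA' p(1,2)] Omega_pullback[OF \<mu> cA cA' p(1,2)]
        chart_inv_chart[OF cA p(1)] chart_inv_chart[OF cA' p(2)] ..
  qed
  have sub: "?S \<subseteq> chart_image c" "snd c' ` ?W \<subseteq> chart_image c'" by (auto simp: chart_image_def)
  have inj: "x \<in> chart_image d - snd d ` ?C" if "d \<in> {c, c'}" "x \<in> snd d ` ?W - snd d ` ?C" for d x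
    using that by (auto simp: chart_image_def)
  have outside: "overlap c c' d x = 0" if d: "d \<in> {c, c'}" and x: "x \<in> chart_image d - snd d ` ?W" for d x
  proof (rule overlap_eq_0'[OF c])
    show "d \<in> A" using d cA cA' by auto
    show "x \<in> chart_image d - snd d ` ?C" using x CW by blast
  qed
  \<comment> \<open>The difference \<open>CARD('m) - 1\<close> is truncated, so positivity of the
    dimension enters here.\<close>
  have card: "Suc (CARD('m) - 1) = CARD('m)" using zero_less_card_finite[where 'a = 'm] by linarith
  have "integral ?S ?k
      = integral (?T ` ?S) ?h"
  proof (rule integral_top_form_change[OF open_overlap[OF cA cA'] inj_on_transition[OF cA cA']])
    show "open (?T ` ?S)"
      unfolding TS by (rule open_chart_image_of[OF cA' openin_overlap[OF cA cA']]) simp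
    show "(?T has_derivative ?T' x) (at x)" if "x \<in> ?S" for x
      using that transition_has_derivative[OF cA cA'] by auto
    fix y assume "y \<in> ?T ` ?S"
    then have y: "y \<in> chart_image c'" unfolding TS using sub(2) by blast
    show "Alt CARD('m) (?f y)"
      using Alt_dwedge[OF pouD(3)[OF c] \<beta> cA' y] unfolding card by (rule Alt_fscale)
    show "Alt CARD('m) (?g y)" by (rule Omega_Alt[OF \<mu> cA' y])
  next
    show "compact (snd c' ` ?C)" "compact (snd c ` ?C)"
      using CW by (auto intro!: compact_supp_image cA cA')
    show "snd c' ` ?C \<subseteq> ?T ` ?S" "snd c ` ?C \<subseteq> ?S" unfolding TS using CW by blast+
    show "continuous_on (?T ` ?S) ?h"
      unfolding f' TS by (rule continuous_on_subset[OF continuous_on_overlap[OF c c' cA'] sub(2)])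
    show "continuous_on ?S ?k"
      using continuous_on_subset[OF continuous_on_overlap[OF c c' cA] sub(1)]
      by (rule continuous_on_eq) (simp only: f)
    show "?h y = 0" if "y \<in> ?T ` ?S - snd c' ` ?C" for y
      unfolding f' using that inj[of c'] unfolding TS by (intro overlap_eq_0'[OF c cA']) blast
    show "?k x = 0"
      if "x \<in> ?S - snd c ` ?C" for x
      using that inj[of c] f[of x] overlap_eq_0'[OF c cA, of x c'] by simp
  qed
  also have "integral ?S ?k
      = integral ?S (overlap c c' c)"
    by (intro HK_cong f)
  also have "integral ?S (overlap c c' c) = integral (chart_image c) (overlap c c' c)"
    by (rule integral_on_subset[symmetric, OF sub(1)]) (use outside in blast)
  also have "integral (?T ` ?S) ?h
      = integral (chart_image c') (overlap c c' c')"
    unfolding f' TS by (rule integral_on_subset[symmetric, OF sub(2)]) (use outside in blast)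
  finally show ?thesis .
qed

lemma sum_dwedge:
  assumes d: "d \<in> A" "x \<in> chart_image d"
  shows "(\<Sum>c\<in>F. dwedge (\<rho> c) \<beta> d x) = 0"
proof -
  have "((\<lambda>y. \<Sum>c\<in>F. (\<rho> c \<circ> chart_inv d) y) has_derivative
      (\<lambda>v. \<Sum>c\<in>F. frechet_derivative (\<rho> c \<circ> chart_inv d) (at x) v)) (at x)"
    using pouD(3) by (intro has_derivative_sum smooth_function_has_derivative d) auto
  moreover have "((\<lambda>y. \<Sum>c\<in>F. (\<rho> c \<circ> chart_inv d) y) has_derivative (\<lambda>_. 0)) (at x)"
  proof (rule has_derivative_transform_within_open[OF has_derivative_const open_chart_image[OF d(1)] d(2)])
    fix y assume y: "y \<in> chart_image d"
    then have "chart_inv d y \<in> topspace M" using chart_inv_in[OF d(1)] chart_subset[OF d(1)] by blast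
    then show "1 = (\<Sum>c\<in>F. (\<rho> c \<circ> chart_inv d) y)" using pouD(5) by simp
  qed
  ultimately have "(\<lambda>v. \<Sum>c\<in>F. frechet_derivative (\<rho> c \<circ> chart_inv d) (at x) v) = (\<lambda>_. 0)"
    by (rule has_derivative_unique)
  then have "(\<Sum>c\<in>F. covector (frechet_derivative (\<rho> c \<circ> chart_inv d) (at x))) = 0"
    unfolding covector_sum[symmetric] by (simp add: covector_eq_0)
  then show ?thesis
    unfolding dwedge_def fwedge_sum_left[symmetric] by simp
qed

lemma stokes: "(\<Sum>c\<in>F. local_integral \<mu> c (\<rho> c) (ext_d A \<beta>)) = 0"
proof -
  have inA: "supp c \<inter> supp c' \<subseteq> fst c" "supp c \<inter> supp c' \<subseteq> fst c'" if "c \<in> F" "c' \<in> F" for c c'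
    using supp_subset[OF that(1)] supp_subset[OF that(2)] by blast+
  have "integral (chart_image c) (\<lambda>x. dwedge (\<rho> c) \<beta> c x std_frame * orient c x)
      = (\<Sum>c'\<in>F. integral (chart_image c) (overlap c c' c))" if c: "c \<in> F" for c
  proof -
    note cA = pouD(2)[OF c]
    have "integral (chart_image c) (\<lambda>x. dwedge (\<rho> c) \<beta> c x std_frame * orient c x)
        = integral (chart_image c) (\<lambda>x. \<Sum>c'\<in>F. overlap c c' c x)"
    proof (rule HK_cong)
      fix x assume "x \<in> chart_image c"
      then have "(\<Sum>c'\<in>F. \<rho> c' (chart_inv c x)) = 1"
        using pouD(5) chart_inv_in[OF cA] chart_subset[OF cA] by blast
      then show "dwedge (\<rho> c) \<beta> c x std_frame * orient c x = (\<Sum>c'\<in>F. overlap c c' c x)"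
        unfolding overlap_def by (simp add: mult.assoc flip: sum_distrib_right)
    qed
    also have "\<dots> = (\<Sum>c'\<in>F. integral (chart_image c) (overlap c c' c))"
      using c inA by (intro HK_sum pouD(1) overlap_integrable cA) auto
    finally show ?thesis .
  qed
  then have "(\<Sum>c\<in>F. local_integral \<mu> c (\<rho> c) (ext_d A \<beta>))
      = - (\<Sum>c\<in>F. \<Sum>c'\<in>F. integral (chart_image c) (overlap c c' c))"
    by (simp add: local_integral_ext_d sum_negf)
  also have "(\<Sum>c\<in>F. \<Sum>c'\<in>F. integral (chart_image c) (overlap c c' c))
      = (\<Sum>c\<in>F. \<Sum>c'\<in>F. integral (chart_image c') (overlap c c' c'))"
    by (intro sum.cong refl integral_overlap)
  also have "\<dots> = (\<Sum>c'\<in>F. \<Sum>c\<in>F. integral (chart_image c') (overlap c c' c'))"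
    by (rule sum.swap)
  also have "\<dots> = (\<Sum>c'\<in>F. integral (chart_image c') (\<lambda>x. \<Sum>c\<in>F. overlap c c' c' x))"
    using inA pouD(2)
    by (intro sum.cong refl HK_sum[symmetric] pouD(1) overlap_integrable) auto
  also have "\<dots> = (\<Sum>c'\<in>F. integral (chart_image c') (\<lambda>x. 0))"
  proof (intro sum.cong refl HK_cong)
    fix c' x assume c': "c' \<in> F" and x: "x \<in> chart_image c'"
    have "(\<Sum>c\<in>F. overlap c c' c' x)
        = \<rho> c' (chart_inv c' x) * (\<Sum>c\<in>F. dwedge (\<rho> c) \<beta> c' x) std_frame * orient c' x"
      by (simp add: overlap_def sum_fun_apply sum_distrib_left sum_distrib_right)
    then show "(\<Sum>c\<in>F. overlap c c' c' x) = 0"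
      by (simp add: sum_dwedge[OF pouD(2)[OF c'] x] zero_fun_apply)
  qed
  finally show ?thesis by simp
qed

end

section \<open>Forms on the manifold\<close>

lemma local_d_eq_0:
  assumes "open U" "x \<in> U" "\<And>y. y \<in> U \<Longrightarrow> \<alpha> y = 0"
  shows "local_d \<alpha> x = 0"
proof
  fix vs
  have "frechet_derivative (\<lambda>y. \<alpha> y us) (at x) v = 0" for us v
    by (rule frechet_derivativeI[OF has_derivative_zero_on_open[OF assms(1,2)]])
      (simp add: assms(3) zero_fun_apply)
  then show "local_d \<alpha> x vs = 0 vs" by (simp add: local_d_def zero_fun_apply)
qed

lemma local_d_cong:
  assumes "open U" "x \<in> U" "fdiff \<alpha> x" "\<And>y. y \<in> U \<Longrightarrow> \<alpha> y = \<beta> y"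
  shows "local_d \<alpha> x = local_d \<beta> x"
proof
  fix vs
  have "frechet_derivative (\<lambda>y. \<beta> y us) (at x) v = dderiv \<alpha> x v us" for us v
    by (rule frechet_derivativeI[OF has_derivative_transform_within_open[OF fdiff_has_derivative[OF assms(3)] assms(1,2)]])
      (simp add: assms(4))
  then show "local_d \<alpha> x vs = local_d \<beta> x vs" by (simp add: local_d_def dderiv_def)
qed

lemma local_d_fscale_const:
  assumes "fdiff \<beta> x" shows "local_d (\<lambda>y. fscale a (\<beta> y)) x = fscale a (local_d \<beta> x)"
proof -
  have "covector (frechet_derivative (\<lambda>_. a) (at x)) = 0"
    by (rule covector_eq_0) simp
  then show ?thesis using local_d_fscale[OF differentiable_const assms, of a] by simp
qed

lemma contract_dderiv: "contract v (dderiv \<alpha> x u) = dderiv (\<lambda>y. contract v (\<alpha> y)) x u"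
  by (simp add: fun_eq_iff contract_apply dderiv_def)

lemma dderiv_eq_0:
  assumes "open U" "x \<in> U" "\<And>y. y \<in> U \<Longrightarrow> \<alpha> y us = 0"
  shows "dderiv \<alpha> x v us = 0"
  unfolding dderiv_def by (rule frechet_derivativeI[OF has_derivative_zero_on_open[OF assms]])

text \<open>The defining conditions of \<open>Alt\<close> are linear in the form. They hold
  throughout the open set \<open>U\<close>, so they survive differentiation.\<close>

lemma Alt_dderiv:
  assumes U: "open U" "x \<in> U"
  shows "(\<And>y. y \<in> U \<Longrightarrow> Alt j (\<alpha> y)) \<Longrightarrow> fdiff \<alpha> x \<Longrightarrow> Alt j (dderiv \<alpha> x u)"
proof (induction j arbitrary: \<alpha>)
  case 0
  have "dderiv \<alpha> x u vs = 0" if "vs \<noteq> []" for vs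
    by (rule dderiv_eq_0[OF U]) (use 0(1) that in simp)
  then show ?case by simp
next
  case (Suc j)
  have "dderiv \<alpha> x u [] = 0"
    by (rule dderiv_eq_0[OF U]) (use Suc.prems(1) in simp)
  moreover have "linear (\<lambda>v. dderiv \<alpha> x u (v # vs))" for vs
  proof (rule linearI)
    have lin: "linear (\<lambda>v. \<alpha> y (v # vs))" if "y \<in> U" for y
      by (rule Alt_linear[OF Suc.prems(1)[OF that]])
    fix v w and r :: real
    have "((\<lambda>y. \<alpha> y ((v + w) # vs)) has_derivative (\<lambda>u. dderiv \<alpha> x u (v # vs) + dderiv \<alpha> x u (w # vs))) (at x)"
      by (rule has_derivative_transform_within_open[OF has_derivative_add[OF
            fdiff_has_derivative[OF Suc.prems(2), of "v # vs"] fdiff_has_derivative[OF Suc.prems(2), of "w # vs"]] U])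
        (simp add: linear_add[OF lin])
    from frechet_derivativeI[OF this, of u]
    show "dderiv \<alpha> x u ((v + w) # vs) = dderiv \<alpha> x u (v # vs) + dderiv \<alpha> x u (w # vs)"
      by (simp only: dderiv_def[of _ _ _ "(v + w) # vs"])
    have "((\<lambda>y. \<alpha> y ((r *\<^sub>R v) # vs)) has_derivative (\<lambda>u. r * dderiv \<alpha> x u (v # vs))) (at x)"
      by (rule has_derivative_transform_within_open[OF has_derivative_mult_right[OF
            fdiff_has_derivative[OF Suc.prems(2), of "v # vs"]] U])
        (simp add: linear_cmul[OF lin])
    from frechet_derivativeI[OF this, of u]
    show "dderiv \<alpha> x u ((r *\<^sub>R v) # vs) = r *\<^sub>R dderiv \<alpha> x u (v # vs)"
      by (simp only: dderiv_def[of _ _ _ "(r *\<^sub>R v) # vs"] real_scaleR_def)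
  qed
  moreover have "Alt j (contract v (dderiv \<alpha> x u))" for v
    unfolding contract_dderiv
    by (rule Suc.IH) (use Suc.prems in \<open>auto intro: fdiff_contract\<close>)
  moreover have "contract v (contract v (dderiv \<alpha> x u)) = 0" for v
  proof
    fix us
    have "dderiv (\<lambda>y. contract v (contract v (\<alpha> y))) x u us = 0"
      by (rule dderiv_eq_0[OF U]) (simp add: Alt_contract_twice[OF Suc.prems(1)] zero_fun_apply)
    then show "contract v (contract v (dderiv \<alpha> x u)) us = 0 us"
      by (simp add: contract_dderiv zero_fun_apply)
  qed
  ultimately show ?case by simp
qed

lemma Alt_local_d:
  assumes U: "open U" "x \<in> U"
  shows "(\<And>y. y \<in> U \<Longrightarrow> Alt j (\<alpha> y)) \<Longrightarrow> fdiff \<alpha> x \<Longrightarrow> Alt (Suc j) (local_d \<alpha> x)"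
proof (induction j arbitrary: \<alpha>)
  case (0 \<alpha>)
  have "local_d (\<lambda>y. contract v (\<alpha> y)) x = 0" for v
    by (rule local_d_eq_0[OF U]) (use 0(1) Alt_0_contract in blast)
  then have c: "contract v (local_d \<alpha> x) = dderiv \<alpha> x v" for v
    by (simp add: contract_local_d)
  have dderiv: "Alt 0 (dderiv \<alpha> x v)" for v by (rule Alt_dderiv[OF U 0])
  have "linear (\<lambda>v. local_d \<alpha> x (v # vs))" for vs
  proof -
    have "local_d \<alpha> x (v # vs) = dderiv \<alpha> x v vs" for v
      using fun_cong[OF c[of v], of vs] by (simp add: contract_apply)
    then show ?thesis using has_derivative_linear[OF fdiff_has_derivative[OF 0(2), of vs]] by simp
  qed
  moreover have "contract u (dderiv \<alpha> x v) = 0" for u v by (rule Alt_0_contract[OF dderiv])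
  ultimately show ?case using dderiv c by simp
next
  case (Suc j \<alpha>)
  have dderiv: "Alt (Suc j) (dderiv \<alpha> x v)" for v by (rule Alt_dderiv[OF U Suc.prems])
  have "linear (\<lambda>v. local_d \<alpha> x (v # vs))" for vs
  proof -
    \<comment> \<open>In the second term of Cartan's formula \<open>v\<close> is an argument of the
      derivatives of \<alpha>, which are alternating by \<open>dderiv\<close>.\<close>
    have "linear (\<lambda>v. \<Sum>i<length vs. (-1) ^ i * dderiv \<alpha> x (vs ! i) (v # take i vs @ drop (Suc i) vs))"
      by (intro linear_compose_sum ballI)
        (use Alt_linear[OF dderiv] linear_compose_scale_right[where 'b = real] in auto)
    then have "linear (\<lambda>v. local_d (\<lambda>y. contract v (\<alpha> y)) x vs)"
      by (simp add: local_d_def contract_apply dderiv_def)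
    then show ?thesis
      unfolding local_d_Cons
      by (intro linear_compose_sub has_derivative_linear[OF fdiff_has_derivative[OF Suc.prems(2)]])
  qed
  moreover have "Alt (Suc j) (contract v (local_d \<alpha> x))" for v
    unfolding contract_local_d
    by (intro Alt_diff dderiv Suc.IH) (use Suc.prems in \<open>auto intro: fdiff_contract\<close>)
  \<comment> \<open>Applying Cartan's formula twice, the derivative terms cancel and leave the
    differential of a double contraction, which is 0.\<close>
  moreover have "contract v (contract v (local_d \<alpha> x)) = 0" for v
  proof -
    have "local_d (\<lambda>y. contract v (contract v (\<alpha> y))) x = 0"
      by (rule local_d_eq_0[OF U]) (rule Alt_contract_twice[OF Suc.prems(1)])
    then show ?thesis
      by (simp add: contract_local_d contract_diff contract_dderiv)
  qed
  ultimately show ?case by simp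
qed

lemma fdiff_fpower: "fdiff \<alpha> x \<Longrightarrow> fdiff (\<lambda>y. fpower (\<alpha> y) k) x"
  by (induction k) (simp_all add: fdiff_funit fdiff_fwedge)

lemma local_d_fpower:
  assumes "fdiff \<alpha> x" "local_d \<alpha> x = 0"
  shows "local_d (\<lambda>y. fpower (\<alpha> y) k) x = 0"
proof (induction k)
  case 0
  show ?case by (simp add: local_d_def fun_eq_iff zero_fun_apply)
next
  case (Suc k)
  show ?case
    using local_d_fwedge[OF assms(1) fdiff_fpower[OF assms(1)], of k] by (simp add: assms(2) Suc.IH)
qed

text \<open>\<open>Omega\<close> without the normalisation off the charts: the zeroth power of
  \<omega> takes the value 1 there too.\<close>

definition is_form :: "('a, 'm::finite) chart set \<Rightarrow> nat \<Rightarrow> ('a, 'm) form \<Rightarrow> bool" where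
  "is_form A k \<alpha> \<longleftrightarrow>
     (\<forall>c\<in>A. \<forall>x\<in>chart_image c. Alt k (\<alpha> c x)) \<and>
     (\<forall>c\<in>A. \<forall>vs. smooth_on (\<lambda>x. \<alpha> c x vs) (chart_image c)) \<and>
     (\<forall>c\<in>A. \<forall>c'\<in>A. \<forall>p\<in>fst c \<inter> fst c'. \<forall>vs.
        \<alpha> c (snd c p) vs =
        \<alpha> c' (snd c' p) (map (frechet_derivative (transition c c') (at (snd c p))) vs))"

lemma Omega_eq_is_form:
  "\<alpha> \<in> Omega A k \<longleftrightarrow> (\<forall>c x vs. c \<notin> A \<or> x \<notin> chart_image c \<longrightarrow> \<alpha> c x vs = 0) \<and> is_form A k \<alpha>"
  unfolding Omega_def is_form_def Alt_iff_alternating_multilinear mem_Collect_eq ..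

lemma is_formD:
  assumes "is_form A k \<alpha>" "c \<in> A"
  shows "x \<in> chart_image c \<Longrightarrow> Alt k (\<alpha> c x)"
    and "smooth_on (\<lambda>x. \<alpha> c x vs) (chart_image c)"
    and "c' \<in> A \<Longrightarrow> p \<in> fst c \<Longrightarrow> p \<in> fst c' \<Longrightarrow>
      \<alpha> c (snd c p) vs = \<alpha> c' (snd c' p) (map (frechet_derivative (transition c c') (at (snd c p))) vs)"
  using assms(1)[unfolded is_form_def, THEN conjunct1, rule_format, OF assms(2)]
    assms(1)[unfolded is_form_def, THEN conjunct2, THEN conjunct1, rule_format, OF assms(2)]
    assms(1)[unfolded is_form_def, THEN conjunct2, THEN conjunct2, rule_format, OF assms(2) _ IntI]
  by blast+

context smooth_manifold
begin

lemma is_form_wedge: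
  assumes \<alpha>: "is_form A j \<alpha>" and \<beta>: "is_form A k \<beta>"
  shows "is_form A (j + k) (wedge \<alpha> \<beta>)"
  unfolding is_form_def
proof (intro conjI ballI allI)
  fix c x assume "c \<in> A" "x \<in> chart_image c"
  then show "Alt (j + k) (wedge \<alpha> \<beta> c x)"
    unfolding wedge_eq_fwedge by (intro Alt_fwedge is_formD(1)[OF \<alpha>] is_formD(1)[OF \<beta>])
next
  fix c vs assume c: "c \<in> A"
  show "smooth_on (\<lambda>x. wedge \<alpha> \<beta> c x vs) (chart_image c)"
    unfolding wedge_def
    by (intro smooth_on_sum smooth_on_mult smooth_on_const open_chart_image c is_formD(2)[OF \<alpha>] is_formD(2)[OF \<beta>])
next
  fix c c' p vs assume c: "c \<in> A" "c' \<in> A" and p: "p \<in> fst c \<inter> fst c'"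
  let ?DT = "frechet_derivative (transition c c') (at (snd c p))"
  have "\<alpha> c (snd c p) = (\<lambda>us. \<alpha> c' (snd c' p) (map ?DT us))"
    "\<beta> c (snd c p) = (\<lambda>us. \<beta> c' (snd c' p) (map ?DT us))"
    using p by (auto intro!: ext is_formD(3)[OF \<alpha> c] is_formD(3)[OF \<beta> c])
  then show "wedge \<alpha> \<beta> c (snd c p) vs = wedge \<alpha> \<beta> c' (snd c' p) (map ?DT vs)"
    by (simp only: wedge_eq_fwedge fwedge_map)
qed

lemma is_form_wedge_power:
  assumes "is_form A j \<omega>" shows "is_form A (k * j) (wedge_power \<omega> k)"
proof (induction k)
  case 0
  show ?case by (simp add: is_form_def)
next
  case (Suc k)
  then show ?case using is_form_wedge[OF assms] by simp
qed

text \<open>The values 0 off the charts are inherited from the factor \<alpha>.\<close>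

lemma Omega_wedge:
  assumes \<alpha>: "\<alpha> \<in> Omega A j" and \<beta>: "is_form A k \<beta>"
  shows "wedge \<alpha> \<beta> \<in> Omega A (j + k)"
  using assms is_form_wedge[of j \<alpha> k \<beta>] unfolding Omega_eq_is_form
  by (simp add: wedge_def)

lemma fdiff_form:
  assumes "is_form A k \<alpha>" "c \<in> A" "x \<in> chart_image c" shows "fdiff (\<alpha> c) x"
  by (rule fdiff_smooth[OF is_formD(2)[OF assms(1,2)] open_chart_image[OF assms(2)] assms(3)])

lemma Omega_zero: "0 \<in> Omega A k"
  by (simp add: Omega_eq_is_form is_form_def zero_fun_apply)

end

section \<open>Differentiability of the Poisson tensor\<close>

lemma differentiable_prod:
  fixes f :: "'i \<Rightarrow> 'e::real_normed_vector \<Rightarrow> real"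
  assumes "\<And>i. i \<in> I \<Longrightarrow> f i differentiable (at x)"
  shows "(\<lambda>y. \<Prod>i\<in>I. f i y) differentiable (at x)"
  using assms by (induction I rule: infinite_finite_induct) auto

lemma differentiable_det:
  fixes B :: "'e::real_normed_vector \<Rightarrow> real^'m::finite^'m"
  assumes "\<And>i j. (\<lambda>y. B y $ i $ j) differentiable (at x)"
  shows "(\<lambda>y. det (B y)) differentiable (at x)"
  unfolding det_def using assms
  by (intro differentiable_sum ballI differentiable_mult differentiable_const differentiable_prod)
    (auto simp: finite_permutations)

text \<open>Cramer's rule writes each entry as a quotient of determinants on the open set where
  \<open>B\<close> is invertible.\<close>

lemma differentiable_matrix_inv:
  fixes B :: "'e::real_normed_vector \<Rightarrow> real^'m::finite^'m"
  assumes U: "open U" "x \<in> U" and inv: "\<And>y. y \<in> U \<Longrightarrow> invertible (B y)"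
    and B: "\<And>i j. (\<lambda>y. B y $ i $ j) differentiable (at x)"
  shows "(\<lambda>y. matrix_inv (B y) $ k $ l) differentiable (at x)"
proof -
  let ?d = "\<lambda>y. det (\<chi> i j. if j = k then axis l 1 $ i else B y $ i $ j)"
  have eq: "?d y / det (B y) = matrix_inv (B y) $ k $ l" if "y \<in> U" for y
  proof -
    have "B y ** matrix_inv (B y) = mat 1"
      using someI_ex[OF inv[OF that, unfolded invertible_def]] by (simp add: matrix_inv_def)
    then have "B y *v column l (matrix_inv (B y)) = axis l 1"
      by (metis matrix_vector_mul_assoc matrix_vector_mul_lid matrix_vector_mult_basis)
    moreover have "det (B y) \<noteq> 0" using inv[OF that] by (simp add: invertible_det_nz)
    ultimately have "column l (matrix_inv (B y)) = (\<chi> k. det (\<chi> i j. if j = k then axis l 1 $ i else B y $ i $ j) / det (B y))"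
      using cramer by blast
    then have "column l (matrix_inv (B y)) $ k = ?d y / det (B y)" by simp
    then show ?thesis by (simp add: column_def)
  qed
  have "(\<lambda>y. if j = k then axis l 1 $ i else B y $ i $ j) differentiable (at x)" for i j
    using B by (cases "j = k") auto
  then have "?d differentiable (at x)" by (intro differentiable_det) simp
  moreover have "(\<lambda>y. det (B y)) differentiable (at x)" by (rule differentiable_det[OF B])
  moreover have "det (B x) \<noteq> 0" using inv[OF U(2)] by (simp add: invertible_det_nz)
  ultimately have "(\<lambda>y. ?d y / det (B y)) differentiable (at x)" by (intro differentiable_divide)
  then obtain D where "((\<lambda>y. ?d y / det (B y)) has_derivative D) (at x)" unfolding differentiable_def by blast
  then have "((\<lambda>y. matrix_inv (B y) $ k $ l) has_derivative D) (at x)"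
    by (rule has_derivative_transform_within_open[OF _ U]) (rule eq)
  then show ?thesis unfolding differentiable_def by blast
qed

lemma poisson_contract_eq:
  "poisson_contract \<omega> \<alpha> c x = fscale (1/2) (pcontract (poisson \<omega> c x) (\<alpha> c x))"
  by (simp add: fun_eq_iff poisson_contract_def fscale_def pcontract_def sum_fun_apply)

section \<open>The quantum Stokes theorem\<close>

lemma wedge_wedge_power:
  "wedge \<alpha> (wedge_power \<omega> k) c = (\<lambda>y. fwedge (\<alpha> c y) (fpower (\<omega> c y) k))"
  by (rule ext) (simp only: wedge_eq_fwedge wedge_power_eq_fpower)

context closed_symplectic_manifold
begin

lemma is_form_\<omega>: "is_form A 2 \<omega>"
  using two_form by (simp only: Omega_eq_is_form)

lemma symplectic_fibre:
  assumes "c \<in> A" "x \<in> chart_image c" shows "symplectic_form (\<omega> c x)"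
  using is_formD(1)[OF is_form_\<omega> assms] nondegenerate[OF assms] by unfold_locales

lemma is_form_\<omega>_power: "is_form A (2 * k) (wedge_power \<omega> k)"
  using is_form_wedge_power[OF is_form_\<omega>, of k] by (simp only: mult.commute)

text \<open>Index types are nonempty, so dimension 0 does not occur, and \<open>2 * n - 1\<close> is
  a true difference.\<close>

lemma n_pos: "n > 0"
  using dimension zero_less_card_finite[where 'a = 'm] by (cases n) auto

lemma volume_form: "wedge_power \<omega> n \<in> Omega A CARD('m)"
proof -
  \<comment> \<open>One factor \<omega> is split off, since \<open>Omega_wedge\<close> takes the
    normalisation off the charts from its first factor.\<close>
  obtain m where m: "n = Suc m" using n_pos by (cases n) auto
  have "wedge \<omega> (wedge_power \<omega> m) \<in> Omega A (2 + 2 * m)"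
    by (rule Omega_wedge[OF two_form is_form_\<omega>_power])
  then show ?thesis by (simp add: m dimension)
qed

lemma volume_form_nonzero:
  "c \<in> A \<Longrightarrow> x \<in> chart_image c \<Longrightarrow> wedge_power \<omega> n c x std_frame \<noteq> 0"
  unfolding wedge_power_eq_fpower
  by (rule symplectic_form.fpower_std_frame[OF symplectic_fibre dimension])

text \<open>Local integrals evaluate a form on \<open>std_frame\<close> alone, so \<open>B\<close>
  is compared with the exact form only there.\<close>

lemma manifold_integral_exact:
  assumes \<beta>: "\<beta> \<in> Omega A (2 * n - 1)"
    and B: "\<And>c x. c \<in> A \<Longrightarrow> x \<in> chart_image c \<Longrightarrow> B c x std_frame = C * ext_d A \<beta> c x std_frame"
  shows "manifold_integral M A (wedge_power \<omega> n) B = 0"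
proof -
  obtain F \<rho> where F\<rho>: "(SOME (F, \<rho>). partition_of_unity M A F \<rho>) = (F, \<rho>)"
    by (meson surj_pair)
  \<comment> \<open>Existence turns the pair selected in the definition into a partition of unity,
    to which Stokes' theorem applies.\<close>
  have "\<exists>z. (\<lambda>(F, \<rho>). partition_of_unity M A F \<rho>) z"
    using ex_partition_of_unity by simp
  from someI_ex[OF this] have pou: "partition_of_unity M A F \<rho>"
    unfolding F\<rho> by simp
  interpret integration_data M A F \<rho> \<beta> "wedge_power \<omega> n"
    by unfold_locales (use pou \<beta> volume_form volume_form_nonzero in \<open>simp_all add: dimension\<close>)
  have "local_integral (wedge_power \<omega> n) c (\<rho> c) B = C * local_integral (wedge_power \<omega> n) c (\<rho> c) (ext_d A \<beta>)"
    if "c \<in> F" for c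
  proof -
    have "local_integral (wedge_power \<omega> n) c (\<rho> c) B = integral (chart_image c)
        (\<lambda>x. C * (\<rho> c (chart_inv c x) * ext_d A \<beta> c x std_frame * sgn (wedge_power \<omega> n c x std_frame)))"
      unfolding local_integral_def
      by (intro HK_cong) (simp add: B pouD(2)[OF that])
    then show ?thesis by (simp add: local_integral_def)
  qed
  then have "(\<Sum>c\<in>F. local_integral (wedge_power \<omega> n) c (\<rho> c) B)
      = C * (\<Sum>c\<in>F. local_integral (wedge_power \<omega> n) c (\<rho> c) (ext_d A \<beta>))"
    by (simp add: sum_distrib_left)
  then show ?thesis
    by (simp add: manifold_integral_def F\<rho> stokes)
qed

text \<open>The form \<gamma> has degree \<open>m\<close>, so its other degree parts contribute 0.
  The factorial goes into the constant, and \<open>a\<close> serves to treat a form and its negative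
  alike.\<close>

lemma quantum_integral_exact:
  assumes deg: "\<And>c x vs. c \<in> A \<Longrightarrow> x \<in> chart_image c \<Longrightarrow> length vs \<noteq> m \<Longrightarrow> \<gamma> c x vs = 0"
    and ex: "even m \<Longrightarrow> m \<le> 2 * n \<Longrightarrow> \<exists>C. \<exists>\<beta>\<in>Omega A (2 * n - 1). \<forall>c\<in>A. \<forall>x\<in>chart_image c.
      fwedge (\<gamma> c x) (fpower (\<omega> c x) (n - m div 2)) std_frame = C * ext_d A \<beta> c x std_frame"
  shows "(\<Sum>i\<le>2 * n. quantum_integral_deg n M A \<omega> i (deg_part i (\<lambda>c x. fscale a (\<gamma> c x)))) = 0"
proof (intro sum.neutral ballI)
  fix i
  let ?k = "n - i div 2" and ?\<gamma> = "\<lambda>c x. fscale a (\<gamma> c x)"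
  let ?B = "wedge (deg_part i ?\<gamma>) (\<lambda>c x vs. wedge_power \<omega> ?k c x vs / fact ?k)"
  have *: "\<exists>C. \<exists>\<beta>\<in>Omega A (2 * n - 1). \<forall>c\<in>A. \<forall>x\<in>chart_image c.
      ?B c x std_frame = C * ext_d A \<beta> c x std_frame" if i: "even i" "i \<le> 2 * n"
  proof (cases "i = m")
    case True
    obtain C \<beta> where \<beta>: "\<beta> \<in> Omega A (2 * n - 1)" and eq: "\<And>c x. c \<in> A \<Longrightarrow> x \<in> chart_image c \<Longrightarrow>
        fwedge (\<gamma> c x) (fpower (\<omega> c x) ?k) std_frame = C * ext_d A \<beta> c x std_frame"
      using ex i unfolding True by blast
    have "?B c x std_frame = (1 / fact ?k * (a * C)) * ext_d A \<beta> c x std_frame" if cx: "c \<in> A" "x \<in> chart_image c" for c x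
    proof -
      have 1: "deg_part i ?\<gamma> c x = fscale a (\<gamma> c x)"
        using deg[OF cx] by (auto simp: deg_part_def True fscale_def)
      have 2: "(\<lambda>vs. wedge_power \<omega> ?k c x vs / fact ?k) = fscale (1 / fact ?k) (fpower (\<omega> c x) ?k)"
        by (simp add: fun_eq_iff fscale_def wedge_power_eq_fpower)
      show ?thesis
        unfolding wedge_eq_fwedge 1 2 fwedge_fscale_right fwedge_fscale_left fscale_def eq[OF cx] by simp
    qed
    then show ?thesis using \<beta> by blast
  next
    case False
    have "?B c x std_frame = 0 * ext_d A 0 c x std_frame" if cx: "c \<in> A" "x \<in> chart_image c" for c x
    proof -
      have "deg_part i ?\<gamma> c x = 0"
        using deg[OF cx] False by (auto simp: deg_part_def fun_eq_iff zero_fun_apply fscale_def)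
      then show ?thesis by (simp add: wedge_eq_fwedge zero_fun_apply)
    qed
    then show ?thesis using Omega_zero by blast
  qed
  show "quantum_integral_deg n M A \<omega> i (deg_part i ?\<gamma>) = 0"
  proof (cases "even i \<and> i \<le> 2 * n")
    case True
    with * obtain C \<beta> where \<beta>: "\<beta> \<in> Omega A (2 * n - 1)" and B: "\<And>c x. c \<in> A \<Longrightarrow> x \<in> chart_image c \<Longrightarrow>
        ?B c x std_frame = C * ext_d A \<beta> c x std_frame" by blast
    have "manifold_integral M A (wedge_power \<omega> n) ?B = 0"
      by (rule manifold_integral_exact[where B = ?B and C = C, OF \<beta> B])
    then show ?thesis
      by (simp only: quantum_integral_deg_def Let_def if_cancel)
  qed (auto simp: quantum_integral_deg_def)
qed

lemma local_d_\<omega>: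
  assumes "c \<in> A" "x \<in> chart_image c" shows "local_d (\<omega> c) x = 0"
  using fun_cong[OF fun_cong[OF d_closed, of c], of x] ext_d_eq_local_d[OF assms, of \<omega>]
  by (simp add: zero_fun_apply fun_eq_iff)

section \<open>Exactness of the two integrands\<close>

context
  fixes \<alpha> :: "('a, 'm) form" and j :: nat
  assumes \<alpha>: "\<alpha> \<in> Omega A j"
begin

lemma is_form_\<alpha>: "is_form A j \<alpha>"
  using \<alpha> by (simp only: Omega_eq_is_form)

lemma ext_d_wedge_power:
  assumes cx: "c \<in> A" "x \<in> chart_image c"
  shows "ext_d A (wedge \<alpha> (wedge_power \<omega> k)) c x = fwedge (local_d (\<alpha> c) x) (fpower (\<omega> c x) k)"
proof -
  have "ext_d A (wedge \<alpha> (wedge_power \<omega> k)) c x = local_d (\<lambda>y. fwedge (\<alpha> c y) (fpower (\<omega> c y) k)) x"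
    by (simp only: ext_d_eq_local_d[OF cx] wedge_wedge_power)
  also have "\<dots> = fwedge (local_d (\<alpha> c) x) (fpower (\<omega> c x) k)"
    using local_d_fwedge[OF fdiff_form[OF is_form_\<alpha> cx] fdiff_fpower[OF fdiff_form[OF is_form_\<omega> cx]], of k]
      local_d_fpower[OF fdiff_form[OF is_form_\<omega> cx] local_d_\<omega>[OF cx], of k] by simp
  finally show ?thesis .
qed

lemma Omega_wedge_power: "wedge \<alpha> (wedge_power \<omega> k) \<in> Omega A (j + 2 * k)"
  by (rule Omega_wedge[OF \<alpha> is_form_\<omega>_power])

lemma Alt_ext_d:
  assumes cx: "c \<in> A" "x \<in> chart_image c" shows "Alt (Suc j) (ext_d A \<alpha> c x)"
  unfolding ext_d_eq_local_d[OF cx]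
  by (rule Alt_local_d[OF open_chart_image[OF cx(1)] cx(2) is_formD(1)[OF is_form_\<alpha> cx(1)] fdiff_form[OF is_form_\<alpha> cx]])

lemma quantum_integral_ext_d:
  "(\<Sum>i\<le>2 * n. quantum_integral_deg n M A \<omega> i (deg_part i (ext_d A \<alpha>))) = 0"
proof (rule quantum_integral_exact[where a = 1, unfolded fscale_simps])
  show "ext_d A \<alpha> c x vs = 0" if "c \<in> A" "x \<in> chart_image c" "length vs \<noteq> Suc j" for c x vs
    by (rule Alt_length[OF Alt_ext_d[OF that(1,2)] that(3)])
  assume j: "even (Suc j)" "Suc j \<le> 2 * n"
  let ?k = "n - Suc j div 2"
  \<comment> \<open>As d\<alpha> has even degree, the primitive has exactly the degree that Stokes'
    theorem expects.\<close>
  have "j + 2 * ?k = 2 * n - 1"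
  proof -
    obtain i where i: "Suc j = 2 * i" using j(1) by (elim evenE)
    then have "?k = n - i" by (simp add: i)
    then show ?thesis using i j(2) by linarith
  qed
  then have "wedge \<alpha> (wedge_power \<omega> ?k) \<in> Omega A (2 * n - 1)"
    using Omega_wedge_power[of ?k] by (simp only:)
  moreover have "fwedge (ext_d A \<alpha> c x) (fpower (\<omega> c x) ?k) std_frame
      = 1 * ext_d A (wedge \<alpha> (wedge_power \<omega> ?k)) c x std_frame" if "c \<in> A" "x \<in> chart_image c" for c x
    unfolding ext_d_wedge_power[OF that] unfolding ext_d_eq_local_d[OF that] by simp
  ultimately show "\<exists>C. \<exists>\<beta>\<in>Omega A (2 * n - 1). \<forall>c\<in>A. \<forall>x\<in>chart_image c.
      fwedge (ext_d A \<alpha> c x) (fpower (\<omega> c x) ?k) std_frame = C * ext_d A \<beta> c x std_frame"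
    by blast
qed

text \<open>Twice the contraction of \<alpha> with the Poisson bivector field. It is differentiated
  within a chart only; the form given to Stokes' theorem is \<alpha> times a power of
  \<omega>.\<close>

definition Lambda where "Lambda c x = pcontract (poisson \<omega> c x) (\<alpha> c x)"

lemma poisson_eq: "c \<in> A \<Longrightarrow> x \<in> chart_image c \<Longrightarrow> poisson \<omega> c x = symplectic_form.W (\<omega> c x)"
  by (simp add: poisson_def symplectic_form.W_def symplectic_form.\<Omega>_def symplectic_fibre)

lemma fdiff_Lambda:
  assumes cx: "c \<in> A" "x \<in> chart_image c" shows "fdiff (Lambda c) x"
proof -
  have "(\<lambda>y. poisson \<omega> c y $ i $ k) differentiable (at x)" for i k
    unfolding poisson_def
  proof (rule differentiable_matrix_inv[OF open_chart_image[OF cx(1)] cx(2)])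
    show "invertible (\<chi> i j. \<omega> c y [axis i 1, axis j 1])" if "y \<in> chart_image c" for y
      using symplectic_form.invertible_\<Omega>[OF symplectic_fibre[OF cx(1) that]]
      by (simp add: symplectic_form.\<Omega>_def[OF symplectic_fibre[OF cx(1) that]])
    show "(\<lambda>y. (\<chi> i j. \<omega> c y [axis i 1, axis j 1]) $ i $ j) differentiable (at x)" for i j
      using fdiff_form[OF is_form_\<omega> cx] by (simp add: fdiff_def)
  qed
  moreover have "(\<lambda>y. \<alpha> c y us) differentiable (at x)" for us
    using fdiff_form[OF is_form_\<alpha> cx] by (simp add: fdiff_def)
  ultimately show ?thesis
    by (simp add: fdiff_def Lambda_def pcontract_def sum_fun_apply fscale_def contract_apply)
qed

lemma koszul_eq:
  assumes cx: "c \<in> A" "x \<in> chart_image c"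
  shows "koszul A \<omega> \<alpha> c x
    = fscale (1/2) (pcontract (poisson \<omega> c x) (local_d (\<alpha> c) x)) - fscale (1/2) (local_d (Lambda c) x)"
proof -
  have "poisson_contract \<omega> \<alpha> c = (\<lambda>y. fscale (1/2) (Lambda c y))"
    by (simp add: fun_eq_iff poisson_contract_eq Lambda_def)
  then have "ext_d A (poisson_contract \<omega> \<alpha>) c x = fscale (1/2) (local_d (Lambda c) x)"
    by (simp only: ext_d_eq_local_d[OF cx] local_d_fscale_const[OF fdiff_Lambda[OF cx]])
  then show ?thesis
    by (simp only: koszul_def minus_apply poisson_contract_eq ext_d_eq_local_d[OF cx])
qed

lemma pcontract_length:
  "Alt k f \<Longrightarrow> length vs + 2 \<noteq> k \<Longrightarrow> pcontract W f vs = 0"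
  by (simp add: pcontract_def sum_fun_apply fscale_def contract_apply Alt_length)

text \<open>The contraction lowers the degree by two and d raises it by one. For
  \<open>j = 0\<close> the difference \<open>j - 1\<close> is truncated, so that case is listed
  separately: there \<delta>\<alpha> vanishes on all lists.\<close>

lemma koszul_degree:
  assumes cx: "c \<in> A" "x \<in> chart_image c" and vs: "length vs \<noteq> j - 1 \<or> j = 0"
  shows "koszul A \<omega> \<alpha> c x vs = 0"
proof -
  have "pcontract (poisson \<omega> c x) (local_d (\<alpha> c) x) vs = 0"
    using vs by (intro pcontract_length[OF Alt_ext_d[OF cx, unfolded ext_d_eq_local_d[OF cx]]]) auto
  moreover have "local_d (Lambda c) x vs = 0"
  proof -
    have "frechet_derivative (\<lambda>y. Lambda c y (take i vs @ drop (Suc i) vs)) (at x) v = 0" if "i < length vs" for i v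
    proof (rule frechet_derivativeI[OF has_derivative_zero_on_open[OF open_chart_image[OF cx(1)] cx(2)]])
      fix y assume "y \<in> chart_image c"
      then show "Lambda c y (take i vs @ drop (Suc i) vs) = 0"
        unfolding Lambda_def using vs that
        by (intro pcontract_length[OF is_formD(1)[OF is_form_\<alpha> cx(1)]]) auto
    qed
    then show ?thesis by (simp add: local_d_def)
  qed
  ultimately show ?thesis
    by (simp add: koszul_eq[OF cx] minus_apply fscale_def)
qed

lemma koszul_exact:
  assumes j: "even (j - 1)" "j - 1 \<le> 2 * n"
  shows "\<exists>C. \<exists>\<beta>\<in>Omega A (2 * n - 1). \<forall>c\<in>A. \<forall>x\<in>chart_image c.
    fwedge (koszul A \<omega> \<alpha> c x) (fpower (\<omega> c x) (n - (j - 1) div 2)) std_frame = C * ext_d A \<beta> c x std_frame"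
proof -
  have trivial: ?thesis if "\<And>c x. c \<in> A \<Longrightarrow> x \<in> chart_image c \<Longrightarrow> koszul A \<omega> \<alpha> c x = 0"
  proof (intro exI[of _ 0] bexI[OF _ Omega_zero] ballI)
    fix c x assume "c \<in> A" "x \<in> chart_image c"
    then show "fwedge (koszul A \<omega> \<alpha> c x) (fpower (\<omega> c x) (n - (j - 1) div 2)) std_frame = 0 * ext_d A 0 c x std_frame"
      by (simp add: that zero_fun_apply)
  qed
  \<comment> \<open>The exponent \<open>l\<close> is one less than the exponent of \<omega> in the
    integral. For \<open>j = 2 * n + 1\<close> the latter is already 0, but then \<alpha> vanishes;
    \<open>j = 0\<close> meets the parity condition only through truncation.\<close>
  consider "j = 0" | "j = 2 * n + 1" | l where "j + 2 * l = 2 * n - 1" "n - (j - 1) div 2 = Suc l" "j > 0"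
  proof -
    assume *: "j = 0 \<Longrightarrow> thesis" "j = 2 * n + 1 \<Longrightarrow> thesis"
      "\<And>l. j + 2 * l = 2 * n - 1 \<Longrightarrow> n - (j - 1) div 2 = Suc l \<Longrightarrow> j > 0 \<Longrightarrow> thesis"
    obtain i where i: "j - 1 = 2 * i" using j(1) by (elim evenE)
    have "i \<le> n" using i j(2) by simp
    consider "j = 0" | "j > 0" "i = n" | "j > 0" "i < n" using \<open>i \<le> n\<close> by linarith
    then show thesis
    proof cases
      case 2
      then have "j = 2 * n + 1" using i by linarith
      then show thesis by (rule *(2))
    next
      case 3
      show thesis
      proof (rule *(3)[of "n - i - 1"])
        have "j = 2 * i + 1" using 3 i by linarith
        then show "j + 2 * (n - i - 1) = 2 * n - 1" using 3 by simp
        have "(j - 1) div 2 = i" unfolding i by simp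
        then show "n - (j - 1) div 2 = Suc (n - i - 1)" using 3 by linarith
      qed (use 3 in simp)
    qed (rule *(1))
  qed
  then show ?thesis
  proof cases
    case 1
    then show ?thesis
      using koszul_degree by (intro trivial) (auto simp: fun_eq_iff zero_fun_apply)
  next
    case 2
    show ?thesis
    proof (rule trivial)
      fix c x assume cx: "c \<in> A" "x \<in> chart_image c"
      have "\<alpha> c y = 0" if "y \<in> chart_image c" for y
        by (rule Alt_degree_gt_DIM[OF is_formD(1)[OF is_form_\<alpha> cx(1) that]]) (simp add: 2 dimension)
      moreover from this have "local_d (\<alpha> c) x = 0"
        by (intro local_d_eq_0[OF open_chart_image[OF cx(1)] cx(2)])
      moreover have "pcontract W 0 = 0" for W :: "real^'m^'m"
        by (simp add: pcontract_def)
      ultimately show "koszul A \<omega> \<alpha> c x = 0"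
        using local_d_eq_0[OF open_chart_image[OF cx(1)] cx(2), of "Lambda c"]
        by (simp add: koszul_eq[OF cx] Lambda_def)
    qed
  next
    case (3 l)
    let ?\<beta> = "wedge \<alpha> (wedge_power \<omega> l)"
    \<comment> \<open>The constant of \<open>pcontract_fwedge_fpower\<close> in degree
      \<open>i\<close>, for d\<alpha> with \<open>i = Suc j\<close> and for \<alpha> with
      \<open>i = j\<close>. Half the difference of these two values is \<open>Suc l\<close>.\<close>
    let ?a = "\<lambda>i. real (Suc l) * (2 * real i + 2 * real l - real CARD('m))"
    have "?\<beta> \<in> Omega A (2 * n - 1)" using Omega_wedge_power[of l] 3(1) by (simp only:)
    moreover have "fwedge (koszul A \<omega> \<alpha> c x) (fpower (\<omega> c x) (n - (j - 1) div 2)) std_frame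
        = (1/2 * ?a (Suc j) - 1/2 * ?a j) * ext_d A ?\<beta> c x std_frame"
      if cx: "c \<in> A" "x \<in> chart_image c" for c x
    proof -
      note U = open_chart_image[OF cx(1)] cx(2)
      note d\<omega> = fdiff_form[OF is_form_\<omega> cx] and d\<alpha> = fdiff_form[OF is_form_\<alpha> cx]
      \<comment> \<open>The total degree is \<open>2 * n + 1\<close>, just above the
        dimension.\<close>
      have deg: "CARD('m) < j + 2 * Suc l" unfolding dimension using 3(1) n_pos by simp
      then have "CARD('m) < Suc j + 2 * Suc l" by simp
      note lower = symplectic_form.pcontract_fwedge_fpower[OF symplectic_fibre _ this]
        symplectic_form.pcontract_fwedge_fpower[OF symplectic_fibre _ deg]
      have "Alt (Suc j) (local_d (\<alpha> c) x)" using Alt_ext_d[OF cx] by (simp only: ext_d_eq_local_d[OF cx])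
      from lower(1)[OF cx this]
      have 1: "fwedge (pcontract (poisson \<omega> c x) (local_d (\<alpha> c) x)) (fpower (\<omega> c x) (Suc l))
          = fscale (?a (Suc j)) (fwedge (local_d (\<alpha> c) x) (fpower (\<omega> c x) l))"
        by (simp only: poisson_eq[OF cx])
      \<comment> \<open>As \<omega> is closed, the power moves inside the differential. The
        pointwise identity can then be used under it, because it holds on the whole chart.\<close>
      have "fwedge (local_d (Lambda c) x) (fpower (\<omega> c x) (Suc l)) = local_d (\<lambda>y. fwedge (Lambda c y) (fpower (\<omega> c y) (Suc l))) x"
        using local_d_fwedge[OF fdiff_Lambda[OF cx] fdiff_fpower[OF d\<omega>], of "Suc l"]
          local_d_fpower[OF d\<omega> local_d_\<omega>[OF cx], of "Suc l"] by (simp only: fwedge_zero_right add_0_right)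
      also have "\<dots> = local_d (\<lambda>y. fscale (?a j) (fwedge (\<alpha> c y) (fpower (\<omega> c y) l))) x"
      proof (rule local_d_cong[OF U fdiff_fwedge[OF fdiff_Lambda[OF cx] fdiff_fpower[OF d\<omega>]]])
        fix y assume y: "y \<in> chart_image c"
        show "fwedge (Lambda c y) (fpower (\<omega> c y) (Suc l)) = fscale (?a j) (fwedge (\<alpha> c y) (fpower (\<omega> c y) l))"
          using lower(2)[OF cx(1) y is_formD(1)[OF is_form_\<alpha> cx(1) y]]
          by (simp only: Lambda_def poisson_eq[OF cx(1) y])
      qed
      also have "\<dots> = fscale (?a j) (local_d (\<lambda>y. fwedge (\<alpha> c y) (fpower (\<omega> c y) l)) x)"
        by (rule local_d_fscale_const[OF fdiff_fwedge[OF d\<alpha> fdiff_fpower[OF d\<omega>]]])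
      also have "local_d (\<lambda>y. fwedge (\<alpha> c y) (fpower (\<omega> c y) l)) x = ext_d A ?\<beta> c x"
        by (simp only: ext_d_eq_local_d[OF cx] wedge_wedge_power)
      finally have 2: "fwedge (local_d (Lambda c) x) (fpower (\<omega> c x) (Suc l)) = fscale (?a j) (ext_d A ?\<beta> c x)" .
      show ?thesis
        unfolding koszul_eq[OF cx] 3(2) fwedge_diff_left fwedge_fscale_left 1 2 ext_d_wedge_power[OF cx, symmetric]
          minus_apply fscale_def
        by (simp only: left_diff_distrib mult.assoc)
    qed
    ultimately show ?thesis by blast
  qed
qed

lemma quantum_integral_koszul:
  "(\<Sum>i\<le>2 * n. quantum_integral_deg n M A \<omega> i (deg_part i (koszul A \<omega> \<alpha>))) = 0"
  "(\<Sum>i\<le>2 * n. quantum_integral_deg n M A \<omega> i (deg_part i (- koszul A \<omega> \<alpha>))) = 0"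
proof -
  note * = quantum_integral_exact[of "j - 1" "koszul A \<omega> \<alpha>", OF _ koszul_exact]
  show "(\<Sum>i\<le>2 * n. quantum_integral_deg n M A \<omega> i (deg_part i (koszul A \<omega> \<alpha>))) = 0"
    using *[of 1] koszul_degree by simp
  have "- koszul A \<omega> \<alpha> = (\<lambda>c x. fscale (-1) (koszul A \<omega> \<alpha> c x))"
    by (simp add: fun_eq_iff uminus_apply)
  then show "(\<Sum>i\<le>2 * n. quantum_integral_deg n M A \<omega> i (deg_part i (- koszul A \<omega> \<alpha>))) = 0"
    using *[of "-1"] koszul_degree by (simp only:) blast
qed

end

end

text \<open>\<open>map_poly\<close> acts coefficientwise on \<open>pCons\<close> for maps that send
  0 to 0.\<close>

lemma ext_d_zero: "ext_d A 0 = 0"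
  by (simp add: ext_d_def fun_eq_iff zero_fun_apply)

lemma koszul_zero: "koszul A \<omega> 0 = 0"
proof -
  have "poisson_contract \<omega> 0 = 0"
    by (simp add: poisson_contract_def fun_eq_iff zero_fun_apply contract_apply)
  then show ?thesis by (simp add: koszul_def ext_d_zero)
qed

theorem theorem0p1:
  fixes M :: "'a topology" and A :: "('a, 'm::finite) chart set"
    and \<omega> \<alpha> :: "('a, 'm) form" and n j :: nat
  assumes "closed_symplectic_manifold n M A \<omega>"
    and "\<alpha> \<in> Omega A j"
  shows "quantum_integral n M A \<omega> [:ext_d A \<alpha>:] = 0
       \<and> quantum_integral n M A \<omega> (pCons 0 [:koszul A \<omega> \<alpha>:]) = 0
       \<and> quantum_integral n M A \<omega> (quantum_d A \<omega> [:\<alpha>:]) = 0"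
proof -
  interpret closed_symplectic_manifold n M A \<omega> by fact
  let ?Q = "\<lambda>\<gamma>. \<Sum>i\<le>2 * n. quantum_integral_deg n M A \<omega> i (deg_part i \<gamma>)"
  note Q = quantum_integral_ext_d[OF assms(2)] quantum_integral_koszul[OF assms(2)]
  \<comment> \<open>The zero form is the differential of the zero form, so its integral is the exact
    case once more.\<close>
  have Q0: "?Q 0 = 0"
    using quantum_integral_ext_d[OF Omega_zero] by (simp only: ext_d_zero)
  have "quantum_d A \<omega> [:\<alpha>:] = [:ext_d A \<alpha>:] - pCons 0 [:koszul A \<omega> \<alpha>:]"
    by (simp only: quantum_d_def map_poly_pCons[of "ext_d A", OF ext_d_zero]
        map_poly_pCons[of "koszul A \<omega>", OF koszul_zero] map_poly_0)
  \<comment> \<open>The two terms are coefficients of different powers of h, so the integral treats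
    them one by one; the second coefficient is the negative of \<delta>\<alpha>.\<close>
  also have "\<dots> = [:ext_d A \<alpha>, - koszul A \<omega> \<alpha>:]" by simp
  finally show ?thesis
    by (simp only: quantum_integral_def map_poly_pCons[of ?Q, OF Q0] map_poly_0 Q Q0 pCons_0_0)
qed

end
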